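(* Let $d>1$ be an integer. There are constants $c,C>0$ depending only on $d$ such that for every finite nonempty monotone index set $\Lambda\subset\mathbb{N}^d$ the best (largest) constant $c_\Lambda$ for which $$c_\Lambda\sum_{\beta\in\Lambda}2^{2|\beta|_\infty}\|s_\beta\|_{L_2}^2\le\Big\|\sum_{\beta\in\Lambda}s_\beta\Big\|_{H_0^1}^2$$ holds for all choices of $s_\beta\in S_\beta$, $\beta\in\Lambda$, satisfies $$c\,\tilde n'_\Lambda\le c_\Lambda^{-1}\le C\,\tilde n_\Lambda,$$ where $$\tilde n'_\Lambda:=\max_{\beta\in\Lambda}2^{|\beta|_1-|\beta|_\infty},\qquad \tilde n_\Lambda:=\sum_{k=1}^{k_\Lambda}\sum_{\beta\in\Lambda_{k,0}}2^{|\beta|_1-|\beta|_\infty},$$ with $k_\Lambda=\max_{\beta\in\Lambda}|\beta|_\infty$, $\Lambda_k=\{\beta\in\Lambda:\ |\beta|_\infty=k\}$, and $\Lambda_{k,0}$ the set of maximal elements of $\Lambda_k$, i.e. those $\beta\in\Lambda_k$ such that $\beta'\in\Lambda_k$ and $\beta'\ge\beta$ imply $\beta'=\beta$.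
   Context: Notation: $\mathbb{N}=\{1,2,3,\dots\}$, $I=[0,1]$, $I^d$ is the $d$-dimensional unit cube, $L_2=L_2(I^d)$. For $\beta\in\mathbb{N}^d$, $|\beta|_1=\sum_{i=1}^d\beta_i$ and $|\beta|_\infty=\max_i\beta_i$; $\beta'\le\beta$ means $\beta'_i\le\beta_i$ for all $i$. The $H^1_0$ norm is $\|u\|_{H_0^1}^2=\int_{I^d}|\nabla u|^2\,dx$. A set $\Lambda\subset\mathbb{N}^d$ is monotone if $\beta\in\Lambda$, $\beta'\in\mathbb{N}^d$ and $\beta'\le\beta$ imply $\beta'\in\Lambda$. Faber-Schauder blocks: let $\phi(t)=(1-|t|)_+$ for $t\in\mathbb{R}$. For $k\in\mathbb{N}$ and $i=0,1,\dots,2^{k-1}-1$ put $\phi_{2^{k-1}+i}(t)=\phi(2^kt-(2i+1))$, $t\in[0,1]$, and let $J_k=\{2^{k-1},\dots,2^k-1\}$. For $\alpha\in\mathbb{N}^d$ put $\phi_\alpha(x)=\prod_{i=1}^d\phi_{\alpha_i}(x_i)$, and for $\beta\in\mathbb{N}^d$ put $J_\beta=J_{\beta_1}\times\dots\times J_{\beta_d}$ and $S_\beta=\mathrm{span}\{\phi_\alpha:\alpha\in J_\beta\}$. *)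

theory Defs
  imports "HOL-Analysis.Analysis" "HOL-Library.Log_Nat"
begin

(* Multi-indices in N^d, N = {1,2,...}, are functions 'd => nat with all values >= 1, where d = CARD('d).
   Their componentwise order is the library order on functions. *)

definition norm_one :: "('d::finite \<Rightarrow> nat) \<Rightarrow> nat" where
  "norm_one \<beta> = (\<Sum>i\<in>UNIV. \<beta> i)"

definition norm_max :: "('d::finite \<Rightarrow> nat) \<Rightarrow> nat" where
  "norm_max \<beta> = Max (range \<beta>)"

definition multi_indices :: "('d::finite \<Rightarrow> nat) set" where
  "multi_indices = {\<beta>. \<forall>i. 1 \<le> \<beta> i}"

definition monotone_index_set :: "('d::finite \<Rightarrow> nat) set \<Rightarrow> bool" where
  "monotone_index_set \<Lambda> \<longleftrightarrow> \<Lambda> \<subseteq> multi_indices \<and>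
     (\<forall>\<beta>\<in>\<Lambda>. \<forall>\<beta>'\<in>multi_indices. \<beta>' \<le> \<beta> \<longrightarrow> \<beta>' \<in> \<Lambda>)"

definition hat :: "real \<Rightarrow> real" where
  "hat t = max 0 (1 - \<bar>t\<bar>)"

(* For m >= 1, k = floorlog 2 m is the number of binary digits of m, i.e. the unique k >= 1
   with m = 2^(k-1) + i and 0 <= i < 2^(k-1). The functions are extended from [0,1] to the
   real line by the same formula, which gives 0 outside [0,1]. *)
definition faber_schauder :: "nat \<Rightarrow> real \<Rightarrow> real" where
  "faber_schauder m t =
     (let k = floorlog 2 m; i = m - 2 ^ (k - 1) in hat (2 ^ k * t - (2 * real i + 1)))"

lemma faber_schauder_eq:
  assumes "1 \<le> k" and "i < 2 ^ (k - 1)"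
  shows "faber_schauder (2 ^ (k - 1) + i) t = hat (2 ^ k * t - (2 * real i + 1))"
proof -
  have "(2::nat) ^ k = 2 * 2 ^ (k - 1)"
    using assms(1) by (cases k) auto
  then have "floorlog 2 (2 ^ (k - 1) + i) \<le> k"
    using assms(2) by (intro floorlog_leI) auto
  moreover have "k \<le> floorlog 2 (2 ^ (k - 1) + i)"
    by (intro floorlog_geI) auto
  ultimately have "floorlog 2 (2 ^ (k - 1) + i) = k"
    by simp
  then show ?thesis
    by (simp add: faber_schauder_def)
qed

definition level_indices :: "nat \<Rightarrow> nat set" where
  "level_indices k = {2 ^ (k - 1)..2 ^ k - 1}"

definition tensor_faber_schauder :: "('d::finite \<Rightarrow> nat) \<Rightarrow> real ^ 'd \<Rightarrow> real" where
  "tensor_faber_schauder \<alpha> x = (\<Prod>i\<in>UNIV. faber_schauder (\<alpha> i) (x $ i))"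

definition block_indices :: "('d::finite \<Rightarrow> nat) \<Rightarrow> ('d \<Rightarrow> nat) set" where
  "block_indices \<beta> = {\<alpha>. \<forall>i. \<alpha> i \<in> level_indices (\<beta> i)}"

(* Linear span, written out: the family is finite, and the function type
   is not an instance of real_vector. *)
definition block_space :: "('d::finite \<Rightarrow> nat) \<Rightarrow> (real ^ 'd \<Rightarrow> real) set" where
  "block_space \<beta> =
     {\<lambda>x. \<Sum>\<alpha>\<in>block_indices \<beta>. a \<alpha> * tensor_faber_schauder \<alpha> x | a. True}"

definition unit_cube :: "(real ^ 'd) set" where
  "unit_cube = {x. \<forall>i. 0 \<le> x $ i \<and> x $ i \<le> 1}"

definition L2_norm :: "(real ^ 'd::finite \<Rightarrow> real) \<Rightarrow> real" where
  "L2_norm u = sqrt (LINT x:unit_cube|lebesgue. (u x)\<^sup>2)"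

(* Unspecified where u is not differentiable; for the piecewise polynomial, continuous functions
   considered here this is a null set, and elsewhere it is the weak gradient. *)
definition gradient :: "(real ^ 'd::finite \<Rightarrow> real) \<Rightarrow> real ^ 'd \<Rightarrow> real ^ 'd" where
  "gradient u x = (SOME D. GDERIV u x :> D)"

definition H10_norm :: "(real ^ 'd::finite \<Rightarrow> real) \<Rightarrow> real" where
  "H10_norm u = sqrt (LINT x:unit_cube|lebesgue. (norm (gradient u x))\<^sup>2)"

definition stable_with :: "('d::finite \<Rightarrow> nat) set \<Rightarrow> real \<Rightarrow> bool" where
  "stable_with \<Lambda> c \<longleftrightarrow>
     (\<forall>s. (\<forall>\<beta>\<in>\<Lambda>. s \<beta> \<in> block_space \<beta>) \<longrightarrow>
        c * (\<Sum>\<beta>\<in>\<Lambda>. 2 ^ (2 * norm_max \<beta>) * (L2_norm (s \<beta>))\<^sup>2)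
          \<le> (H10_norm (\<lambda>x. \<Sum>\<beta>\<in>\<Lambda>. s \<beta> x))\<^sup>2)"

definition is_best_constant :: "('d::finite \<Rightarrow> nat) set \<Rightarrow> real \<Rightarrow> bool" where
  "is_best_constant \<Lambda> c \<longleftrightarrow> stable_with \<Lambda> c \<and> (\<forall>c'. stable_with \<Lambda> c' \<longrightarrow> c' \<le> c)"

definition max_level :: "('d::finite \<Rightarrow> nat) set \<Rightarrow> nat" where
  "max_level \<Lambda> = Max (norm_max ` \<Lambda>)"

definition level_set :: "('d::finite \<Rightarrow> nat) set \<Rightarrow> nat \<Rightarrow> ('d \<Rightarrow> nat) set" where
  "level_set \<Lambda> k = {\<beta>\<in>\<Lambda>. norm_max \<beta> = k}"

definition maximal_level_set :: "('d::finite \<Rightarrow> nat) set \<Rightarrow> nat \<Rightarrow> ('d \<Rightarrow> nat) set" where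
  "maximal_level_set \<Lambda> k =
     {\<beta>\<in>level_set \<Lambda> k. \<forall>\<beta>'\<in>level_set \<Lambda> k. \<beta> \<le> \<beta>' \<longrightarrow> \<beta>' = \<beta>}"

(* The natural-number subtractions below do not truncate, as norm_max \<beta> \<le> norm_one \<beta>. *)

definition n_tilde' :: "('d::finite \<Rightarrow> nat) set \<Rightarrow> nat" where
  "n_tilde' \<Lambda> = Max ((\<lambda>\<beta>. 2 ^ (norm_one \<beta> - norm_max \<beta>)) ` \<Lambda>)"

definition n_tilde :: "('d::finite \<Rightarrow> nat) set \<Rightarrow> nat" where
  "n_tilde \<Lambda> =
     (\<Sum>k=1..max_level \<Lambda>. \<Sum>\<beta>\<in>maximal_level_set \<Lambda> k. 2 ^ (norm_one \<beta> - norm_max \<beta>))"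

end

(*
  Idea.  Expand u = sum of s_beta in the tensor Faber-Schauder functions; both norms become tensor
  products of one-dimensional quadratic forms: the mass matrix, and the stiffness matrix, which is
  diagonal because the derivatives are orthogonal Haar functions.

  Upper estimate.  Orthonormalising the one-dimensional system level by level yields L2-orthogonal
  components w_beta', beta' in Lambda (by monotonicity), with
    sum over beta' of 4^|beta'|_max ||w_beta'||^2 <= C ||u||^2 in H_0^1.
  The block s_beta collects contributions from the w_beta' with beta' >= beta only; interpolation of
  w_beta' at level beta costs a factor 2^(|beta'|_1 - |beta|_1) in the squared L2 norm.
  Cauchy-Schwarz with the weights 2^|beta'|_1 / 4^|beta'|_max and geometric sums, first over
  beta <= beta' and then over the indices below each maximal element, give n_tilde.

  Lower estimate.  Test with the product of the nodal hats at 1/2 of levels beta_i.  All its blocks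
  lie in Lambda, and the block that is coarse in every direction but a maximal one is large.
*)
theory Submission
  imports Defs
begin

section \<open>Tensor products and Cholesky factors of quadratic forms\<close>

text \<open>The obstacle is that the blocks are not \<open>L_2\<close>-orthogonal to each other,
  while extracting a block means evaluating at grid points, which the \<open>L_2\<close> norm does
  not control uniformly in the level. The orthonormal system separates the two issues. Its change of
  basis is triangular in both directions, so an orthonormal coefficient sees only basis functions of
  the same or finer levels, and a Faber-Schauder coefficient sees only orthonormal components of the
  same or finer levels. The energy bound for the orthonormal components is proved one direction at a
  time: the mass form is kept in the other directions, and in direction \<open>j\<close> a
  one-dimensional estimate bounds the orthonormal coefficients weighted by \<open>4 ^ level\<close>
  by the diagonal stiffness form. Comparisons between one-dimensional sums of squares survive
  tensoring with further sums of squares, so the only genuinely multivariate analysis is Fubini and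
  the gradient formula. The test function is effective because refining a nodal hat at 1/2 shrinks
  its mass but leaves its coarse coefficients unchanged.\<close>

lemma sum_PiE_insert:
  assumes "i \<notin> I" "finite I"
  shows "(\<Sum>x\<in>PiE (insert i I) A. f x) = (\<Sum>m\<in>A i. \<Sum>x\<in>PiE I A. f (x(i:=m)))"
proof -
  have "(\<Sum>x\<in>PiE (insert i I) A. f x) = (\<Sum>(m,x)\<in>A i \<times> PiE I A. f (x(i:=m)))"
    unfolding PiE_insert_eq
    by (subst sum.reindex) (use inj_combinator[OF assms(1), of A] in \<open>auto simp: case_prod_unfold\<close>)
  then show ?thesis by (simp add: sum.cartesian_product)
qed

text \<open>This is monotonicity of tensor products of positive semidefinite forms. A
  one-dimensional comparison can be used in one direction with all other indices as parameters, so
  \<open>M\<close> is exchanged for \<open>M'\<close> coordinate by coordinate. The output index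
  sets \<open>B\<close> and \<open>B'\<close> may differ.\<close>

lemma tensor_sum_squares_le:
  fixes M M' :: "'i \<Rightarrow> 'a \<Rightarrow> 'b \<Rightarrow> real"
  assumes "finite I"
    and "\<And>i c. i \<in> I \<Longrightarrow> (\<Sum>n\<in>B i. (\<Sum>m\<in>A i. c m * M i m n)\<^sup>2) \<le> (\<Sum>n\<in>B' i. (\<Sum>m\<in>A i. c m * M' i m n)\<^sup>2)"
  shows "(\<Sum>g\<in>PiE I B. (\<Sum>x\<in>PiE I A. a x * (\<Prod>i\<in>I. M i (x i) (g i)))\<^sup>2)
       \<le> (\<Sum>g\<in>PiE I B'. (\<Sum>x\<in>PiE I A. a x * (\<Prod>i\<in>I. M' i (x i) (g i)))\<^sup>2)"
  using assms
proof (induction I arbitrary: a rule: finite_induct)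
  case empty
  then show ?case by simp
next
  case (insert i I)
  have prod_eq: "(\<Prod>l\<in>insert i I. N l ((x(i:=m)) l) ((g(i:=n)) l)) = N i m n * (\<Prod>l\<in>I. N l (x l) (g l))"
    for N :: "'i \<Rightarrow> 'a \<Rightarrow> 'b \<Rightarrow> real" and x g m n
    using insert.hyps by (auto intro!: prod.cong)
  have expand: "(\<Sum>x\<in>PiE (insert i I) A. a x * (\<Prod>l\<in>insert i I. N l (x l) ((g(i:=n)) l)))
      = (\<Sum>m\<in>A i. (\<Sum>x\<in>PiE I A. a (x(i:=m)) * (\<Prod>l\<in>I. N l (x l) (g l))) * N i m n)"
    for N :: "'i \<Rightarrow> 'a \<Rightarrow> 'b \<Rightarrow> real" and g n
    unfolding sum_PiE_insert[OF insert.hyps(2,1)] prod_eq by (simp add: sum_distrib_left sum_distrib_right mult_ac)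
  have swap: "(\<Sum>m\<in>A i. (\<Sum>x\<in>PiE I A. a (x(i:=m)) * p x) * c m)
     = (\<Sum>x\<in>PiE I A. (\<Sum>m\<in>A i. a (x(i:=m)) * c m) * p x)"
    for p c
    unfolding sum_distrib_left sum_distrib_right by (subst sum.swap) (simp add: mult_ac)
  have "(\<Sum>g\<in>PiE (insert i I) B. (\<Sum>x\<in>PiE (insert i I) A. a x * (\<Prod>i\<in>insert i I. M i (x i) (g i)))\<^sup>2)
     = (\<Sum>g\<in>PiE I B. \<Sum>n\<in>B i. (\<Sum>m\<in>A i. (\<Sum>x\<in>PiE I A. a (x(i:=m)) * (\<Prod>l\<in>I. M l (x l) (g l))) * M i m n)\<^sup>2)"
    unfolding sum_PiE_insert[OF insert.hyps(2,1), where A=B] expand by (rule sum.swap)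
  also have "\<dots> \<le> (\<Sum>g\<in>PiE I B. \<Sum>n\<in>B' i. (\<Sum>m\<in>A i. (\<Sum>x\<in>PiE I A. a (x(i:=m)) * (\<Prod>l\<in>I. M l (x l) (g l))) * M' i m n)\<^sup>2)"
    by (intro sum_mono insert.prems) auto
  also have "\<dots> = (\<Sum>n\<in>B' i. \<Sum>g\<in>PiE I B. (\<Sum>x\<in>PiE I A. (\<Sum>m\<in>A i. a (x(i:=m)) * M' i m n) * (\<Prod>l\<in>I. M l (x l) (g l)))\<^sup>2)"
    by (subst sum.swap) (simp only: swap)
  \<comment> \<open>For fixed \<open>n\<close> direction \<open>i\<close> is now absorbed into the
    coefficients of \<open>x\<close>, which is why the induction leaves \<open>a\<close>
    arbitrary.\<close>
  also have "\<dots> \<le> (\<Sum>n\<in>B' i. \<Sum>g\<in>PiE I B'. (\<Sum>x\<in>PiE I A. (\<Sum>m\<in>A i. a (x(i:=m)) * M' i m n) * (\<Prod>l\<in>I. M' l (x l) (g l)))\<^sup>2)"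
    by (intro sum_mono insert.IH insert.prems) auto
  also have "\<dots> = (\<Sum>g\<in>PiE (insert i I) B'. (\<Sum>x\<in>PiE (insert i I) A. a x * (\<Prod>i\<in>insert i I. M' i (x i) (g i)))\<^sup>2)"
    unfolding sum_PiE_insert[OF insert.hyps(2,1), where A=B'] expand swap ..
  finally show ?case .
qed

text \<open>Induction by bordering: with \<open>g\<close> the new column of \<open>G\<close>, the
  new row of the factor is \<open>t = U g\<close>, and the new diagonal entry is the square root of
  the Schur complement. Carrying the two-sided inverse \<open>U\<close> along makes \<open>t\<close>
  explicit. Hypothesis \<open>pos\<close> is positivity on vectors with nonzero last entry, which is
  what the Schur complement needs.\<close>

lemma cholesky:
  fixes G :: "nat \<Rightarrow> nat \<Rightarrow> real"
  assumes sym: "\<And>m n. G m n = G n m"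
    and pos: "\<And>n a. a n \<noteq> 0 \<Longrightarrow> 1 \<le> n \<Longrightarrow> 0 < (\<Sum>l\<in>{1..n}. \<Sum>m\<in>{1..n}. a l * a m * G l m)"
  shows "\<exists>T U. (\<forall>m\<in>{1..N}. \<forall>n\<in>{1..N}. G m n = (\<Sum>l\<in>{1..N}. T m l * T n l)) \<and>
    (\<forall>m\<in>{1..N}. \<forall>n\<in>{1..N}. (\<Sum>l\<in>{1..N}. T m l * U l n) = (if m = n then 1 else 0)) \<and>
    (\<forall>m\<in>{1..N}. \<forall>n\<in>{1..N}. (\<Sum>l\<in>{1..N}. U m l * T l n) = (if m = n then 1 else 0)) \<and>
    (\<forall>m n. m < n \<longrightarrow> T m n = 0) \<and> (\<forall>m n. m < n \<longrightarrow> U m n = (0::real))"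
proof (induction N)
  case 0
  show ?case by (intro exI[of _ "\<lambda>_ _. 0"]) simp
next
  case (Suc N)
  then obtain T U where H:
    "\<forall>m\<in>{1..N}. \<forall>n\<in>{1..N}. G m n = (\<Sum>l\<in>{1..N}. T m l * T n l)"
    "\<forall>m\<in>{1..N}. \<forall>n\<in>{1..N}. (\<Sum>l\<in>{1..N}. T m l * U l n) = (if m = n then 1 else 0)"
    "\<forall>m\<in>{1..N}. \<forall>n\<in>{1..N}. (\<Sum>l\<in>{1..N}. U m l * T l n) = (if m = n then 1 else 0)"
    "\<forall>m n. m < n \<longrightarrow> T m n = 0" "\<forall>m n. m < n \<longrightarrow> U m n = 0"
    by (elim exE conjE) (rule that)
  have G: "(\<Sum>l\<in>{1..N}. T m l * T n l) = G m n"
    and TU: "(\<Sum>l\<in>{1..N}. T m l * U l n) = (if m = n then 1 else 0)"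
    and UT: "(\<Sum>l\<in>{1..N}. U m l * T l n) = (if m = n then 1 else 0)"
    if "m\<in>{1..N}" "n\<in>{1..N}" for m n
    using H(1-3) that by auto
  have tri: "T m n = 0" "U m n = 0" if "m < n" for m n
    using H(4,5) that by auto
  note [simp del] = One_nat_def
  let ?R = "{1..N}"
  define t where "t n = (\<Sum>m\<in>?R. U n m * G m (Suc N))" for n
  define x where "x m = (\<Sum>n\<in>?R. t n * U n m)" for m
  have Tt: "(\<Sum>n\<in>?R. T m n * t n) = G m (Suc N)" if "m \<in> ?R" for m
  proof -
    have "(\<Sum>n\<in>?R. T m n * t n) = (\<Sum>l\<in>?R. (\<Sum>n\<in>?R. T m n * U n l) * G l (Suc N))"
      unfolding t_def sum_distrib_left sum_distrib_right by (subst sum.swap) (simp add: mult_ac)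
    also have "\<dots> = (\<Sum>l\<in>?R. if m = l then G l (Suc N) else 0)"
      using that by (intro sum.cong refl) (simp add: TU)
    finally show ?thesis using that by simp
  qed
  have xT: "(\<Sum>m\<in>?R. x m * T m n) = t n" if "n \<in> ?R" for n
  proof -
    have "(\<Sum>m\<in>?R. x m * T m n) = (\<Sum>l\<in>?R. t l * (\<Sum>m\<in>?R. U l m * T m n))"
      unfolding x_def sum_distrib_left sum_distrib_right by (subst sum.swap) (simp add: mult_ac)
    also have "\<dots> = (\<Sum>l\<in>?R. if l = n then t l else 0)"
      using that by (intro sum.cong refl) (simp add: UT)
    finally show ?thesis using that by simp
  qed
  have xG: "(\<Sum>m\<in>?R. x m * G m (Suc N)) = (\<Sum>n\<in>?R. (t n)\<^sup>2)"
  proof -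
    have "(\<Sum>m\<in>?R. x m * G m (Suc N)) = (\<Sum>n\<in>?R. t n * (\<Sum>m\<in>?R. U n m * G m (Suc N)))"
      unfolding x_def sum_distrib_left sum_distrib_right by (subst sum.swap) (simp add: mult_ac)
    then show ?thesis by (simp add: t_def power2_eq_square)
  qed
  have xxG: "(\<Sum>l\<in>?R. \<Sum>m\<in>?R. x l * x m * G l m) = (\<Sum>n\<in>?R. (t n)\<^sup>2)"
  proof -
    have "(\<Sum>l\<in>?R. \<Sum>m\<in>?R. x l * x m * G l m) = (\<Sum>l\<in>?R. \<Sum>m\<in>?R. \<Sum>n\<in>?R. (x l * T l n) * (x m * T m n))"
      by (intro sum.cong refl) (simp add: G[symmetric] sum_distrib_left mult_ac)
    also have "\<dots> = (\<Sum>l\<in>?R. \<Sum>n\<in>?R. \<Sum>m\<in>?R. (x l * T l n) * (x m * T m n))"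
      by (rule sum.cong[OF refl], rule sum.swap)
    also have "\<dots> = (\<Sum>n\<in>?R. \<Sum>l\<in>?R. \<Sum>m\<in>?R. (x l * T l n) * (x m * T m n))"
      by (rule sum.swap)
    also have "\<dots> = (\<Sum>n\<in>?R. (\<Sum>l\<in>?R. x l * T l n) * (\<Sum>m\<in>?R. x m * T m n))"
      by (simp add: sum_product)
    also have "\<dots> = (\<Sum>n\<in>?R. (t n)\<^sup>2)"
      by (intro sum.cong refl) (simp only: xT power2_eq_square)
    finally show ?thesis .
  qed
  define d2 where "d2 = G (Suc N) (Suc N) - (\<Sum>n\<in>?R. (t n)\<^sup>2)"
  have "d2 > 0"
  proof -
    \<comment> \<open>The vector \<open>x\<close> solves \<open>x G = g\<close> on the old block, so
      the form at \<open>(-x, 1)\<close> is exactly the Schur complement \<open>d2\<close>.\<close>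
    define y where "y m = (if m = Suc N then 1 else - x m)" for m
    have "0 < (\<Sum>l\<in>{1..Suc N}. \<Sum>m\<in>{1..Suc N}. y l * y m * G l m)"
      by (rule pos) (auto simp: y_def)
    also have "\<dots> = (\<Sum>l\<in>?R. \<Sum>m\<in>?R. y l * y m * G l m) + (\<Sum>l\<in>?R. y l * y (Suc N) * G l (Suc N))
        + ((\<Sum>m\<in>?R. y (Suc N) * y m * G (Suc N) m) + y (Suc N) * y (Suc N) * G (Suc N) (Suc N))"
      by (simp add: sum.distrib)
    also have "(\<Sum>l\<in>?R. \<Sum>m\<in>?R. y l * y m * G l m) = (\<Sum>l\<in>?R. \<Sum>m\<in>?R. x l * x m * G l m)"
      by (intro sum.cong refl) (auto simp: y_def)
    also have "(\<Sum>l\<in>?R. y l * y (Suc N) * G l (Suc N)) = - (\<Sum>l\<in>?R. x l * G l (Suc N))"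
      unfolding sum_negf[symmetric] by (intro sum.cong refl) (auto simp: y_def)
    also have "(\<Sum>m\<in>?R. y (Suc N) * y m * G (Suc N) m) = - (\<Sum>l\<in>?R. x l * G l (Suc N))"
      unfolding sum_negf[symmetric] by (intro sum.cong refl) (auto simp: y_def sym)
    finally show ?thesis by (simp add: xG xxG d2_def y_def)
  qed
  define d where "d = sqrt d2"
  have d: "d > 0" "d * d = d2" using \<open>d2 > 0\<close> by (auto simp: d_def)
  define T' where "T' m n = (if m = Suc N then (if n = Suc N then d else if n \<in> ?R then t n else 0) else T m n)" for m n
  define U' where "U' m n = (if m = Suc N then (if n = Suc N then 1/d else if n \<in> ?R then - x n / d else 0) else U m n)" for m n
  have R: "m \<in> ?R \<Longrightarrow> m \<noteq> Suc N" for m by auto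
  have ins: "{1..Suc N} = insert (Suc N) ?R" "Suc N \<notin> ?R" "finite ?R" by auto
  have z: "m \<in> ?R \<Longrightarrow> T m (Suc N) = 0" "m \<in> ?R \<Longrightarrow> U m (Suc N) = 0" for m using tri by auto
  have TU0: "(\<Sum>l\<in>?R. t l * U l n) = x n" for n by (simp add: x_def)
  have s1: "(\<Sum>l\<in>?R. T' m l * T' n l) = (\<Sum>l\<in>?R. T m l * T n l)" if "m \<in> ?R" "n \<in> ?R" for m n
    using that by (intro sum.cong refl) (auto simp: T'_def)
  have s2: "(\<Sum>l\<in>?R. T' m l * T' (Suc N) l) = (\<Sum>l\<in>?R. T m l * t l)" "(\<Sum>l\<in>?R. T' (Suc N) l * T' m l) = (\<Sum>l\<in>?R. T m l * t l)" if "m \<in> ?R" for m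
    using that by (auto intro!: sum.cong simp: T'_def)
  have s3: "(\<Sum>l\<in>?R. T' (Suc N) l * T' (Suc N) l) = (\<Sum>l\<in>?R. (t l)\<^sup>2)"
    by (intro sum.cong refl) (auto simp: T'_def power2_eq_square)
  have g1: "(\<Sum>l\<in>{1..Suc N}. T' m l * T' n l) = G m n" if "m\<in>{1..Suc N}" "n\<in>{1..Suc N}" for m n
  proof -
    have "m = Suc N \<or> m \<in> ?R" "n = Suc N \<or> n \<in> ?R" using that by auto
    then show ?thesis
      unfolding ins(1) sum.insert[OF ins(3,2)]
      by (elim disjE) (simp_all only: s1 s2 s3 Tt G, auto simp: T'_def d d2_def z sym)
  qed
  have g2: "(\<Sum>l\<in>{1..Suc N}. T' m l * U' l n) = (if m = n then 1 else 0)" if "m\<in>{1..Suc N}" "n\<in>{1..Suc N}" for m n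
  proof -
    have a1: "(\<Sum>l\<in>?R. T' m l * U' l n) = (\<Sum>l\<in>?R. T m l * U l n)" if "m \<in> ?R" for m n
      using that by (intro sum.cong refl) (auto simp: T'_def U'_def)
    have a2: "(\<Sum>l\<in>?R. T' (Suc N) l * U' l n) = x n" for n
      unfolding x_def by (intro sum.cong refl) (auto simp: T'_def U'_def)
    have a3: "(\<Sum>l\<in>?R. T m l * U l (Suc N)) = 0" for m by (intro sum.neutral) (auto simp: z)
    have a4: "x (Suc N) = 0" unfolding x_def by (intro sum.neutral) (auto simp: z)
    have "m = Suc N \<or> m \<in> ?R" "n = Suc N \<or> n \<in> ?R" using that by auto
    then show ?thesis
      unfolding ins(1) sum.insert[OF ins(3,2)]
      using d(1) by (elim disjE) (simp_all only: a1 a2 a3 a4 TU, auto simp: T'_def U'_def z)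
  qed
  have g3: "(\<Sum>l\<in>{1..Suc N}. U' m l * T' l n) = (if m = n then 1 else 0)" if "m\<in>{1..Suc N}" "n\<in>{1..Suc N}" for m n
  proof -
    have a1: "(\<Sum>l\<in>?R. U' m l * T' l n) = (\<Sum>l\<in>?R. U m l * T l n)" if "m \<in> ?R" for m n
      using that by (intro sum.cong refl) (auto simp: T'_def U'_def)
    have a2: "(\<Sum>l\<in>?R. U' (Suc N) l * T' l n) = - (\<Sum>l\<in>?R. x l * T l n) / d" for n
      unfolding sum_negf[symmetric] sum_divide_distrib by (intro sum.cong refl) (auto simp: T'_def U'_def)
    have a3: "(\<Sum>l\<in>?R. U m l * T l (Suc N)) = 0" for m by (intro sum.neutral) (auto simp: z)
    have a4: "(\<Sum>l\<in>?R. x l * T l (Suc N)) = 0" by (intro sum.neutral) (auto simp: z)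
    have "m = Suc N \<or> m \<in> ?R" "n = Suc N \<or> n \<in> ?R" using that by auto
    then show ?thesis
      unfolding ins(1) sum.insert[OF ins(3,2)]
      using d(1) by (elim disjE) (simp_all only: a1 a2 a3 a4 UT xT, auto simp: T'_def U'_def z)
  qed
  have "m < n \<Longrightarrow> T' m n = 0" "m < n \<Longrightarrow> U' m n = 0" for m n
    using tri by (auto simp: T'_def U'_def)
  then show ?case using g1 g2 g3 by (intro exI[of _ T'] exI[of _ U']) auto
qed

section \<open>Faber-Schauder functions in one dimension\<close>

abbreviation lev :: "nat \<Rightarrow> nat" where
  "lev m \<equiv> floorlog 2 m"

text \<open>The peak of \<open>faber_schauder m\<close> is at \<open>node m / 2 ^ lev m\<close>.
  This fraction is in lowest terms because the numerator is odd, which separates the levels.\<close>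

definition node :: "nat \<Rightarrow> nat" where
  "node m = 2 * (m - 2 ^ (lev m - 1)) + 1"

lemma fs_eq_hat: "faber_schauder m t = hat (2 ^ lev m * t - real (node m))"
  by (simp add: faber_schauder_def node_def Let_def add.commute)

lemma lev_bounds:
  assumes "1 \<le> m"
  shows "1 \<le> lev m" "2 ^ (lev m - 1) \<le> m" "m < 2 ^ lev m"
  using assms floorlog_bounds[of m 2] floorlog_geI[of 2 1 m] by auto

lemma mem_level_indices:
  assumes "1 \<le> m"
  shows "m \<in> level_indices k \<longleftrightarrow> lev m = k"
proof
  assume "lev m = k"
  then show "m \<in> level_indices k"
    using lev_bounds[OF assms] by (auto simp: level_indices_def)
next
  assume m: "m \<in> level_indices k"
  \<comment> \<open>By truncated subtraction \<open>level_indices 0\<close> is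
    \<open>{1..0}\<close>, hence empty.\<close>
  then have "k \<noteq> 0" using assms by (intro notI) (simp add: level_indices_def)
  have "m < 2 ^ k" using m by (auto simp: level_indices_def) (metis Suc_le_eq Suc_pred pos2 zero_less_power le_imp_less_Suc)
  then have "lev m \<le> k" by (intro floorlog_leI) auto
  moreover have "k \<le> lev m" using m by (intro floorlog_geI) (auto simp: level_indices_def)
  ultimately show "lev m = k" by simp
qed

lemma level_indices_pos: "m \<in> level_indices k \<Longrightarrow> 1 \<le> m"
  by (auto simp: level_indices_def intro: order_trans[rotated])

lemma level_indices_lev: "m \<in> level_indices k \<Longrightarrow> lev m = k"
  using level_indices_pos mem_level_indices by blast

lemma finite_level_indices: "finite (level_indices k)"
  by (simp add: level_indices_def)

lemma odd_node: "odd (node m)"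
  by (simp add: node_def)

lemma node_less:
  assumes "1 \<le> m"
  shows "node m + 1 \<le> 2 ^ lev m" "1 \<le> node m"
proof -
  have "2 ^ lev m = 2 * (2::nat) ^ (lev m - 1)"
    using lev_bounds(1)[OF assms] by (cases "lev m") auto
  then show "node m + 1 \<le> 2 ^ lev m"
    using lev_bounds[OF assms] by (simp add: node_def)
qed (simp add: node_def)

lemma node_inj:
  assumes "1 \<le> m" "1 \<le> n" "lev m = lev n" "node m = node n"
  shows "m = n"
  using assms lev_bounds(2)[OF assms(1)] lev_bounds(2)[OF assms(2)] by (simp add: node_def)

section \<open>Hat functions on dyadic grids\<close>

lemma hat_eq_0: "1 \<le> \<bar>t\<bar> \<Longrightarrow> hat t = 0"
  by (simp add: hat_def)

lemma hat_bounds: "0 \<le> hat t" "hat t \<le> 1"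
  by (simp_all add: hat_def)

lemma continuous_on_hat [continuous_intros]:
  "continuous_on S f \<Longrightarrow> continuous_on S (\<lambda>x. hat (f x))"
  unfolding hat_def by (intro continuous_intros)

lemma continuous_on_fs [continuous_intros]:
  "continuous_on S f \<Longrightarrow> continuous_on S (\<lambda>x. faber_schauder m (f x))"
  unfolding fs_eq_hat by (intro continuous_intros)

lemma hat_affine:
  fixes z :: int
  obtains A B where "\<And>t. real_of_int z \<le> t \<Longrightarrow> t \<le> real_of_int z + 1 \<Longrightarrow> hat t = A + B * t"
proof -
  consider "z \<ge> 1" | "z = 0" | "z = -1" | "z \<le> -2" by linarith
  then show ?thesis
  proof cases
    case 1
    then have "real_of_int z \<ge> 1" by linarith
    then show ?thesis by (intro that[of 0 0]) (auto simp: hat_def)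
  next
    case 2
    then show ?thesis by (intro that[of 1 "-1"]) (auto simp: hat_def)
  next
    case 3
    then show ?thesis by (intro that[of 1 1]) (auto simp: hat_def)
  next
    case 4
    then have "real_of_int z \<le> -2" by linarith
    then show ?thesis by (intro that[of 0 0]) (auto simp: hat_def)
  qed
qed

text \<open>Each cell of the grid of mesh \<open>1 / 2 ^ k\<close> lies in a single cell of the grid
  of mesh \<open>1 / 2 ^ lev m\<close>, where the function is affine. The number of that coarse cell
  is \<open>n = j div p\<close>.\<close>

lemma fs_affine:
  assumes "lev m \<le> k" "0 \<le> s" "s \<le> 1"
  shows "faber_schauder m ((real j + s) / 2 ^ k)
    = (1 - s) * faber_schauder m (real j / 2 ^ k) + s * faber_schauder m ((real j + 1) / 2 ^ k)"
proof -
  define p :: nat where "p = 2 ^ (k - lev m)"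
  define n where "n = j div p"
  have p: "p > 0" "(2::real) ^ k = 2 ^ lev m * real p"
    using assms(1) by (auto simp: p_def simp flip: power_add)
  have "n * p \<le> j" "j < (n + 1) * p"
    using p(1) div_times_less_eq_dividend[of j p] dividend_less_div_times[of p j] by (auto simp: n_def add.commute)
  then have "n * p \<le> j" "j + 1 \<le> (n + 1) * p" by auto
  then have "real (n * p) \<le> real j" "real (j + 1) \<le> real ((n + 1) * p)"
    using of_nat_le_iff by blast+
  then have jn: "real n * real p \<le> real j" "real j + 1 \<le> (real n + 1) * real p"
    by (auto simp: algebra_simps)
  obtain A B where AB: "\<And>t. real_of_int (int n - int (node m)) \<le> t \<Longrightarrow>
      t \<le> real_of_int (int n - int (node m)) + 1 \<Longrightarrow> hat t = A + B * t"
    using hat_affine by blast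
  have eq: "faber_schauder m ((real j + r) / 2 ^ k) = A + B * ((real j + r) / real p - real (node m))"
    if "0 \<le> r" "r \<le> 1" for r
  proof -
    have "real n \<le> (real j + r) / real p" "(real j + r) / real p \<le> real n + 1"
      using jn that p(1) by (auto simp: field_simps)
    then have "hat ((real j + r) / real p - real (node m)) = A + B * ((real j + r) / real p - real (node m))"
      by (intro AB) auto
    then show ?thesis
      by (simp add: fs_eq_hat p(2))
  qed
  have "faber_schauder m (real j / 2 ^ k) = A + B * (real j / real p - real (node m))"
    using eq[of 0] by simp
  then show ?thesis
    using p(1) by (simp only: eq[OF assms(2,3)] eq[of 1]) (simp add: field_simps)
qed

text \<open>At a point of a coarser grid the argument of \<open>hat\<close> is an even integer minus
  the odd \<open>node m\<close>, hence has absolute value at least 1.\<close>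

lemma fs_at_coarse_node:
  assumes "k < lev m"
  shows "faber_schauder m (real j / 2 ^ k) = 0"
proof -
  obtain e where e: "lev m = Suc e + k" using assms less_imp_Suc_add by (metis add.commute add_Suc)
  have "faber_schauder m (real j / 2 ^ k) = hat (real_of_int (2 * (2 ^ e * int j) - int (node m)))"
    by (simp add: fs_eq_hat e power_add)
  also have "\<dots> = 0"
  proof (rule hat_eq_0)
    have "odd (2 * (2 ^ e * int j) - int (node m))" using odd_node by simp
    then have "2 * (2 ^ e * int j) - int (node m) \<noteq> 0" by (metis even_zero)
    then have "1 \<le> \<bar>2 * (2 ^ e * int j) - int (node m)\<bar>" by linarith
    then show "1 \<le> \<bar>real_of_int (2 * (2 ^ e * int j) - int (node m))\<bar>" by linarith
  qed
  finally show ?thesis .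
qed

lemma fs_at_own_node:
  "faber_schauder m (real j / 2 ^ lev m) = (if j = node m then 1 else 0)"
proof (cases "j = node m")
  case False
  then have "1 \<le> \<bar>int j - int (node m)\<bar>" by linarith
  then have "1 \<le> \<bar>real_of_int (int j - int (node m))\<bar>" by linarith
  then show ?thesis using False by (simp add: fs_eq_hat hat_eq_0)
qed (simp add: fs_eq_hat hat_def)

text \<open>Minus one half of the second difference at the peak of \<open>faber_schauder m\<close>,
  with the endpoints of its support as neighbours. It is the coefficient functional dual to the
  basis.\<close>

definition hierarchical_surplus :: "nat \<Rightarrow> (real \<Rightarrow> real) \<Rightarrow> real" where
  "hierarchical_surplus m f = f (real (node m) / 2 ^ lev m)
     - (f (real (node m - 1) / 2 ^ lev m) + f (real (node m + 1) / 2 ^ lev m)) / 2"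

text \<open>A finer \<open>n\<close> vanishes at all three points. On the same level the neighbours
  of the peak are even multiples of the mesh width and hence no peaks. A coarser \<open>n\<close> is
  affine between the neighbours, so the second difference vanishes.\<close>

lemma surplus_fs:
  assumes "1 \<le> m" "1 \<le> n"
  shows "hierarchical_surplus m (faber_schauder n) = (if m = n then 1 else 0)"
proof -
  consider "lev m < lev n" | "lev m = lev n" | "lev n < lev m" by linarith
  then show ?thesis
  proof cases
    case 1
    then show ?thesis by (simp only: hierarchical_surplus_def fs_at_coarse_node) auto
  next
    case 2
    have "node m - 1 \<noteq> node n" "node m + 1 \<noteq> node n"
      using odd_node[of m] odd_node[of n] node_less(2)[OF assms(1)] by (metis even_plus_one_iff le_add_diff_inverse2)+
    moreover have "node m = node n \<longleftrightarrow> m = n" using node_inj assms 2 by auto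
    ultimately show ?thesis by (simp only: hierarchical_surplus_def 2 fs_at_own_node) auto
  next
    case 3
    obtain k where k: "lev m = Suc k" using 3 by (cases "lev m") auto
    define j where "j = m - 2 ^ (lev m - 1)"
    have j: "node m = 2 * j + 1" by (simp add: node_def j_def)
    have e: "real (node m) / 2 ^ lev m = (real j + 1/2) / 2 ^ k"
      "real (node m - 1) / 2 ^ lev m = real j / 2 ^ k"
      "real (node m + 1) / 2 ^ lev m = (real j + 1) / 2 ^ k"
      by (simp_all add: j k field_simps)
    have "faber_schauder n ((real j + 1/2) / 2 ^ k)
      = (1 - 1/2) * faber_schauder n (real j / 2 ^ k) + 1/2 * faber_schauder n ((real j + 1) / 2 ^ k)"
      using 3 k by (intro fs_affine) auto
    then have "hierarchical_surplus m (faber_schauder n) = 0"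
      by (simp only: hierarchical_surplus_def e) simp
    then show ?thesis using 3 by auto
  qed
qed

lemma surplus_sum:
  "hierarchical_surplus m (\<lambda>t. \<Sum>n\<in>F. a n * f n t) = (\<Sum>n\<in>F. a n * hierarchical_surplus m (f n))"
  by (simp add: hierarchical_surplus_def sum_subtractf right_diff_distrib sum.distrib sum_divide_distrib add_divide_distrib distrib_left)

section \<open>The mass matrix in one dimension\<close>

definition mass :: "nat \<Rightarrow> nat \<Rightarrow> real" where
  "mass m n = integral {0..1} (\<lambda>t. faber_schauder m t * faber_schauder n t)"

lemma mass_sym: "mass m n = mass n m"
  by (simp add: mass_def mult.commute)

lemma integral_square_sum:
  fixes f :: "nat \<Rightarrow> real \<Rightarrow> real"
  assumes "finite F" "\<And>m n. m \<in> F \<Longrightarrow> n \<in> F \<Longrightarrow> (\<lambda>t. f m t * f n t) integrable_on S"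
  shows "integral S (\<lambda>t. (\<Sum>m\<in>F. a m * f m t)\<^sup>2) = (\<Sum>m\<in>F. \<Sum>n\<in>F. a m * a n * integral S (\<lambda>t. f m t * f n t))"
proof -
  have "(\<lambda>t. (\<Sum>m\<in>F. a m * f m t)\<^sup>2) = (\<lambda>t. \<Sum>m\<in>F. \<Sum>n\<in>F. (a m * a n) * (f m t * f n t))"
    by (simp add: power2_eq_square sum_product mult_ac)
  then show ?thesis
    using assms by (simp add: integral_sum integrable_sum integrable_on_mult_right)
qed

lemma fs_mult_integrable: "(\<lambda>t. faber_schauder m t * faber_schauder n t) integrable_on {a..b}"
  by (intro integrable_continuous_real continuous_intros)

lemma mass_form:
  assumes "finite F"
  shows "(\<Sum>m\<in>F. \<Sum>n\<in>F. a m * a n * mass m n) = integral {0..1} (\<lambda>t. (\<Sum>m\<in>F. a m * faber_schauder m t)\<^sup>2)"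
  unfolding mass_def by (rule integral_square_sum[symmetric, OF assms fs_mult_integrable])

text \<open>The exact value exceeds the bound by \<open>(b - a) / 6 * (w a + w b)^2\<close>.\<close>

lemma integral_affine_square:
  fixes a b p q :: real
  assumes "a \<le> b" "\<And>t. a \<le> t \<Longrightarrow> t \<le> b \<Longrightarrow> w t = p + q * t"
  shows "integral {a..b} (\<lambda>t. (w t)\<^sup>2) \<ge> (b - a) / 6 * ((w a)\<^sup>2 + (w b)\<^sup>2)"
proof -
  have "((\<lambda>t. (p + q * t)\<^sup>2) has_integral
      (p\<^sup>2 * b + p * q * b\<^sup>2 + q\<^sup>2 * b ^ 3 / 3) - (p\<^sup>2 * a + p * q * a\<^sup>2 + q\<^sup>2 * a ^ 3 / 3)) {a..b}"
    by (rule fundamental_theorem_of_calculus[OF assms(1)])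
      (auto intro!: derivative_eq_intros simp: has_real_derivative_iff_has_vector_derivative[symmetric] power2_eq_square algebra_simps)
  then have "((\<lambda>t. (w t)\<^sup>2) has_integral
      (p\<^sup>2 * b + p * q * b\<^sup>2 + q\<^sup>2 * b ^ 3 / 3) - (p\<^sup>2 * a + p * q * a\<^sup>2 + q\<^sup>2 * a ^ 3 / 3)) {a..b}"
    by (rule has_integral_eq[rotated]) (simp add: assms(2))
  then have "integral {a..b} (\<lambda>t. (w t)\<^sup>2)
     = (p\<^sup>2 * b + p * q * b\<^sup>2 + q\<^sup>2 * b ^ 3 / 3) - (p\<^sup>2 * a + p * q * a\<^sup>2 + q\<^sup>2 * a ^ 3 / 3)"
    by (rule integral_unique)
  also have "\<dots> = (b - a) / 6 * ((w a)\<^sup>2 + (w b)\<^sup>2) + (b - a) / 6 * (w a + w b)\<^sup>2"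
    using assms by (simp add: power2_eq_square power3_eq_cube field_simps)
  finally show ?thesis using assms(1) by simp
qed

lemma nodal_integral_bound:
  fixes w :: "real \<Rightarrow> real"
  assumes "0 < N" and cont: "continuous_on UNIV w"
    and aff: "\<And>j s. 0 \<le> s \<Longrightarrow> s \<le> 1 \<Longrightarrow>
      w ((real j + s) / N) = (1 - s) * w (real j / N) + s * w ((real j + 1) / N)"
  shows "integral {0..real n / N} (\<lambda>t. (w t)\<^sup>2) \<ge>
    1 / (6 * N) * (\<Sum>j<n. (w (real j / N))\<^sup>2 + (w (real (Suc j) / N))\<^sup>2)"
proof (induction n)
  case (Suc n)
  have le: "0 \<le> real n / N" "real n / N \<le> real (Suc n) / N" using assms(1) by (auto simp: divide_right_mono)
  have "w t = (w (real n / N) - real n * (w ((real n + 1) / N) - w (real n / N))) + (N * (w ((real n + 1) / N) - w (real n / N))) * t"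
    if "real n / N \<le> t" "t \<le> real (Suc n) / N" for t
  proof -
    define s where "s = N * t - real n"
    have "0 \<le> s" "s \<le> 1" "t = (real n + s) / N" using that assms(1) by (auto simp: s_def field_simps)
    then have "w t = (1 - s) * w (real n / N) + s * w ((real n + 1) / N)"
      using aff[of s n] by simp
    then show ?thesis by (simp add: s_def algebra_simps)
  qed
  from integral_affine_square[OF le(2) this]
  have "integral {real n / N..real (Suc n) / N} (\<lambda>t. (w t)\<^sup>2) \<ge> (real (Suc n) / N - real n / N) / 6 * ((w (real n / N))\<^sup>2 + (w (real (Suc n) / N))\<^sup>2)"
    by blast
  also have "(real (Suc n) / N - real n / N) / 6 = 1 / (6 * N)" using assms(1) by (simp add: field_simps)
  finally have "integral {real n / N..real (Suc n) / N} (\<lambda>t. (w t)\<^sup>2) \<ge> 1 / (6 * N) * ((w (real n / N))\<^sup>2 + (w (real (Suc n) / N))\<^sup>2)" .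
  moreover have "integral {0..real n / N} (\<lambda>t. (w t)\<^sup>2) + integral {real n / N..real (Suc n) / N} (\<lambda>t. (w t)\<^sup>2)
      = integral {0..real (Suc n) / N} (\<lambda>t. (w t)\<^sup>2)"
    using le by (intro Henstock_Kurzweil_Integration.integral_combine integrable_continuous_real continuous_intros continuous_on_subset[OF cont]) auto
  ultimately show ?case using Suc.IH by (simp add: distrib_left)
qed simp

lemma surplus_square_le:
  "(hierarchical_surplus m w)\<^sup>2 \<le> 3 * ((w (real (node m) / 2 ^ lev m))\<^sup>2
     + (w (real (node m - 1) / 2 ^ lev m))\<^sup>2 + (w (real (node m + 1) / 2 ^ lev m))\<^sup>2)"
proof -
  have "(x - (y + z) / 2)\<^sup>2 \<le> 3 * (x\<^sup>2 + y\<^sup>2 + z\<^sup>2)" for x y z :: real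
  proof -
    \<comment> \<open>Sum-of-squares certificate: the first square cancels the mixed terms of
      \<open>x\<close> with \<open>y + z\<close>, and \<open>(y - z)^2 / 2\<close> those of
      \<open>y\<close> with \<open>z\<close>.\<close>
    have "3 * (x\<^sup>2 + y\<^sup>2 + z\<^sup>2) - (x - (y + z) / 2)\<^sup>2 = (x + (y+z)/2)\<^sup>2 + x\<^sup>2 + (y - z)\<^sup>2 / 2 + 2 * y\<^sup>2 + 2 * z\<^sup>2"
      by (simp add: power2_eq_square field_simps)
    also have "\<dots> \<ge> 0" by simp
    finally show ?thesis by simp
  qed
  then show ?thesis unfolding hierarchical_surplus_def .
qed

text \<open>The price of interpolation: the level-\<open>k\<close> coefficients are second
  differences of nodal values of \<open>w\<close> on the grid of mesh \<open>1 / 2 ^ K\<close>, and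
  the squares of those nodal values are controlled by \<open>2 ^ K\<close> times the squared
  \<open>L_2\<close> norm. The constant is 54 = 3 * 3 * 6: the squared surplus, its three families
  of points, and the nodal integral bound.\<close>

lemma coefficient_bound:
  assumes "k \<le> K"
  shows "(\<Sum>m\<in>level_indices k. (a m)\<^sup>2)
    \<le> 54 * 2 ^ K * (\<Sum>m\<in>{1..<2^K}. \<Sum>n\<in>{1..<2^K}. a m * a n * mass m n)"
proof -
  define F :: "nat set" where "F = {1..<2^K}"
  define w where "w t = (\<Sum>m\<in>F. a m * faber_schauder m t)" for t
  define S where "S = (\<Sum>j\<le>2^K. (w (real j / 2 ^ K))\<^sup>2)"
  have JF: "level_indices k \<subseteq> F"
  proof
    fix m assume m: "m \<in> level_indices k"
    have "m < 2 ^ k" using lev_bounds(3)[of m] level_indices_pos[OF m] level_indices_lev[OF m] by auto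
    also have "\<dots> \<le> 2 ^ K" using assms by (simp add: power_increasing)
    finally show "m \<in> F" using level_indices_pos[OF m] by (auto simp: F_def)
  qed
  have am: "a m = hierarchical_surplus m w" if "m \<in> F" for m
  proof -
    have "hierarchical_surplus m w = (\<Sum>n\<in>F. a n * hierarchical_surplus m (faber_schauder n))"
      unfolding w_def by (rule surplus_sum)
    also have "\<dots> = (\<Sum>n\<in>F. if m = n then a n else 0)"
      using that by (intro sum.cong refl) (auto simp: F_def surplus_fs)
    finally show ?thesis using that by (simp add: F_def)
  qed
  \<comment> \<open>Each of the three families (peaks, left and right neighbours) consists of
    distinct points of the level-\<open>k\<close> grid, which embeds into the level-\<open>K\<close>
    grid by multiplication with \<open>2 ^ (K - k)\<close>. So each family costs at most one copy of
    \<open>S\<close>.\<close>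
  have inj: "(\<Sum>m\<in>level_indices k. (w (real (f (node m)) / 2 ^ lev m))\<^sup>2) \<le> S"
    if f: "\<And>m m'. m \<in> level_indices k \<Longrightarrow> m' \<in> level_indices k \<Longrightarrow> f (node m) = f (node m') \<Longrightarrow> node m = node m'"
      "\<And>m. m \<in> level_indices k \<Longrightarrow> f (node m) \<le> 2 ^ k" for f
  proof -
    define g where "g m = f (node m) * 2 ^ (K - k)" for m
    have "(\<Sum>m\<in>level_indices k. (w (real (f (node m)) / 2 ^ lev m))\<^sup>2) = (\<Sum>m\<in>level_indices k. (w (real (g m) / 2 ^ K))\<^sup>2)"
    proof (rule sum.cong[OF refl])
      fix m assume m: "m \<in> level_indices k"
      have "(2::real) ^ K = 2 ^ k * 2 ^ (K - k)" using assms by (simp flip: power_add)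
      then show "(w (real (f (node m)) / 2 ^ lev m))\<^sup>2 = (w (real (g m) / 2 ^ K))\<^sup>2"
        by (simp add: g_def level_indices_lev[OF m])
    qed
    also have "\<dots> = (\<Sum>j\<in>g ` level_indices k. (w (real j / 2 ^ K))\<^sup>2)"
    proof (rule sum.reindex[symmetric, unfolded o_def])
      show "inj_on g (level_indices k)"
      proof (rule inj_onI)
        fix m m' assume m: "m \<in> level_indices k" "m' \<in> level_indices k" "g m = g m'"
        then have "node m = node m'" by (intro f(1)) (auto simp: g_def)
        then show "m = m'"
          using level_indices_pos[OF m(1)] level_indices_pos[OF m(2)] level_indices_lev[OF m(1)] level_indices_lev[OF m(2)]
          by (metis node_inj)
      qed
    qed
    also have "\<dots> \<le> S"
      unfolding S_def
    proof (rule sum_mono2)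
      have "f (node m) * 2 ^ (K - k) \<le> 2 ^ k * 2 ^ (K - k)" if "m \<in> level_indices k" for m
        using f(2)[OF that] by simp
      then show "g ` level_indices k \<subseteq> {..2^K}"
        using assms by (auto simp: g_def simp flip: power_add)
    qed auto
    finally show ?thesis .
  qed
  have nl: "node m + 1 \<le> 2 ^ k" "1 \<le> node m" if "m \<in> level_indices k" for m
    using node_less[of m] level_indices_pos[OF that] level_indices_lev[OF that] by auto
  have "(\<Sum>m\<in>level_indices k. (a m)\<^sup>2) \<le> (\<Sum>m\<in>level_indices k. 3 * ((w (real (node m) / 2 ^ lev m))\<^sup>2
     + (w (real (node m - 1) / 2 ^ lev m))\<^sup>2 + (w (real (node m + 1) / 2 ^ lev m))\<^sup>2))"
  proof (rule sum_mono)
    fix m assume "m \<in> level_indices k"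
    then have "a m = hierarchical_surplus m w" using JF am by blast
    then show "(a m)\<^sup>2 \<le> 3 * ((w (real (node m) / 2 ^ lev m))\<^sup>2
     + (w (real (node m - 1) / 2 ^ lev m))\<^sup>2 + (w (real (node m + 1) / 2 ^ lev m))\<^sup>2)"
      using surplus_square_le[of m w] by (simp only:)
  qed
  also have "\<dots> = 3 * ((\<Sum>m\<in>level_indices k. (w (real (node m) / 2 ^ lev m))\<^sup>2)
     + (\<Sum>m\<in>level_indices k. (w (real (node m - 1) / 2 ^ lev m))\<^sup>2) + (\<Sum>m\<in>level_indices k. (w (real (node m + 1) / 2 ^ lev m))\<^sup>2))"
    by (simp only: sum_distrib_left[symmetric] sum.distrib)
  also have "\<dots> \<le> 3 * (S + S + S)"
  proof (intro mult_left_mono add_mono)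
    show "(\<Sum>m\<in>level_indices k. (w (real (node m) / 2 ^ lev m))\<^sup>2) \<le> S"
      using nl by (intro inj[of "\<lambda>x. x"]) (auto dest: Suc_leD)
    show "(\<Sum>m\<in>level_indices k. (w (real (node m - 1) / 2 ^ lev m))\<^sup>2) \<le> S"
    proof (rule inj[of "\<lambda>x. x - 1"])
      fix m m' assume "m \<in> level_indices k" "m' \<in> level_indices k" "node m - 1 = node m' - 1"
      then show "node m = node m'" using nl(2)[of m] nl(2)[of m'] by linarith
    next
      fix m assume "m \<in> level_indices k"
      then show "node m - 1 \<le> 2 ^ k" using nl(1)[of m] by linarith
    qed
    show "(\<Sum>m\<in>level_indices k. (w (real (node m + 1) / 2 ^ lev m))\<^sup>2) \<le> S"
      using nl by (intro inj[of "\<lambda>x. x + 1"]) auto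
  qed simp
  also have "\<dots> = 9 * S" by simp
  also have "S \<le> (\<Sum>j<2^K. (w (real j / 2 ^ K))\<^sup>2 + (w (real (Suc j) / 2 ^ K))\<^sup>2)"
  proof -
    have "S = (w (real 0 / 2 ^ K))\<^sup>2 + (\<Sum>j<2^K. (w (real (Suc j) / 2 ^ K))\<^sup>2)"
      unfolding S_def lessThan_Suc_atMost[symmetric] by (rule sum.lessThan_Suc_shift)
    moreover have "(w (real 0 / 2 ^ K))\<^sup>2 \<le> (\<Sum>j<2^K. (w (real j / 2 ^ K))\<^sup>2)"
      by (rule member_le_sum) auto
    ultimately show ?thesis by (simp add: sum.distrib)
  qed
  also have "9 * (\<Sum>j<2^K. (w (real j / 2 ^ K))\<^sup>2 + (w (real (Suc j) / 2 ^ K))\<^sup>2)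
    = 54 * 2 ^ K * (1 / (6 * 2 ^ K) * (\<Sum>j<2^K. (w (real j / 2 ^ K))\<^sup>2 + (w (real (Suc j) / 2 ^ K))\<^sup>2))"
    by simp
  also have "\<dots> \<le> 54 * 2 ^ K * integral {0..real (2^K) / 2 ^ K} (\<lambda>t. (w t)\<^sup>2)"
  proof (intro mult_left_mono nodal_integral_bound)
    show "continuous_on UNIV w" unfolding w_def by (intro continuous_intros)
    fix j s assume s: "0 \<le> s" "s \<le> (1::real)"
    have "faber_schauder m ((real j + s) / 2 ^ K) = (1 - s) * faber_schauder m (real j / 2 ^ K) + s * faber_schauder m ((real j + 1) / 2 ^ K)"
      if "m \<in> F" for m
      using that s by (intro fs_affine floorlog_leI) (auto simp: F_def)
    then show "w ((real j + s) / 2 ^ K) = (1 - s) * w (real j / 2 ^ K) + s * w ((real j + 1) / 2 ^ K)"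
      unfolding w_def sum_distrib_left sum.distrib[symmetric]
      by (intro sum.cong refl) (simp only: distrib_left mult.left_commute)
  qed auto
  finally show ?thesis
    by (simp add: mass_form w_def F_def)
qed

text \<open>\<open>coefficient_bound\<close> speaks of complete levels, the factorisation of leading
  blocks \<open>{1..n}\<close>. Cutting the vector off after \<open>n\<close> reconciles the two,
  and the coefficient \<open>a n\<close> survives in its level.\<close>

lemma mass_form_pos:
  assumes "a n \<noteq> 0" "1 \<le> n"
  shows "0 < (\<Sum>l\<in>{1..n}. \<Sum>m\<in>{1..n}. a l * a m * mass l m)"
proof -
  define b where "b m = (if m \<le> n then a m else 0)" for m
  have n: "n < 2 ^ lev n" "n \<in> level_indices (lev n)"
    using lev_bounds(3)[OF assms(2)] mem_level_indices[OF assms(2)] by auto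
  have "(b n)\<^sup>2 \<le> (\<Sum>m\<in>level_indices (lev n). (b m)\<^sup>2)"
    by (rule member_le_sum[OF n(2)]) (auto simp: finite_level_indices)
  also have "\<dots> \<le> 54 * 2 ^ lev n * (\<Sum>l\<in>{1..<2^lev n}. \<Sum>m\<in>{1..<2^lev n}. b l * b m * mass l m)"
    by (rule coefficient_bound) simp
  also have "(\<Sum>l\<in>{1..<2^lev n}. \<Sum>m\<in>{1..<2^lev n}. b l * b m * mass l m)
     = (\<Sum>l\<in>{1..n}. \<Sum>m\<in>{1..n}. b l * b m * mass l m)"
  proof -
    have "(\<Sum>l\<in>{1..<2^lev n}. \<Sum>m\<in>{1..<2^lev n}. b l * b m * mass l m)
      = (\<Sum>l\<in>{1..<2^lev n}. \<Sum>m\<in>{1..n}. b l * b m * mass l m)"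
      using n(1) by (intro sum.cong refl sum.mono_neutral_right) (auto simp: b_def)
    also have "\<dots> = (\<Sum>l\<in>{1..n}. \<Sum>m\<in>{1..n}. b l * b m * mass l m)"
      using n(1) by (intro sum.mono_neutral_right) (auto simp: b_def)
    finally show ?thesis .
  qed
  also have "\<dots> = (\<Sum>l\<in>{1..n}. \<Sum>m\<in>{1..n}. a l * a m * mass l m)"
    by (intro sum.cong refl) (auto simp: b_def)
  finally have "(b n)\<^sup>2 \<le> 54 * 2 ^ lev n * (\<Sum>l\<in>{1..n}. \<Sum>m\<in>{1..n}. a l * a m * mass l m)" .
  moreover have "0 < (b n)\<^sup>2" using assms(1) by (simp add: b_def)
  ultimately have "0 < 54 * 2 ^ lev n * (\<Sum>l\<in>{1..n}. \<Sum>m\<in>{1..n}. a l * a m * mass l m)" by linarith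
  then show ?thesis by (simp add: zero_less_mult_iff)
qed

lemma hat_square_integral_le:
  "integral {0..1} (\<lambda>t. hat (2 ^ k * t - q) * hat (2 ^ k * t - q)) \<le> 2 / 2 ^ k"
proof -
  let ?f = "\<lambda>t. hat (2 ^ k * t - q) * hat (2 ^ k * t - q)"
  let ?I = "{(q - 1) / 2 ^ k..(q + 1) / 2 ^ k}"
  have "integral {0..1} ?f = (LINT t:{0..1}|lborel. ?f t)"
    by (rule set_borel_integral_eq_integral(2)[symmetric], rule borel_integrable_atLeastAtMost') (intro continuous_intros)
  also have "\<dots> \<le> (LINT t|lborel. indicator ?I t)"
    unfolding set_lebesgue_integral_def
  proof (rule integral_mono')
    fix t
    have "?f t \<le> indicator ?I t"
    proof (cases "t \<in> ?I")
      case True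
      then show ?thesis by (simp add: mult_le_one hat_bounds)
    next
      case False
      then have "1 \<le> \<bar>2 ^ k * t - q\<bar>" by (auto simp: field_simps)
      then show ?thesis by (simp add: hat_eq_0)
    qed
    then show "indicator {0..1} t *\<^sub>R ?f t \<le> indicator ?I t"
      by (auto simp: indicator_def)
  qed (auto simp: integrable_indicator_iff emeasure_lborel_Icc_eq)
  also have "\<dots> = 2 / 2 ^ k"
    by (simp add: divide_right_mono diff_divide_distrib[symmetric])
  finally show ?thesis .
qed

lemma mass_diag_le: "mass m m \<le> 2 / 2 ^ lev m"
  unfolding mass_def fs_eq_hat by (rule hat_square_integral_le)

text \<open>This is \<open>coefficient_bound\<close> at a unit vector, which spares the exact
  integral.\<close>

lemma mass_diag_ge:
  assumes "1 \<le> m"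
  shows "1 / (54 * 2 ^ lev m) \<le> mass m m"
proof -
  define a where "a n = (if n = m then 1 else 0 :: real)" for n
  have m: "m \<in> level_indices (lev m)" "m \<in> {1..<2 ^ lev m}"
    using lev_bounds[OF assms] mem_level_indices[OF assms] assms by auto
  have "1 = (\<Sum>n\<in>level_indices (lev m). (a n)\<^sup>2)"
  proof -
    have "(a n)\<^sup>2 = (if n = m then 1 else 0)" for n by (simp add: a_def)
    then show ?thesis using m(1) by (simp add: finite_level_indices)
  qed
  also have "\<dots> \<le> 54 * 2 ^ lev m * (\<Sum>l\<in>{1..<2^lev m}. \<Sum>n\<in>{1..<2^lev m}. a l * a n * mass l n)"
    by (rule coefficient_bound) simp
  also have "(\<Sum>l\<in>{1..<2^lev m}. \<Sum>n\<in>{1..<2^lev m}. a l * a n * mass l n)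
     = (\<Sum>l\<in>{1..<2^lev m}. \<Sum>n\<in>{1..<2^lev m}. if n = m then a l * mass l m else 0)"
    by (intro sum.cong refl) (simp add: a_def)
  also have "\<dots> = (\<Sum>l\<in>{1..<2^lev m}. a l * mass l m)"
    using m(2) by (simp only: sum.delta finite_atLeastLessThan if_True)
  also have "\<dots> = (\<Sum>l\<in>{1..<2^lev m}. if l = m then mass m m else 0)"
    by (intro sum.cong refl) (simp add: a_def)
  also have "\<dots> = mass m m" using m(2) by (simp only: sum.delta finite_atLeastLessThan if_True)
  finally show ?thesis by (simp add: field_simps)
qed

text \<open>The scaled peaks are distinct odd integers, at distance at least 2, so the open supports
  are disjoint.\<close>

lemma mass_same_level:
  assumes "1 \<le> m" "1 \<le> n" "lev m = lev n" "m \<noteq> n"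
  shows "mass m n = 0"
proof -
  have "node m \<noteq> node n" using node_inj assms by blast
  then have ne: "2 \<le> \<bar>real (node m) - real (node n)\<bar>"
  proof -
    have "even (int (node m) - int (node n))" "int (node m) - int (node n) \<noteq> 0"
      using odd_node \<open>node m \<noteq> node n\<close> by auto
    then have "2 \<le> \<bar>int (node m) - int (node n)\<bar>" by presburger
    then show ?thesis by linarith
  qed
  have "faber_schauder m t * faber_schauder n t = 0" for t
  proof (cases "1 \<le> \<bar>2 ^ lev m * t - real (node m)\<bar>")
    case False
    then have "1 \<le> \<bar>2 ^ lev m * t - real (node n)\<bar>" using ne by linarith
    then show ?thesis by (simp add: fs_eq_hat hat_eq_0 flip: assms(3))
  qed (simp add: fs_eq_hat hat_eq_0)
  then show ?thesis unfolding mass_def by (simp only: integral_0)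
qed

section \<open>Orthonormalisation of the Faber-Schauder basis\<close>

lemma weighted_Cauchy_Schwarz_sum:
  fixes y w :: "'a \<Rightarrow> real"
  assumes "\<And>x. x \<in> A \<Longrightarrow> 0 < w x"
  shows "(\<Sum>x\<in>A. y x)\<^sup>2 \<le> (\<Sum>x\<in>A. w x) * (\<Sum>x\<in>A. (y x)\<^sup>2 / w x)"
proof -
  have "(\<Sum>x\<in>A. y x) = (\<Sum>x\<in>A. sqrt (w x) * (y x / sqrt (w x)))"
    using assms by (intro sum.cong refl) (auto simp: less_imp_neq[symmetric])
  then have "(\<Sum>x\<in>A. y x)\<^sup>2 \<le> (\<Sum>x\<in>A. (sqrt (w x))\<^sup>2) * (\<Sum>x\<in>A. (y x / sqrt (w x))\<^sup>2)"
    by (simp only: Cauchy_Schwarz_ineq_sum)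
  also have "\<dots> = (\<Sum>x\<in>A. w x) * (\<Sum>x\<in>A. (y x)\<^sup>2 / w x)"
    using assms by (intro arg_cong2[of _ _ _ _ "(*)"] sum.cong refl) (auto simp: power_divide less_imp_le)
  finally show ?thesis .
qed

lemma sum_inverse_powers_le: "(\<Sum>l\<in>{k..K}. 1 / 2 ^ l :: real) \<le> 2 / 2 ^ k"
proof -
  have "(\<Sum>l\<in>{k..<k+n}. 1 / 2 ^ l :: real) = 2 / 2 ^ k - 2 / 2 ^ (k + n)" for n
  proof (induction n)
    case (Suc n)
    have "(\<Sum>l\<in>{k..<k + Suc n}. 1 / 2 ^ l :: real) = (\<Sum>l\<in>{k..<k + n}. 1 / 2 ^ l) + 1 / 2 ^ (k + n)"
      by simp
    moreover have "1 / 2 ^ (k + n) = 2 / (2::real) ^ (k + Suc n)" "2 / (2::real) ^ (k + n) = 4 / 2 ^ (k + Suc n)" by auto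
    ultimately show ?case using Suc.IH by linarith
  qed simp
  from this[of "Suc K - k"] have "(\<Sum>l\<in>{k..<k + (Suc K - k)}. 1 / 2 ^ l :: real) \<le> 2 / 2 ^ k" by simp
  moreover have "{k..K} \<subseteq> {k..<k + (Suc K - k)}" by auto
  then have "(\<Sum>l\<in>{k..K}. 1 / 2 ^ l :: real) \<le> (\<Sum>l\<in>{k..<k + (Suc K - k)}. 1 / 2 ^ l :: real)"
    by (intro sum_mono2) auto
  ultimately show ?thesis by simp
qed

lemma lev_le: "m \<in> {1..<2^K} \<Longrightarrow> lev m \<in> {1..K}"
  using lev_bounds(1)[of m] floorlog_leI[of m 2 K] by simp

lemma lev_mono_less: "lev m < lev n \<Longrightarrow> m < n"
  using floorlog_mono[of n m 2] by linarith

lemma level_indices_eq: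
  assumes "1 \<le> k" "k \<le> K"
  shows "level_indices k = {m \<in> {1..<2^K}. lev m = k}"
proof (intro equalityI subsetI)
  fix m assume m: "m \<in> level_indices k"
  have "m < 2 ^ k" using lev_bounds(3)[of m] level_indices_pos[OF m] level_indices_lev[OF m] by auto
  also have "\<dots> \<le> 2 ^ K" using assms by (simp add: power_increasing)
  finally show "m \<in> {m \<in> {1..<2^K}. lev m = k}"
    using level_indices_pos[OF m] level_indices_lev[OF m] by auto
next
  fix m assume "m \<in> {m \<in> {1..<2^K}. lev m = k}"
  then have "1 \<le> m" "lev m = k" by auto
  then show "m \<in> level_indices k" by (simp only: mem_level_indices)
qed

lemma gram_form_eq:
  fixes G T :: "'a \<Rightarrow> 'a \<Rightarrow> real"
  assumes "\<And>m n. m \<in> F \<Longrightarrow> n \<in> F \<Longrightarrow> G m n = (\<Sum>l\<in>R. T m l * T n l)"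
  shows "(\<Sum>m\<in>F. \<Sum>n\<in>F. a m * a n * G m n) = (\<Sum>l\<in>R. (\<Sum>m\<in>F. a m * T m l)\<^sup>2)"
proof -
  have "(\<Sum>m\<in>F. \<Sum>n\<in>F. a m * a n * G m n) = (\<Sum>m\<in>F. \<Sum>n\<in>F. \<Sum>l\<in>R. (a m * T m l) * (a n * T n l))"
    using assms by (intro sum.cong refl) (simp add: sum_distrib_left mult_ac)
  also have "\<dots> = (\<Sum>m\<in>F. \<Sum>l\<in>R. \<Sum>n\<in>F. (a m * T m l) * (a n * T n l))"
    by (rule sum.cong[OF refl], rule sum.swap)
  also have "\<dots> = (\<Sum>l\<in>R. \<Sum>m\<in>F. \<Sum>n\<in>F. (a m * T m l) * (a n * T n l))"
    by (rule sum.swap)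
  finally show ?thesis by (simp add: power2_eq_square sum_product)
qed

text \<open>
  The rows of \<open>U\<close> are the coefficients of the \<open>L\<^sub>2\<close>-orthonormalisation of the Faber-Schauder functions
  of level at most \<open>K\<close>; triangularity makes it compatible with the nested spaces of coarser levels.
\<close>

locale faber_schauder_orthonormalisation =
  fixes K :: nat and T U :: "nat \<Rightarrow> nat \<Rightarrow> real"
  assumes mass_eq: "\<And>m n. m \<in> {1..<2^K} \<Longrightarrow> n \<in> {1..<2^K} \<Longrightarrow> mass m n = (\<Sum>l\<in>{1..<2^K}. T m l * T n l)"
    and T_U: "\<And>m n. m \<in> {1..<2^K} \<Longrightarrow> n \<in> {1..<2^K} \<Longrightarrow> (\<Sum>l\<in>{1..<2^K}. T m l * U l n) = (if m = n then 1 else 0)"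
    and U_T: "\<And>m n. m \<in> {1..<2^K} \<Longrightarrow> n \<in> {1..<2^K} \<Longrightarrow> (\<Sum>l\<in>{1..<2^K}. U m l * T l n) = (if m = n then 1 else 0)"
    and T_triangular: "\<And>m n. m < n \<Longrightarrow> T m n = 0"
    and U_triangular: "\<And>m n. m < n \<Longrightarrow> U m n = 0"

lemma faber_schauder_orthonormalisation_exists: "\<exists>T U. faber_schauder_orthonormalisation K T U"
proof -
  have eq: "{1..2 ^ K - 1} = {1..<2 ^ K :: nat}" by auto
  have "\<exists>T U. (\<forall>m\<in>{1..2^K-1}. \<forall>n\<in>{1..2^K-1}. mass m n = (\<Sum>l\<in>{1..2^K-1}. T m l * T n l)) \<and>
    (\<forall>m\<in>{1..2^K-1}. \<forall>n\<in>{1..2^K-1}. (\<Sum>l\<in>{1..2^K-1}. T m l * U l n) = (if m = n then 1 else 0)) \<and>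
    (\<forall>m\<in>{1..2^K-1}. \<forall>n\<in>{1..2^K-1}. (\<Sum>l\<in>{1..2^K-1}. U m l * T l n) = (if m = n then 1 else 0)) \<and>
    (\<forall>m n. m < n \<longrightarrow> T m n = 0) \<and> (\<forall>m n. m < n \<longrightarrow> U m n = (0::real))"
    by (rule cholesky[OF mass_sym]) (rule mass_form_pos)
  then obtain T U where
    "\<forall>m\<in>{1..<2^K}. \<forall>n\<in>{1..<2^K}. mass m n = (\<Sum>l\<in>{1..<2^K}. T m l * T n l)"
    "\<forall>m\<in>{1..<2^K}. \<forall>n\<in>{1..<2^K}. (\<Sum>l\<in>{1..<2^K}. T m l * U l n) = (if m = n then 1 else 0)"
    "\<forall>m\<in>{1..<2^K}. \<forall>n\<in>{1..<2^K}. (\<Sum>l\<in>{1..<2^K}. U m l * T l n) = (if m = n then 1 else 0)"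
    "\<forall>m n. m < n \<longrightarrow> T m n = 0" "\<forall>m n. m < n \<longrightarrow> U m n = 0"
    unfolding eq by (elim exE conjE) (rule that)
  then have "faber_schauder_orthonormalisation K T U"
    unfolding faber_schauder_orthonormalisation_def by blast
  then show ?thesis by blast
qed

context faber_schauder_orthonormalisation
begin

lemma coarse_T_eq_0: "lev m < lev n \<Longrightarrow> T m n = 0"
  by (rule T_triangular[OF lev_mono_less])

lemma coarse_U_eq_0: "lev m < lev n \<Longrightarrow> U m n = 0"
  by (rule U_triangular[OF lev_mono_less])

text \<open>A Jackson-type estimate: the right side is twice the stiffness form, whose diagonal is
  \<open>2 * 2 ^ lev m\<close>. By triangularity only the parts \<open>y l n\<close> with
  \<open>l \<ge> lev n\<close> enter coefficient \<open>n\<close>. Cauchy-Schwarz with weights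
  \<open>1 / 2 ^ l\<close> followed by \<open>2 ^ lev n * 2 ^ l \<le> 4 ^ l\<close> removes
  \<open>n\<close> from the weights, so that the sum over \<open>n\<close> becomes the mass form of
  a single level, which is diagonal.\<close>

lemma orthonormal_coefficients_bound:
  "(\<Sum>n\<in>{1..<2^K}. (\<Sum>m\<in>{1..<2^K}. c m * (2 ^ lev n * T m n))\<^sup>2) \<le> 4 * (\<Sum>m\<in>{1..<2^K}. 2 ^ lev m * (c m)\<^sup>2)"
proof -
  define R :: "nat set" where "R = {1..<2^K}"
  define J where "J l = {m \<in> R. lev m = l}" for l
  define y where "y l n = (\<Sum>m\<in>J l. c m * T m n)" for l n
  have "finite R" by (simp add: R_def)
  have split: "(\<Sum>m\<in>R. f m) = (\<Sum>l\<in>{1..K}. \<Sum>m\<in>J l. f m)" for f :: "nat \<Rightarrow> real"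
    unfolding J_def using \<open>finite R\<close> lev_le
    by (intro sum.group[symmetric]) (auto simp: R_def)
  have y0: "y l n = 0" if "l < lev n" for l n
    unfolding y_def using that by (intro sum.neutral) (auto simp: J_def coarse_T_eq_0)
  have step: "(\<Sum>m\<in>R. c m * (2 ^ lev n * T m n))\<^sup>2 \<le> 2 * (\<Sum>l\<in>{1..K}. 4 ^ l * (y l n)\<^sup>2)" if "n \<in> R" for n
  proof -
    have lev: "lev n \<in> {1..K}" using lev_le that by (auto simp: R_def)
    have "(\<Sum>m\<in>R. c m * T m n) = (\<Sum>l\<in>{1..K}. y l n)"
      by (simp add: split y_def)
    also have "\<dots> = (\<Sum>l\<in>{lev n..K}. y l n)"
      using lev by (intro sum.mono_neutral_right) (auto simp: y0)
    finally have eq: "(\<Sum>m\<in>R. c m * T m n) = (\<Sum>l\<in>{lev n..K}. y l n)" .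
    have "(\<Sum>m\<in>R. c m * (2 ^ lev n * T m n))\<^sup>2 = 4 ^ lev n * (\<Sum>l\<in>{lev n..K}. y l n)\<^sup>2"
    proof -
      have "(\<Sum>m\<in>R. c m * (2 ^ lev n * T m n)) = 2 ^ lev n * (\<Sum>m\<in>R. c m * T m n)"
        by (simp add: sum_distrib_left mult.left_commute)
      moreover have "((2::real) ^ lev n)\<^sup>2 = 4 ^ lev n" by (simp add: power2_eq_square flip: power_mult_distrib)
      ultimately show ?thesis by (simp only: eq power_mult_distrib)
    qed
    also have "\<dots> \<le> 4 ^ lev n * ((\<Sum>l\<in>{lev n..K}. 1 / 2 ^ l) * (\<Sum>l\<in>{lev n..K}. (y l n)\<^sup>2 / (1 / 2 ^ l)))"
      by (intro mult_left_mono weighted_Cauchy_Schwarz_sum) auto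
    also have "\<dots> \<le> 4 ^ lev n * ((2 / 2 ^ lev n) * (\<Sum>l\<in>{lev n..K}. (y l n)\<^sup>2 / (1 / 2 ^ l)))"
      by (intro mult_left_mono mult_right_mono sum_inverse_powers_le sum_nonneg) auto
    also have "\<dots> = 2 * (\<Sum>l\<in>{lev n..K}. 2 ^ lev n * 2 ^ l * (y l n)\<^sup>2)"
    proof -
      have "(4::real) ^ lev n = 2 ^ lev n * 2 ^ lev n" by (simp flip: power_mult_distrib)
      then show ?thesis by (simp add: sum_distrib_left mult_ac)
    qed
    also have "\<dots> \<le> 2 * (\<Sum>l\<in>{lev n..K}. 4 ^ l * (y l n)\<^sup>2)"
    proof (intro mult_left_mono sum_mono mult_right_mono)
      fix l assume "l \<in> {lev n..K}"
      then have "(2::real) ^ lev n * 2 ^ l \<le> 2 ^ l * 2 ^ l" by (intro mult_right_mono power_increasing) auto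
      then show "(2::real) ^ lev n * 2 ^ l \<le> 4 ^ l" by (simp flip: power_mult_distrib)
    qed auto
    also have "\<dots> \<le> 2 * (\<Sum>l\<in>{1..K}. 4 ^ l * (y l n)\<^sup>2)"
      using lev by (intro mult_left_mono sum_mono2) auto
    finally show ?thesis .
  qed
  have "(\<Sum>n\<in>R. (\<Sum>m\<in>R. c m * (2 ^ lev n * T m n))\<^sup>2) \<le> (\<Sum>n\<in>R. 2 * (\<Sum>l\<in>{1..K}. 4 ^ l * (y l n)\<^sup>2))"
    by (intro sum_mono step)
  also have "\<dots> = (\<Sum>l\<in>{1..K}. 2 * 4 ^ l * (\<Sum>n\<in>R. (y l n)\<^sup>2))"
    unfolding sum_distrib_left by (subst sum.swap) (simp add: mult_ac)
  also have "\<dots> \<le> (\<Sum>l\<in>{1..K}. \<Sum>m\<in>J l. 4 * (2 ^ lev m * (c m)\<^sup>2))"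
  proof (rule sum_mono)
    fix l assume "l \<in> {1..K}"
    have "(\<Sum>n\<in>R. (y l n)\<^sup>2) = (\<Sum>m\<in>J l. \<Sum>n\<in>J l. c m * c n * mass m n)"
      unfolding y_def by (rule gram_form_eq[symmetric]) (auto simp: J_def R_def mass_eq)
    also have "\<dots> = (\<Sum>m\<in>J l. \<Sum>n\<in>J l. if m = n then (c m)\<^sup>2 * mass m m else 0)"
    proof (intro sum.cong refl)
      fix m n assume "m \<in> J l" "n \<in> J l"
      then have "m \<noteq> n \<Longrightarrow> mass m n = 0" by (intro mass_same_level) (auto simp: J_def R_def)
      then show "c m * c n * mass m n = (if m = n then (c m)\<^sup>2 * mass m m else 0)"
        by (simp add: power2_eq_square)
    qed
    also have "\<dots> = (\<Sum>m\<in>J l. (c m)\<^sup>2 * mass m m)"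
      using \<open>finite R\<close> by (simp add: J_def)
    also have "\<dots> \<le> (\<Sum>m\<in>J l. (c m)\<^sup>2 * (2 / 2 ^ lev m))"
      by (intro sum_mono mult_left_mono mass_diag_le) auto
    finally have "2 * 4 ^ l * (\<Sum>n\<in>R. (y l n)\<^sup>2) \<le> 2 * 4 ^ l * (\<Sum>m\<in>J l. (c m)\<^sup>2 * (2 / 2 ^ lev m))"
      by simp
    also have "\<dots> = (\<Sum>m\<in>J l. 4 * (2 ^ lev m * (c m)\<^sup>2))"
    proof -
      have "(4::real) ^ l = 2 ^ l * 2 ^ l" by (simp flip: power_mult_distrib)
      then show ?thesis unfolding sum_distrib_left
        by (intro sum.cong refl) (auto simp: J_def)
    qed
    finally show "2 * 4 ^ l * (\<Sum>n\<in>R. (y l n)\<^sup>2) \<le> (\<Sum>m\<in>J l. 4 * (2 ^ lev m * (c m)\<^sup>2))" .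
  qed
  also have "\<dots> = 4 * (\<Sum>m\<in>R. 2 ^ lev m * (c m)\<^sup>2)"
    by (simp only: split sum_distrib_left)
  finally show ?thesis by (simp only: R_def)
qed

text \<open>The \<open>a m\<close> are the Faber-Schauder coefficients of the function with
  orthonormal coefficients \<open>b\<close> on level \<open>k'\<close>, so its mass form is the sum
  of the squares of \<open>b\<close>.\<close>

lemma block_coefficients_bound:
  assumes "k \<le> k'" "1 \<le> k'" "k' \<le> K"
  shows "(\<Sum>m\<in>level_indices k. (\<Sum>n\<in>level_indices k'. b n * U n m)\<^sup>2) \<le> 54 * 2 ^ k' * (\<Sum>n\<in>level_indices k'. (b n)\<^sup>2)"
proof -
  define R :: "nat set" where "R = {1..<2^K}"
  define a where "a m = (\<Sum>n\<in>level_indices k'. b n * U n m)" for m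
  have J: "level_indices k' = {m \<in> R. lev m = k'}" unfolding R_def by (rule level_indices_eq[OF assms(2,3)])
  have sub: "{1..<2^k'} \<subseteq> R" using assms power_increasing[of k' K "2::nat"] by (auto simp: R_def)
  have a0: "a m = 0" if "m \<in> R - {1..<2^k'}" for m
    unfolding a_def
  proof (intro sum.neutral ballI)
    fix n assume "n \<in> level_indices k'"
    then have "n < 2 ^ k'" using lev_bounds(3)[of n] by (auto simp: J R_def)
    then show "b n * U n m = 0" using that by (simp add: U_triangular R_def)
  qed
  \<comment> \<open>Triangularity of \<open>U\<close> keeps the function in the space of levels up
    to \<open>k'\<close>. The bound is therefore applied with \<open>k'\<close> in place of
    \<open>K\<close> and costs only \<open>2 ^ k'\<close>.\<close>
  have "(\<Sum>m\<in>level_indices k. (a m)\<^sup>2) \<le> 54 * 2 ^ k' * (\<Sum>m\<in>{1..<2^k'}. \<Sum>n\<in>{1..<2^k'}. a m * a n * mass m n)"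
    by (rule coefficient_bound[OF assms(1)])
  also have "(\<Sum>m\<in>{1..<2^k'}. \<Sum>n\<in>{1..<2^k'}. a m * a n * mass m n) = (\<Sum>m\<in>R. \<Sum>n\<in>{1..<2^k'}. a m * a n * mass m n)"
    using sub by (intro sum.mono_neutral_left) (auto simp: a0 R_def)
  also have "\<dots> = (\<Sum>m\<in>R. \<Sum>n\<in>R. a m * a n * mass m n)"
    using sub by (intro sum.cong refl sum.mono_neutral_left) (auto simp: a0 R_def)
  also have "\<dots> = (\<Sum>l\<in>R. (\<Sum>m\<in>R. a m * T m l)\<^sup>2)"
    by (rule gram_form_eq) (simp add: R_def mass_eq)
  also have "\<dots> = (\<Sum>l\<in>R. if lev l = k' then (b l)\<^sup>2 else 0)"
  proof (intro sum.cong refl)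
    fix l assume l: "l \<in> R"
    have "(\<Sum>m\<in>R. a m * T m l) = (\<Sum>n\<in>level_indices k'. b n * (\<Sum>m\<in>R. U n m * T m l))"
      unfolding a_def sum_distrib_left sum_distrib_right by (subst sum.swap) (simp add: mult_ac)
    also have "\<dots> = (\<Sum>n\<in>level_indices k'. if n = l then b n else 0)"
    proof (intro sum.cong refl)
      fix n assume "n \<in> level_indices k'"
      then have "(\<Sum>m\<in>R. U n m * T m l) = (if n = l then 1 else 0)"
        using U_T[of n l] l unfolding J R_def by blast
      then show "b n * (\<Sum>m\<in>R. U n m * T m l) = (if n = l then b n else 0)" by simp
    qed
    finally show "(\<Sum>m\<in>R. a m * T m l)\<^sup>2 = (if lev l = k' then (b l)\<^sup>2 else 0)"
      using l by (simp add: J R_def)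
  qed
  also have "\<dots> = (\<Sum>l\<in>level_indices k'. (b l)\<^sup>2)"
    unfolding J by (rule sum.inter_filter[symmetric]) (simp add: R_def)
  finally show ?thesis by (simp add: a_def)
qed

end

section \<open>The norms as quadratic forms in the coefficients\<close>

text \<open>Fubini for products. Lebesgue measure on \<open>real ^ 'd\<close> is the image of the
  product measure indexed by \<open>Basis\<close>, and \<open>idx\<close> turns basis vectors back
  into coordinates.\<close>

lemma cube_integral_prod:
  fixes g :: "'d::finite \<Rightarrow> real \<Rightarrow> real"
  assumes "\<And>i. set_integrable lborel {0..1} (g i)"
  shows "set_integrable lebesgue unit_cube (\<lambda>x::real^'d. \<Prod>i\<in>UNIV. g i (x $ i))" (is ?integrable)
    and "(LINT x:unit_cube|lebesgue. \<Prod>i\<in>UNIV. g i (x $ i)) = (\<Prod>i\<in>UNIV. LINT t:{0..1}|lborel. g i t)" (is ?integral)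
proof -
  define h where "h i t = indicator {0..1} t * g i t" for i t
  define F where "F x = (\<Prod>i\<in>UNIV. h i (x $ i))" for x :: "real^'d"
  have h_int: "integrable lborel (h i)" for i
    using assms[of i] by (simp add: set_integrable_def h_def[abs_def])
  then have h_meas: "h i \<in> borel_measurable borel" for i
    by (metis borel_measurable_integrable measurable_lborel2)
  have F_meas: "F \<in> borel_measurable borel"
    unfolding F_def
  proof (rule borel_measurable_prod)
    fix i
    have "(\<lambda>x::real^'d. x $ i) \<in> borel_measurable borel"
      by (intro borel_measurable_continuous_onI continuous_intros)
    then show "(\<lambda>x::real^'d. h i (x $ i)) \<in> borel_measurable borel"
      by (rule measurable_compose) (rule h_meas)
  qed
  define idx :: "real^'d \<Rightarrow> 'd" where "idx b = (THE i. b = axis i 1)" for b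
  have idx: "idx (axis i 1) = i" for i
    unfolding idx_def by (rule the_equality) (auto simp: axis_eq_axis)
  have Basis: "(Basis :: (real^'d) set) = range (\<lambda>i. axis i 1)"
    by (auto simp: Basis_vec_def)
  have inj: "inj (\<lambda>i::'d. axis i (1::real))"
    by (auto simp: inj_on_def axis_eq_axis)
  have reindex: "(\<Prod>b\<in>Basis. H (idx b) b) = (\<Prod>i\<in>UNIV. H i (axis i 1))"
    for H :: "'d \<Rightarrow> real^'d \<Rightarrow> real"
    unfolding Basis by (subst prod.reindex[OF inj]) (simp add: idx)
  interpret product_sigma_finite "\<lambda>_::real^'d. lborel :: real measure" ..
  have coord: "(\<Sum>b\<in>Basis. f b *\<^sub>R b) $ i = f (axis i 1)" for f and i :: 'd
  proof -
    have "(\<Sum>b\<in>Basis. f b *\<^sub>R b) $ i = (\<Sum>b\<in>Basis. f b *\<^sub>R b) \<bullet> axis i 1"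
      by (simp add: inner_axis)
    also have "\<dots> = f (axis i 1)" by (rule inner_sum_left_Basis) (auto simp: Basis)
    finally show ?thesis .
  qed
  have F_sum: "F (\<Sum>b\<in>Basis. f b *\<^sub>R b) = (\<Prod>b\<in>Basis. h (idx b) (f b))" for f
    unfolding F_def coord by (rule reindex[symmetric, of "\<lambda>i b. h i (f b)"])
  have lb: "(lborel :: (real^'d) measure) = distr (\<Pi>\<^sub>M b\<in>Basis. lborel) borel (\<lambda>f. \<Sum>b\<in>Basis. f b *\<^sub>R b)"
    by (rule lborel_eq)
  have m: "(\<lambda>f. \<Sum>b\<in>Basis. f b *\<^sub>R b) \<in> (\<Pi>\<^sub>M b\<in>(Basis::(real^'d) set). lborel) \<rightarrow>\<^sub>M borel"
    by measurable
  have "integrable (\<Pi>\<^sub>M b\<in>(Basis::(real^'d) set). lborel) (\<lambda>f. \<Prod>b\<in>Basis. h (idx b) (f b))"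
    by (rule product_integrable_prod) (auto intro: h_int)
  then have "integrable lborel F"
    unfolding lb by (subst integrable_distr_eq[OF m F_meas]) (simp add: F_sum)
  then have F_int: "integrable lebesgue F"
    using F_meas by (subst integrable_completion) auto
  have "integral\<^sup>L lebesgue F = integral\<^sup>L lborel F"
    using F_meas by (intro integral_completion) auto
  also have "\<dots> = (\<integral>f. (\<Prod>b\<in>Basis. h (idx b) (f b)) \<partial>(\<Pi>\<^sub>M b\<in>(Basis::(real^'d) set). lborel))"
    unfolding lb by (subst integral_distr[OF m F_meas]) (simp add: F_sum)
  also have "\<dots> = (\<Prod>b\<in>Basis. integral\<^sup>L lborel (h (idx b)))"
    by (rule product_integral_prod) (auto intro: h_int)
  also have "\<dots> = (\<Prod>i\<in>UNIV. integral\<^sup>L lborel (h i))"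
    by (rule reindex)
  finally have F_val: "integral\<^sup>L lebesgue F = (\<Prod>i\<in>UNIV. LINT t:{0..1}|lborel. g i t)"
    by (simp add: set_lebesgue_integral_def h_def[abs_def])
  have F_eq: "F x = indicator unit_cube x *\<^sub>R (\<Prod>i\<in>UNIV. g i (x $ i))" for x
  proof (cases "x \<in> unit_cube")
    case True
    then show ?thesis by (auto simp: F_def h_def unit_cube_def)
  next
    case False
    then obtain i where "x $ i \<notin> {0..1}" by (auto simp: unit_cube_def)
    then have "h i (x $ i) = 0" by (simp add: h_def)
    then show ?thesis using False by (auto simp: F_def intro: prod_zero)
  qed
  show ?integrable using F_int unfolding set_integrable_def F_eq[abs_def] .
  show ?integral using F_val unfolding set_lebesgue_integral_def F_eq[abs_def] .
qed

lemma cube_integral_square: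
  fixes f :: "'d::finite \<Rightarrow> nat \<Rightarrow> real \<Rightarrow> real"
  assumes "\<And>i m n. set_integrable lborel {0..1} (\<lambda>t. f i m t * f i n t)"
  shows "set_integrable lebesgue unit_cube (\<lambda>x::real^'d. (\<Sum>\<alpha>\<in>A. a \<alpha> * (\<Prod>i\<in>UNIV. f i (\<alpha> i) (x $ i)))\<^sup>2)"
    and "(LINT x:unit_cube|lebesgue. (\<Sum>\<alpha>\<in>A. a \<alpha> * (\<Prod>i\<in>UNIV. f i (\<alpha> i) (x $ i)))\<^sup>2)
      = (\<Sum>\<alpha>\<in>A. \<Sum>\<alpha>'\<in>A. a \<alpha> * a \<alpha>' * (\<Prod>i\<in>UNIV. LINT t:{0..1}|lborel. f i (\<alpha> i) t * f i (\<alpha>' i) t))"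
proof -
  have sq: "(\<Sum>\<alpha>\<in>A. a \<alpha> * (\<Prod>i\<in>UNIV. f i (\<alpha> i) (x $ i)))\<^sup>2
    = (\<Sum>\<alpha>\<in>A. \<Sum>\<alpha>'\<in>A. (a \<alpha> * a \<alpha>') * (\<Prod>i\<in>UNIV. f i (\<alpha> i) (x $ i) * f i (\<alpha>' i) (x $ i)))" for x :: "real^'d"
    by (simp add: power2_eq_square sum_product prod.distrib mult_ac)
  have 1: "set_integrable lebesgue unit_cube (\<lambda>x::real^'d. (a \<alpha> * a \<alpha>') * (\<Prod>i\<in>UNIV. f i (\<alpha> i) (x $ i) * f i (\<alpha>' i) (x $ i)))" for \<alpha> \<alpha>'
    by (intro set_integrable_mult_right cube_integral_prod(1) assms)
  then show "set_integrable lebesgue unit_cube (\<lambda>x::real^'d. (\<Sum>\<alpha>\<in>A. a \<alpha> * (\<Prod>i\<in>UNIV. f i (\<alpha> i) (x $ i)))\<^sup>2)"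
    unfolding sq set_integrable_def scaleR_sum_right by (intro Bochner_Integration.integrable_sum)
  have "(LINT x:unit_cube|lebesgue. (\<Sum>\<alpha>\<in>A. a \<alpha> * (\<Prod>i\<in>UNIV. f i (\<alpha> i) (x $ i)))\<^sup>2)
     = (\<Sum>\<alpha>\<in>A. \<Sum>\<alpha>'\<in>A. LINT x:unit_cube|lebesgue. (a \<alpha> * a \<alpha>') * (\<Prod>i\<in>UNIV. f i (\<alpha> i) (x $ i) * f i (\<alpha>' i) (x $ i)))"
    using 1 unfolding sq set_lebesgue_integral_def set_integrable_def scaleR_sum_right
    by (simp add: Bochner_Integration.integral_sum Bochner_Integration.integrable_sum)
  also have "\<dots> = (\<Sum>\<alpha>\<in>A. \<Sum>\<alpha>'\<in>A. a \<alpha> * a \<alpha>' * (\<Prod>i\<in>UNIV. LINT t:{0..1}|lborel. f i (\<alpha> i) t * f i (\<alpha>' i) t))"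
    by (simp only: set_integral_mult_right cube_integral_prod(2)[OF assms])
  finally show "(LINT x:unit_cube|lebesgue. (\<Sum>\<alpha>\<in>A. a \<alpha> * (\<Prod>i\<in>UNIV. f i (\<alpha> i) (x $ i)))\<^sup>2)
      = (\<Sum>\<alpha>\<in>A. \<Sum>\<alpha>'\<in>A. a \<alpha> * a \<alpha>' * (\<Prod>i\<in>UNIV. LINT t:{0..1}|lborel. f i (\<alpha> i) t * f i (\<alpha>' i) t))" .
qed

section \<open>Derivatives and the stiffness matrix in one dimension\<close>

definition hat_deriv :: "real \<Rightarrow> real" where
  "hat_deriv t = indicator {-1<..<0} t - indicator {0<..<1} t"

definition fs_deriv :: "nat \<Rightarrow> real \<Rightarrow> real" where
  "fs_deriv m t = 2 ^ lev m * hat_deriv (2 ^ lev m * t - real (node m))"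

lemma DERIV_hat:
  assumes "t \<notin> {-1, 0, 1}"
  shows "(hat has_real_derivative hat_deriv t) (at t)"
proof -
  consider "t < -1" | "-1 < t" "t < 0" | "0 < t" "t < 1" | "1 < t" using assms by fastforce
  then show ?thesis
  proof cases
    case 1
    show ?thesis
      by (rule has_field_derivative_transform_within_open[of "\<lambda>_. 0" _ _ "{..< -1}"])
        (use 1 in \<open>auto simp: hat_deriv_def hat_def\<close>)
  next
    case 2
    show ?thesis
      by (rule has_field_derivative_transform_within_open[of "\<lambda>t. 1 + t" _ _ "{-1<..<0}"])
        (use 2 in \<open>auto simp: hat_deriv_def hat_def intro!: derivative_eq_intros\<close>)
  next
    case 3
    show ?thesis
      by (rule has_field_derivative_transform_within_open[of "\<lambda>t. 1 - t" _ _ "{0<..<1}"])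
        (use 3 in \<open>auto simp: hat_deriv_def hat_def intro!: derivative_eq_intros\<close>)
  next
    case 4
    show ?thesis
      by (rule has_field_derivative_transform_within_open[of "\<lambda>_. 0" _ _ "{1<..}"])
        (use 4 in \<open>auto simp: hat_deriv_def hat_def\<close>)
  qed
qed

lemma DERIV_fs:
  assumes "2 ^ lev m * t - real (node m) \<notin> {-1, 0, 1}"
  shows "(faber_schauder m has_real_derivative fs_deriv m t) (at t)"
proof -
  have "((\<lambda>t. hat (2 ^ lev m * t - real (node m))) has_real_derivative
     hat_deriv (2 ^ lev m * t - real (node m)) * 2 ^ lev m) (at t)"
    by (rule DERIV_chain2[where g="\<lambda>t. 2 ^ lev m * t - real (node m)", OF DERIV_hat[OF assms]])
       (auto intro!: derivative_eq_intros)
  then show ?thesis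
    by (simp add: fs_deriv_def fs_eq_hat[abs_def] mult.commute)
qed

lemma fs_deriv_has_integral:
  assumes "a \<le> b"
  shows "(fs_deriv m has_integral faber_schauder m b - faber_schauder m a) {a..b}"
proof (rule fundamental_theorem_of_calculus_interior_strong)
  let ?S = "(\<lambda>s. (s + real (node m)) / 2 ^ lev m) ` {-1, 0, 1}"
  show "finite ?S" by simp
  show "continuous_on {a..b} (faber_schauder m)"
    using continuous_on_fs[OF continuous_on_id, of _ m] by simp
  fix x assume "x \<in> {a<..<b} - ?S"
  then have x: "x \<notin> ?S" by blast
  have "2 ^ lev m * x - real (node m) \<notin> {-1, 0, 1}"
  proof
    assume "2 ^ lev m * x - real (node m) \<in> {-1, 0, 1}"
    then have "(2 ^ lev m * x - real (node m) + real (node m)) / 2 ^ lev m \<in> ?S" by (rule imageI)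
    then show False using x by simp
  qed
  then show "(faber_schauder m has_vector_derivative fs_deriv m x) (at x)"
    by (simp add: DERIV_fs has_real_derivative_iff_has_vector_derivative[symmetric])
qed (use assms in auto)

lemma hat_deriv_measurable [measurable]: "hat_deriv \<in> borel_measurable borel"
  unfolding hat_deriv_def by measurable

lemma fs_deriv_mult_integrable: "set_integrable lborel {0..1} (\<lambda>t. fs_deriv m t * fs_deriv n t)"
proof (rule set_integrable_bound)
  show "set_integrable lborel {0..1} (\<lambda>t::real. 2 ^ lev m * (2::real) ^ lev n)"
    by (rule borel_integrable_atLeastAtMost') (intro continuous_intros)
  show "set_borel_measurable lborel {0..1} (\<lambda>t. fs_deriv m t * fs_deriv n t)"
    unfolding set_borel_measurable_def fs_deriv_def by measurable
  have "\<bar>hat_deriv s\<bar> \<le> 1" for s by (auto simp: hat_deriv_def indicator_def)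
  then have "\<bar>hat_deriv s\<bar> * \<bar>hat_deriv s'\<bar> \<le> 1" for s s'
    by (simp add: mult_le_one)
  then show "AE t in lborel. t \<in> {0..1} \<longrightarrow> norm (fs_deriv m t * fs_deriv n t) \<le> norm (2 ^ lev m * (2::real) ^ lev n)"
    by (intro AE_I2) (simp add: fs_deriv_def abs_mult mult_ac mult_le_cancel_left1)
qed

text \<open>The derivative of \<open>faber_schauder m\<close> is \<open>N\<close> on the left and
  \<open>- N\<close> on the right half of its support. Integrating it against the derivative of
  \<open>faber_schauder n\<close> gives \<open>2 * N\<close> times the hierarchical surplus of the
  latter, so diagonality is the duality \<open>surplus_fs\<close>.\<close>

lemma stiffness:
  assumes "1 \<le> m" "1 \<le> n"
  shows "(LINT t:{0..1}|lborel. fs_deriv m t * fs_deriv n t) = (if m = n then 2 * 2 ^ lev m else 0)"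
proof -
  define N :: real where "N = 2 ^ lev m"
  define l c r where "l = real (node m - 1) / N" and "c = real (node m) / N" and "r = real (node m + 1) / N"
  have N: "N > 0" by (simp add: N_def)
  have nl: "real (node m) + 1 \<le> N" "real (node m) \<ge> 1" "real (node m - 1) = real (node m) - 1"
    using node_less[OF assms(1)] unfolding N_def
    by (simp_all add: of_nat_diff) (metis Suc_le_eq add.commute of_nat_Suc of_nat_le_numeral_power_cancel_iff)
  have ord: "0 \<le> l" "l \<le> c" "c \<le> r" "r \<le> 1"
    using N nl by (auto simp: l_def c_def r_def divide_right_mono)
  let ?f = "\<lambda>t. fs_deriv m t * fs_deriv n t"
  have dm: "fs_deriv m t = (if l < t \<and> t < c then N else if c < t \<and> t < r then - N else 0)" for t
  proof -
    have "l < t \<longleftrightarrow> - 1 < N * t - real (node m)" "t < c \<longleftrightarrow> N * t - real (node m) < 0"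
      "c < t \<longleftrightarrow> 0 < N * t - real (node m)" "t < r \<longleftrightarrow> N * t - real (node m) < 1"
      using N nl by (auto simp: l_def c_def r_def field_simps)
    then show ?thesis
      by (auto simp: fs_deriv_def hat_deriv_def N_def[symmetric])
  qed
  \<comment> \<open>The endpoints are exempted because \<open>fs_deriv m\<close> is 0 at the kinks
    rather than a one-sided slope.\<close>
  have lc: "(?f has_integral N * (faber_schauder n c - faber_schauder n l)) {l..c}"
    by (rule has_integral_spike_finite[of "{l, c}" _ _ "\<lambda>t. N * fs_deriv n t"])
      (auto simp: dm intro!: has_integral_mult_right fs_deriv_has_integral ord)
  have cr: "(?f has_integral - N * (faber_schauder n r - faber_schauder n c)) {c..r}"
    by (rule has_integral_spike_finite[of "{c, r}" _ _ "\<lambda>t. - N * fs_deriv n t",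
        OF _ _ has_integral_mult_right[OF fs_deriv_has_integral[OF ord(3)]]])
      (use ord in \<open>auto simp: dm\<close>)
  have z: "(?f has_integral 0) {0..l}" "(?f has_integral 0) {r..1}"
    using ord by (auto intro!: has_integral_is_0 simp: dm)
  have "(?f has_integral 0 + N * (faber_schauder n c - faber_schauder n l)) {0..c}"
    by (rule has_integral_combine[OF _ _ z(1) lc]) (use ord in auto)
  then have "(?f has_integral 0 + N * (faber_schauder n c - faber_schauder n l) + - N * (faber_schauder n r - faber_schauder n c)) {0..r}"
    by (rule has_integral_combine[rotated 2, OF _ cr]) (use ord in auto)
  then have "(?f has_integral 0 + N * (faber_schauder n c - faber_schauder n l) + - N * (faber_schauder n r - faber_schauder n c) + 0) {0..1}"
    by (rule has_integral_combine[rotated 2, OF _ z(2)]) (use ord in auto)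
  then have "integral {0..1} ?f = 2 * N * (faber_schauder n c - (faber_schauder n l + faber_schauder n r) / 2)"
    by (subst integral_unique) (auto simp: algebra_simps)
  also have "\<dots> = 2 * N * hierarchical_surplus m (faber_schauder n)"
    by (simp only: hierarchical_surplus_def l_def c_def r_def N_def)
  also have "\<dots> = (if m = n then 2 * 2 ^ lev m else 0)"
    using assms by (simp add: surplus_fs N_def)
  finally show ?thesis
    by (simp add: set_borel_integral_eq_integral(2)[OF fs_deriv_mult_integrable])
qed

lemma fs_mult_set_integrable: "set_integrable lborel {0..1} (\<lambda>t. faber_schauder m t * faber_schauder n t)"
  by (rule borel_integrable_atLeastAtMost') (intro continuous_intros)

lemma mass_eq_LINT: "(LINT t:{0..1}|lborel. faber_schauder m t * faber_schauder n t) = mass m n"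
  unfolding mass_def by (rule set_borel_integral_eq_integral(2)[OF fs_mult_set_integrable])

section \<open>The two norms of a finite expansion\<close>

lemma L2_norm_square:
  "(L2_norm (\<lambda>x::real^'d::finite. \<Sum>\<alpha>\<in>A. a \<alpha> * tensor_faber_schauder \<alpha> x))\<^sup>2
    = (\<Sum>\<alpha>\<in>A. \<Sum>\<alpha>'\<in>A. a \<alpha> * a \<alpha>' * (\<Prod>i\<in>UNIV. mass (\<alpha> i) (\<alpha>' i)))"
proof -
  have "0 \<le> (LINT x:unit_cube|lebesgue. (\<Sum>\<alpha>\<in>A. a \<alpha> * tensor_faber_schauder \<alpha> (x::real^'d))\<^sup>2)"
    unfolding set_lebesgue_integral_def by (intro Bochner_Integration.integral_nonneg) auto
  then show ?thesis
    unfolding L2_norm_def tensor_faber_schauder_def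
    by (simp add: cube_integral_square(2)[of "\<lambda>_. faber_schauder", OF fs_mult_set_integrable] mass_eq_LINT)
qed

lemma AE_not_dyadic: "AE x in lebesgue. \<forall>i (k::nat) (z::int). 2 ^ k * (x::real^'d::finite) $ i \<noteq> of_int z"
  unfolding AE_all_countable
proof (intro allI)
  fix i :: 'd and k :: nat and z :: int
  have "negligible {x::real^'d. x $ i = of_int z / 2 ^ k}"
    by (simp add: cart_eq_inner_axis negligible_standard_hyperplane)
  then have "{x::real^'d. x $ i = of_int z / 2 ^ k} \<in> null_sets lebesgue"
    by (simp add: negligible_iff_null_sets)
  then have "AE x in lebesgue. x \<notin> {x::real^'d. x $ i = of_int z / 2 ^ k}"
    by (rule AE_not_in)
  then show "AE x in lebesgue. 2 ^ k * (x::real^'d) $ i \<noteq> of_int z"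
    by eventually_elim (auto simp: field_simps)
qed

definition partial_deriv :: "'d::finite \<Rightarrow> ('d \<Rightarrow> nat) set \<Rightarrow> (('d \<Rightarrow> nat) \<Rightarrow> real) \<Rightarrow> real ^ 'd \<Rightarrow> real" where
  "partial_deriv j A a x = (\<Sum>\<alpha>\<in>A. a \<alpha> * (\<Prod>i\<in>UNIV. (if i = j then fs_deriv (\<alpha> i) (x $ i) else faber_schauder (\<alpha> i) (x $ i))))"

text \<open>Off the dyadic hyperplanes no coordinate meets a kink, so the product rule applies.
  Uniqueness of the gradient then determines the choice made by \<open>SOME\<close>.\<close>

lemma gradient_eq:
  fixes x :: "real^'d::finite"
  assumes "\<And>i (k::nat) (z::int). 2 ^ k * x $ i \<noteq> of_int z"
  shows "gradient (\<lambda>x. \<Sum>\<alpha>\<in>A. a \<alpha> * tensor_faber_schauder \<alpha> x) x = (\<chi> j. partial_deriv j A a x)"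
proof -
  let ?u = "\<lambda>x. \<Sum>\<alpha>\<in>A. a \<alpha> * tensor_faber_schauder \<alpha> x"
  let ?D = "\<chi> j. partial_deriv j A a x"
  have 1: "((\<lambda>x::real^'d. faber_schauder m (x $ i)) has_derivative (\<lambda>h. fs_deriv m (x $ i) * h $ i)) (at x)" for m i
  proof -
    have "2 ^ lev m * x $ i - real (node m) \<notin> {-1, 0, 1}"
      using assms[of "lev m" i "int (node m) - 1"] assms[of "lev m" i "int (node m)"] assms[of "lev m" i "int (node m) + 1"]
      by auto
    then have "(faber_schauder m has_derivative (*) (fs_deriv m (x $ i))) (at (x $ i))"
      using DERIV_fs by (simp add: has_field_derivative_def)
    moreover have "((\<lambda>x::real^'d. x $ i) has_derivative (\<lambda>h. h $ i)) (at x)"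
      by (rule bounded_linear.has_derivative[OF bounded_linear_vec_nth]) (rule has_derivative_ident)
    ultimately show ?thesis by (rule has_derivative_compose[rotated])
  qed
  have "((\<lambda>x. \<Sum>\<alpha>\<in>A. a \<alpha> * (\<Prod>i\<in>UNIV. faber_schauder (\<alpha> i) (x $ i))) has_derivative
     (\<lambda>h. \<Sum>\<alpha>\<in>A. a \<alpha> * (\<Sum>j\<in>UNIV. fs_deriv (\<alpha> j) (x $ j) * h $ j * (\<Prod>i\<in>UNIV - {j}. faber_schauder (\<alpha> i) (x $ i))))) (at x)"
    by (intro has_derivative_sum has_derivative_mult_right has_derivative_prod 1)
  also have "(\<lambda>h. \<Sum>\<alpha>\<in>A. a \<alpha> * (\<Sum>j\<in>UNIV. fs_deriv (\<alpha> j) (x $ j) * h $ j * (\<Prod>i\<in>UNIV - {j}. faber_schauder (\<alpha> i) (x $ i)))) = (\<lambda>h. h \<bullet> ?D)"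
  proof
    fix h :: "real^'d"
    have p: "(\<Prod>i\<in>UNIV. (if i = j then fs_deriv (\<alpha> i) (x $ i) else faber_schauder (\<alpha> i) (x $ i)))
       = fs_deriv (\<alpha> j) (x $ j) * (\<Prod>i\<in>UNIV - {j}. faber_schauder (\<alpha> i) (x $ i))" for \<alpha> :: "'d \<Rightarrow> nat" and j
      by (subst prod.remove[of _ j]) (auto intro!: prod.cong)
    show "(\<Sum>\<alpha>\<in>A. a \<alpha> * (\<Sum>j\<in>UNIV. fs_deriv (\<alpha> j) (x $ j) * h $ j * (\<Prod>i\<in>UNIV - {j}. faber_schauder (\<alpha> i) (x $ i)))) = h \<bullet> ?D"
      unfolding inner_vec_def partial_deriv_def p sum_distrib_left
      by (subst sum.swap) (simp add: sum_distrib_left mult_ac)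
  qed
  finally have D: "GDERIV ?u x :> ?D"
    unfolding gderiv_def tensor_faber_schauder_def .
  show ?thesis
    unfolding gradient_def
  proof (rule some_equality)
    show "GDERIV ?u x :> ?D" by (rule D)
    fix D' assume "GDERIV ?u x :> D'"
    then have "(\<lambda>h. h \<bullet> D') = (\<lambda>h. h \<bullet> ?D)"
      using D unfolding gderiv_def by (rule has_derivative_unique)
    then show "D' = ?D" by (metis vector_eq_ldot)
  qed
qed

lemma H10_norm_square:
  fixes a :: "('d::finite \<Rightarrow> nat) \<Rightarrow> real"
  shows "(H10_norm (\<lambda>x. \<Sum>\<alpha>\<in>A. a \<alpha> * tensor_faber_schauder \<alpha> x))\<^sup>2
    = (\<Sum>j\<in>UNIV. \<Sum>\<alpha>\<in>A. \<Sum>\<alpha>'\<in>A. a \<alpha> * a \<alpha>' *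
        (\<Prod>i\<in>UNIV. if i = j then (LINT t:{0..1}|lborel. fs_deriv (\<alpha> i) t * fs_deriv (\<alpha>' i) t) else mass (\<alpha> i) (\<alpha>' i)))"
proof -
  let ?u = "\<lambda>x. \<Sum>\<alpha>\<in>A. a \<alpha> * tensor_faber_schauder \<alpha> x"
  define f where "f j i m t = (if i = j then fs_deriv m t else faber_schauder m t)" for i j :: 'd and m t
  have f_int: "set_integrable lborel {0..1} (\<lambda>t. f j i m t * f j i n t)" for i j m n
    by (cases "i = j") (simp_all add: f_def fs_deriv_mult_integrable fs_mult_set_integrable)
  have pd: "partial_deriv j A a x = (\<Sum>\<alpha>\<in>A. a \<alpha> * (\<Prod>i\<in>UNIV. f j i (\<alpha> i) (x $ i)))" for j x
    by (simp add: partial_deriv_def f_def)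
  have int: "set_integrable lebesgue unit_cube (\<lambda>x. (partial_deriv j A a x)\<^sup>2)" for j
    unfolding pd by (rule cube_integral_square(1)) (rule f_int)
  have AE: "AE x in lebesgue. indicator unit_cube x *\<^sub>R (\<Sum>j\<in>UNIV. (partial_deriv j A a x)\<^sup>2)
     = indicator unit_cube x *\<^sub>R (norm (gradient ?u x))\<^sup>2"
    using AE_not_dyadic
  proof eventually_elim
    case (elim x)
    then have "gradient ?u x = (\<chi> j. partial_deriv j A a x)" by (intro gradient_eq) auto
    then show ?case by (simp add: power2_norm_eq_inner inner_vec_def flip: power2_eq_square)
  qed
  have meas: "(\<lambda>x. indicator unit_cube x *\<^sub>R (\<Sum>j\<in>UNIV. (partial_deriv j A a x)\<^sup>2)) \<in> borel_measurable lebesgue"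
    using int unfolding set_integrable_def scaleR_sum_right
    by (intro borel_measurable_sum borel_measurable_integrable) auto
  \<comment> \<open>The gradient is known only almost everywhere. Its measurability comes from that
    of the partial derivatives and completeness of \<open>lebesgue\<close>.\<close>
  have "(LINT x:unit_cube|lebesgue. (norm (gradient ?u x))\<^sup>2) = (LINT x:unit_cube|lebesgue. (\<Sum>j\<in>UNIV. (partial_deriv j A a x)\<^sup>2))"
    unfolding set_lebesgue_integral_def
    by (rule integral_cong_AE[symmetric, OF meas borel_measurable_AE[OF meas AE] AE])
  also have "\<dots> = (\<Sum>j\<in>UNIV. LINT x:unit_cube|lebesgue. (partial_deriv j A a x)\<^sup>2)"
    using int unfolding set_lebesgue_integral_def set_integrable_def scaleR_sum_right
    by (rule Bochner_Integration.integral_sum)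
  also have "\<dots> = (\<Sum>j\<in>UNIV. \<Sum>\<alpha>\<in>A. \<Sum>\<alpha>'\<in>A. a \<alpha> * a \<alpha>' *
        (\<Prod>i\<in>UNIV. LINT t:{0..1}|lborel. f j i (\<alpha> i) t * f j i (\<alpha>' i) t))"
    unfolding pd by (intro sum.cong refl cube_integral_square(2) f_int)
  also have "\<dots> = (\<Sum>j\<in>UNIV. \<Sum>\<alpha>\<in>A. \<Sum>\<alpha>'\<in>A. a \<alpha> * a \<alpha>' *
        (\<Prod>i\<in>UNIV. if i = j then (LINT t:{0..1}|lborel. fs_deriv (\<alpha> i) t * fs_deriv (\<alpha>' i) t) else mass (\<alpha> i) (\<alpha>' i)))"
    by (intro sum.cong refl arg_cong2[of _ _ _ _ "(*)"] prod.cong) (simp add: f_def mass_eq_LINT)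
  finally have eq: "(LINT x:unit_cube|lebesgue. (norm (gradient ?u x))\<^sup>2) = \<dots>" .
  have "0 \<le> (LINT x:unit_cube|lebesgue. (norm (gradient ?u x))\<^sup>2)"
    unfolding set_lebesgue_integral_def by (intro Bochner_Integration.integral_nonneg) auto
  then show ?thesis unfolding H10_norm_def by (simp add: eq)
qed

section \<open>The upper estimate\<close>

lemma le_norm_max: "\<beta> i \<le> norm_max \<beta>" for \<beta> :: "'d::finite \<Rightarrow> nat"
  by (simp add: norm_max_def)

lemma norm_max_attained: "\<exists>i. norm_max \<beta> = \<beta> i" for \<beta> :: "'d::finite \<Rightarrow> nat"
proof -
  have "norm_max \<beta> \<in> range \<beta>" unfolding norm_max_def by (intro Max_in) auto
  then show ?thesis by auto
qed

lemma norm_max_le_norm_one: "norm_max \<beta> \<le> norm_one \<beta>" for \<beta> :: "'d::finite \<Rightarrow> nat"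
proof -
  obtain i where "norm_max \<beta> = \<beta> i" using norm_max_attained by blast
  then show ?thesis unfolding norm_one_def by (simp add: member_le_sum)
qed

lemma power_norm_one: "(\<Prod>i\<in>UNIV. c ^ \<beta> i) = c ^ norm_one \<beta>" for \<beta> :: "'d::finite \<Rightarrow> nat" and c :: real
  by (simp add: norm_one_def power_sum)

lemma power_norm_max_le: "(4::real) ^ norm_max \<beta> \<le> (\<Sum>j\<in>UNIV. 4 ^ \<beta> j)" for \<beta> :: "'d::finite \<Rightarrow> nat"
proof -
  obtain i where i: "norm_max \<beta> = \<beta> i" using norm_max_attained by blast
  show ?thesis unfolding i by (rule member_le_sum) auto
qed

text \<open>Over \<open>UNIV\<close> the extensional product imposes nothing on the functions. This
  form allows products of sums to be expanded by \<open>prod_sum_PiE\<close>.\<close>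

definition coarse_indices :: "nat \<Rightarrow> ('d::finite \<Rightarrow> nat) set" where
  "coarse_indices K = PiE UNIV (\<lambda>_. {1..<2^K})"

lemma finite_coarse_indices: "finite (coarse_indices K :: ('d::finite \<Rightarrow> nat) set)"
  unfolding coarse_indices_def by (intro finite_PiE) auto

lemma block_indices_PiE: "block_indices \<beta> = PiE UNIV (\<lambda>i. level_indices (\<beta> i))"
  by (auto simp: block_indices_def PiE_UNIV_domain)

lemma finite_block_indices: "finite (block_indices \<beta>)"
  unfolding block_indices_PiE by (intro finite_PiE finite_level_indices) auto

lemma block_indicesD:
  assumes "\<alpha> \<in> block_indices \<beta>"
  shows "1 \<le> \<alpha> i" "lev (\<alpha> i) = \<beta> i"
proof -
  have "\<alpha> i \<in> level_indices (\<beta> i)" using assms by (simp add: block_indices_def)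
  then show "1 \<le> \<alpha> i" "lev (\<alpha> i) = \<beta> i" by (rule level_indices_pos, rule level_indices_lev)
qed

lemma block_indices_lev:
  assumes "\<alpha> \<in> block_indices \<beta>"
  shows "(\<lambda>i. lev (\<alpha> i)) = \<beta>"
  using block_indicesD(2)[OF assms] by auto

lemma block_indicesI:
  assumes "\<And>i. 1 \<le> \<alpha> i" "\<And>i. lev (\<alpha> i) = \<beta> i"
  shows "\<alpha> \<in> block_indices \<beta>"
  unfolding block_indices_def using assms by (auto simp only: mem_level_indices)

lemma coarse_indices_iff: "\<alpha> \<in> coarse_indices K \<longleftrightarrow> (\<forall>i. 1 \<le> \<alpha> i \<and> lev (\<alpha> i) \<le> K)"
proof -
  have "1 \<le> m \<and> m < 2 ^ K \<longleftrightarrow> 1 \<le> m \<and> lev m \<le> K" for m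
    using floorlog_leI[of m 2 K] floorlog_leD[of 2 m K] by auto
  then show ?thesis
    unfolding coarse_indices_def by (simp only: PiE_UNIV_domain Pi_iff atLeastLessThan_iff) auto
qed

lemma block_subset_coarse: "(\<And>i. \<beta> i \<le> K) \<Longrightarrow> block_indices \<beta> \<subseteq> coarse_indices K"
  unfolding coarse_indices_iff[abs_def] subset_iff using block_indicesD by metis

lemma sum_coarse_blocks:
  fixes \<Lambda> :: "('d::finite \<Rightarrow> nat) set" and g :: "('d \<Rightarrow> nat) \<Rightarrow> real"
  assumes "finite \<Lambda>" "\<And>\<beta> i. \<beta> \<in> \<Lambda> \<Longrightarrow> \<beta> i \<le> K"
    and "\<And>\<alpha>. \<alpha> \<in> coarse_indices K \<Longrightarrow> (\<lambda>i. lev (\<alpha> i)) \<notin> \<Lambda> \<Longrightarrow> g \<alpha> = 0"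
  shows "(\<Sum>\<alpha>\<in>coarse_indices K. g \<alpha>) = (\<Sum>\<beta>\<in>\<Lambda>. \<Sum>\<alpha>\<in>block_indices \<beta>. g \<alpha>)"
proof -
  define Q where "Q = {\<alpha> \<in> coarse_indices K. (\<lambda>i. lev (\<alpha> i)) \<in> \<Lambda>}"
  have "finite Q"
    unfolding Q_def by (rule finite_subset[OF _ finite_coarse_indices[of K]]) auto
  have "(\<Sum>\<alpha>\<in>coarse_indices K. g \<alpha>) = (\<Sum>\<alpha>\<in>Q. g \<alpha>)"
    using assms(3) finite_coarse_indices by (intro sum.mono_neutral_right) (auto simp: Q_def)
  also have "\<dots> = (\<Sum>\<beta>\<in>\<Lambda>. \<Sum>\<alpha>\<in>{\<alpha> \<in> Q. (\<lambda>i. lev (\<alpha> i)) = \<beta>}. g \<alpha>)"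
    using \<open>finite Q\<close> assms(1) by (intro sum.group[symmetric]) (auto simp: Q_def)
  also have "\<dots> = (\<Sum>\<beta>\<in>\<Lambda>. \<Sum>\<alpha>\<in>block_indices \<beta>. g \<alpha>)"
  proof (intro sum.cong refl)
    fix \<beta> assume \<beta>: "\<beta> \<in> \<Lambda>"
    show "{\<alpha> \<in> Q. (\<lambda>i. lev (\<alpha> i)) = \<beta>} = block_indices \<beta>"
    proof (intro equalityI subsetI)
      fix \<alpha> assume "\<alpha> \<in> {\<alpha> \<in> Q. (\<lambda>i. lev (\<alpha> i)) = \<beta>}"
      then show "\<alpha> \<in> block_indices \<beta>"
        by (intro block_indicesI) (auto simp: Q_def coarse_indices_iff)
    next
      fix \<alpha> assume \<alpha>: "\<alpha> \<in> block_indices \<beta>"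
      then show "\<alpha> \<in> {\<alpha> \<in> Q. (\<lambda>i. lev (\<alpha> i)) = \<beta>}"
        using block_subset_coarse[of \<beta> K] assms(2) \<beta> by (auto simp: Q_def block_indices_lev[OF \<alpha>])
    qed
  qed
  finally show ?thesis .
qed

text \<open>Distinct indices of one block differ in some direction, where the two factors have the
  same level and disjoint open supports. Hence the Gram matrix of a block is diagonal.\<close>

lemma L2_norm_block_square:
  fixes \<beta> :: "'d::finite \<Rightarrow> nat"
  shows "(L2_norm (\<lambda>x::real^'d. \<Sum>\<alpha>\<in>block_indices \<beta>. a \<alpha> * tensor_faber_schauder \<alpha> x))\<^sup>2
    = (\<Sum>\<alpha>\<in>block_indices \<beta>. (a \<alpha>)\<^sup>2 * (\<Prod>i\<in>UNIV. mass (\<alpha> i) (\<alpha> i)))"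
proof -
  have "a \<alpha> * a \<alpha>' * (\<Prod>i\<in>UNIV. mass (\<alpha> i) (\<alpha>' i)) = (if \<alpha>' = \<alpha> then (a \<alpha>)\<^sup>2 * (\<Prod>i\<in>UNIV. mass (\<alpha> i) (\<alpha> i)) else 0)"
    if \<alpha>: "\<alpha> \<in> block_indices \<beta>" "\<alpha>' \<in> block_indices \<beta>" for \<alpha> \<alpha>'
  proof (cases "\<alpha>' = \<alpha>")
    case False
    then obtain i where "\<alpha> i \<noteq> \<alpha>' i" by (metis ext)
    then have "mass (\<alpha> i) (\<alpha>' i) = 0"
      using block_indicesD[OF \<alpha>(1), of i] block_indicesD[OF \<alpha>(2), of i] by (intro mass_same_level) auto
    then have "(\<Prod>i\<in>UNIV. mass (\<alpha> i) (\<alpha>' i)) = 0" by (intro prod_zero) auto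
    then show ?thesis using False by simp
  qed (simp add: power2_eq_square)
  then have "(\<Sum>\<alpha>\<in>block_indices \<beta>. \<Sum>\<alpha>'\<in>block_indices \<beta>. a \<alpha> * a \<alpha>' * (\<Prod>i\<in>UNIV. mass (\<alpha> i) (\<alpha>' i)))
    = (\<Sum>\<alpha>\<in>block_indices \<beta>. \<Sum>\<alpha>'\<in>block_indices \<beta>. if \<alpha>' = \<alpha> then (a \<alpha>)\<^sup>2 * (\<Prod>i\<in>UNIV. mass (\<alpha> i) (\<alpha> i)) else 0)"
    by (intro sum.cong refl) auto
  then show ?thesis by (simp add: L2_norm_square finite_block_indices)
qed

lemma L2_norm_block_le:
  fixes \<beta> :: "'d::finite \<Rightarrow> nat"
  shows "(L2_norm (\<lambda>x::real^'d. \<Sum>\<alpha>\<in>block_indices \<beta>. a \<alpha> * tensor_faber_schauder \<alpha> x))\<^sup>2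
    \<le> 2 ^ CARD('d) / 2 ^ norm_one \<beta> * (\<Sum>\<alpha>\<in>block_indices \<beta>. (a \<alpha>)\<^sup>2)"
proof -
  have "(a \<alpha>)\<^sup>2 * (\<Prod>i\<in>UNIV. mass (\<alpha> i) (\<alpha> i)) \<le> (a \<alpha>)\<^sup>2 * (\<Prod>i\<in>UNIV. 2 / 2 ^ \<beta> i)" if \<alpha>: "\<alpha> \<in> block_indices \<beta>" for \<alpha>
  proof (intro mult_left_mono prod_mono conjI)
    fix i
    show "0 \<le> mass (\<alpha> i) (\<alpha> i)"
      by (rule order_trans[OF _ mass_diag_ge[OF block_indicesD(1)[OF \<alpha>]]]) simp
    show "mass (\<alpha> i) (\<alpha> i) \<le> 2 / 2 ^ \<beta> i"
      using mass_diag_le[of "\<alpha> i"] block_indicesD(2)[OF \<alpha>, of i] by simp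
  qed auto
  moreover have "(\<Prod>i\<in>UNIV. 2 / 2 ^ \<beta> i :: real) = 2 ^ CARD('d) / 2 ^ norm_one \<beta>"
    by (simp add: prod_dividef power_norm_one)
  ultimately show ?thesis
    unfolding L2_norm_block_square sum_distrib_left by (intro sum_mono) (simp add: mult.commute)
qed

lemma gram_tensor_form_eq:
  fixes F M :: "'d::finite \<Rightarrow> nat \<Rightarrow> nat \<Rightarrow> real"
  assumes "\<And>i m n. m \<in> {1..<2^K} \<Longrightarrow> n \<in> {1..<2^K} \<Longrightarrow> F i m n = (\<Sum>l\<in>{1..<2^K}. M i m l * M i n l)"
  shows "(\<Sum>\<alpha>\<in>coarse_indices K. \<Sum>\<alpha>'\<in>coarse_indices K. a \<alpha> * a \<alpha>' * (\<Prod>i\<in>UNIV. F i (\<alpha> i) (\<alpha>' i)))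
    = (\<Sum>\<gamma>\<in>coarse_indices K. (\<Sum>\<alpha>\<in>coarse_indices K. a \<alpha> * (\<Prod>i\<in>UNIV. M i (\<alpha> i) (\<gamma> i)))\<^sup>2)"
proof (rule gram_form_eq)
  fix \<alpha> \<alpha>' :: "'d \<Rightarrow> nat" assume "\<alpha> \<in> coarse_indices K" "\<alpha>' \<in> coarse_indices K"
  then have "(\<Prod>i\<in>UNIV. F i (\<alpha> i) (\<alpha>' i)) = (\<Prod>i\<in>UNIV. \<Sum>l\<in>{1..<2^K}. M i (\<alpha> i) l * M i (\<alpha>' i) l)"
    by (intro prod.cong refl assms) (auto simp: coarse_indices_def)
  also have "\<dots> = (\<Sum>\<gamma>\<in>coarse_indices K. \<Prod>i\<in>UNIV. M i (\<alpha> i) (\<gamma> i) * M i (\<alpha>' i) (\<gamma> i))"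
    unfolding coarse_indices_def by (rule prod_sum_PiE) auto
  finally show "(\<Prod>i\<in>UNIV. F i (\<alpha> i) (\<alpha>' i))
    = (\<Sum>\<gamma>\<in>coarse_indices K. (\<Prod>i\<in>UNIV. M i (\<alpha> i) (\<gamma> i)) * (\<Prod>i\<in>UNIV. M i (\<alpha>' i) (\<gamma> i)))"
    by (simp add: prod.distrib)
qed

section \<open>Passage to orthonormal coefficients and back\<close>

context faber_schauder_orthonormalisation
begin

definition orthonormal_coeff :: "(('d::finite \<Rightarrow> nat) \<Rightarrow> real) \<Rightarrow> ('d \<Rightarrow> nat) \<Rightarrow> real" where
  "orthonormal_coeff a \<gamma> = (\<Sum>\<alpha>\<in>coarse_indices K. a \<alpha> * (\<Prod>i\<in>UNIV. T (\<alpha> i) (\<gamma> i)))"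

text \<open>The energy is a sum over \<open>j\<close> of forms with stiffness in direction
  \<open>j\<close> and mass elsewhere. In the \<open>j\<close>-th form
  \<open>orthonormal_coefficients_bound\<close> is used in direction \<open>j\<close> and equality
  in all others, joined by \<open>tensor_sum_squares_le\<close>.\<close>

lemma orthonormal_coeff_H10_bound:
  fixes a :: "('d::finite \<Rightarrow> nat) \<Rightarrow> real"
  shows "(\<Sum>\<gamma>\<in>coarse_indices K. (\<Sum>j\<in>UNIV. 4 ^ lev (\<gamma> j)) * (orthonormal_coeff a \<gamma>)\<^sup>2)
    \<le> 2 * (H10_norm (\<lambda>x. \<Sum>\<alpha>\<in>coarse_indices K. a \<alpha> * tensor_faber_schauder \<alpha> x))\<^sup>2"
proof -
  let ?R = "{1..<2^K} :: nat set" and ?Q = "coarse_indices K :: ('d \<Rightarrow> nat) set"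
  define st where "st m n = (LINT t:{0..1}|lborel. fs_deriv m t * fs_deriv n t)" for m n
  define H where "H j = (\<Sum>\<alpha>\<in>?Q. \<Sum>\<alpha>'\<in>?Q. a \<alpha> * a \<alpha>' *
        (\<Prod>i\<in>UNIV. if i = j then st (\<alpha> i) (\<alpha>' i) else mass (\<alpha> i) (\<alpha>' i)))" for j
  have step: "(\<Sum>\<gamma>\<in>?Q. 4 ^ lev (\<gamma> j) * (orthonormal_coeff a \<gamma>)\<^sup>2) \<le> 2 * H j" for j
  proof -
    \<comment> \<open>The diagonal square root of twice the stiffness matrix: it writes the right
      side of the one-dimensional estimate as a sum of squares.\<close>
    define E :: "nat \<Rightarrow> nat \<Rightarrow> real" where "E m l = (if m = l then sqrt (4 * 2 ^ lev m) else 0)" for m l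
    define M where "M i m n = (if i = j then 2 ^ lev n * T m n else T m n)" for i m n
    define M' where "M' i m n = (if i = j then E m n else T m n)" for i m n
    have pM: "(\<Prod>i\<in>UNIV. M i (\<alpha> i) (\<gamma> i)) = 2 ^ lev (\<gamma> j) * (\<Prod>i\<in>UNIV. T (\<alpha> i) (\<gamma> i))" for \<alpha> \<gamma>
    proof -
      have "(\<Prod>i\<in>UNIV. M i (\<alpha> i) (\<gamma> i)) = (\<Prod>i\<in>UNIV. (if i = j then 2 ^ lev (\<gamma> i) else 1) * T (\<alpha> i) (\<gamma> i))"
        by (intro prod.cong refl) (simp add: M_def)
      then show ?thesis by (simp add: prod.distrib)
    qed
    have "(\<Sum>\<gamma>\<in>?Q. 4 ^ lev (\<gamma> j) * (orthonormal_coeff a \<gamma>)\<^sup>2) = (\<Sum>\<gamma>\<in>?Q. (\<Sum>\<alpha>\<in>?Q. a \<alpha> * (\<Prod>i\<in>UNIV. M i (\<alpha> i) (\<gamma> i)))\<^sup>2)"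
    proof (intro sum.cong refl)
      fix \<gamma> :: "'d \<Rightarrow> nat"
      have "(\<Sum>\<alpha>\<in>?Q. a \<alpha> * (\<Prod>i\<in>UNIV. M i (\<alpha> i) (\<gamma> i))) = 2 ^ lev (\<gamma> j) * orthonormal_coeff a \<gamma>"
        by (simp add: pM orthonormal_coeff_def sum_distrib_left mult.left_commute)
      moreover have "((2::real) ^ lev (\<gamma> j))\<^sup>2 = 4 ^ lev (\<gamma> j)" by (simp add: power2_eq_square flip: power_mult_distrib)
      ultimately show "4 ^ lev (\<gamma> j) * (orthonormal_coeff a \<gamma>)\<^sup>2 = (\<Sum>\<alpha>\<in>?Q. a \<alpha> * (\<Prod>i\<in>UNIV. M i (\<alpha> i) (\<gamma> i)))\<^sup>2"
        by (simp only: power_mult_distrib)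
    qed
    also have "\<dots> \<le> (\<Sum>\<gamma>\<in>?Q. (\<Sum>\<alpha>\<in>?Q. a \<alpha> * (\<Prod>i\<in>UNIV. M' i (\<alpha> i) (\<gamma> i)))\<^sup>2)"
      unfolding coarse_indices_def
    proof (rule tensor_sum_squares_le)
      fix i :: 'd and c :: "nat \<Rightarrow> real"
      show "(\<Sum>n\<in>?R. (\<Sum>m\<in>?R. c m * M i m n)\<^sup>2) \<le> (\<Sum>n\<in>?R. (\<Sum>m\<in>?R. c m * M' i m n)\<^sup>2)"
      proof (cases "i = j")
        case True
        have "(\<Sum>m\<in>?R. c m * E m n) = c n * sqrt (4 * 2 ^ lev n)" if "n \<in> ?R" for n
        proof -
          have "(\<Sum>m\<in>?R. c m * E m n) = (\<Sum>m\<in>?R. if m = n then c n * sqrt (4 * 2 ^ lev n) else 0)"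
            by (intro sum.cong refl) (simp add: E_def)
          also have "\<dots> = c n * sqrt (4 * 2 ^ lev n)"
            using that by (simp only: sum.delta finite_atLeastLessThan if_True)
          finally show ?thesis .
        qed
        then have "(\<Sum>n\<in>?R. (\<Sum>m\<in>?R. c m * E m n)\<^sup>2) = (\<Sum>n\<in>?R. (c n * sqrt (4 * 2 ^ lev n))\<^sup>2)"
          by (intro sum.cong refl) simp
        also have "\<dots> = 4 * (\<Sum>n\<in>?R. 2 ^ lev n * (c n)\<^sup>2)"
          unfolding sum_distrib_left by (intro sum.cong refl) (simp add: power_mult_distrib real_sqrt_pow2 mult_ac)
        finally show ?thesis
          using True orthonormal_coefficients_bound[of c] by (simp only: M_def M'_def if_True simp_thms)
      qed (simp add: M_def M'_def)
    qed simp
    also have "\<dots> = (\<Sum>\<alpha>\<in>?Q. \<Sum>\<alpha>'\<in>?Q. a \<alpha> * a \<alpha>' *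
        (\<Prod>i\<in>UNIV. if i = j then 2 * st (\<alpha> i) (\<alpha>' i) else mass (\<alpha> i) (\<alpha>' i)))"
    proof (rule gram_tensor_form_eq[symmetric])
      fix i :: 'd and m n assume mn: "m \<in> ?R" "n \<in> ?R"
      show "(if i = j then 2 * st m n else mass m n) = (\<Sum>l\<in>?R. M' i m l * M' i n l)"
      proof (cases "i = j")
        case True
        have "(\<Sum>l\<in>?R. E m l * E n l) = (\<Sum>l\<in>?R. if l = m then (if m = n then 4 * 2 ^ lev m else 0) else 0)"
          by (intro sum.cong refl) (auto simp: E_def)
        also have "\<dots> = (if m = n then 4 * 2 ^ lev m else 0)"
          using mn by (simp only: sum.delta finite_atLeastLessThan if_True)
        also have "\<dots> = 2 * st m n"
          using mn by (simp add: st_def stiffness)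
        finally show ?thesis using True by (simp only: M'_def if_True simp_thms)
      next
        case False
        then show ?thesis using mass_eq[OF mn] by (simp only: M'_def if_False)
      qed
    qed
    also have "\<dots> = 2 * H j"
    proof -
      have "(\<Prod>i\<in>UNIV. if i = j then 2 * st (\<alpha> i) (\<alpha>' i) else mass (\<alpha> i) (\<alpha>' i))
        = 2 * (\<Prod>i\<in>UNIV. if i = j then st (\<alpha> i) (\<alpha>' i) else mass (\<alpha> i) (\<alpha>' i))" for \<alpha> \<alpha>'
      proof -
        have "(\<Prod>i\<in>UNIV. if i = j then 2 * st (\<alpha> i) (\<alpha>' i) else mass (\<alpha> i) (\<alpha>' i))
          = (\<Prod>i\<in>UNIV. (if i = j then 2 else 1) * (if i = j then st (\<alpha> i) (\<alpha>' i) else mass (\<alpha> i) (\<alpha>' i)))"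
          by (intro prod.cong refl) simp
        then show ?thesis by (simp add: prod.distrib)
      qed
      then show ?thesis by (simp add: H_def sum_distrib_left mult_ac)
    qed
    finally show ?thesis .
  qed
  have "(\<Sum>\<gamma>\<in>?Q. (\<Sum>j\<in>UNIV. 4 ^ lev (\<gamma> j)) * (orthonormal_coeff a \<gamma>)\<^sup>2)
    = (\<Sum>j\<in>UNIV. \<Sum>\<gamma>\<in>?Q. 4 ^ lev (\<gamma> j) * (orthonormal_coeff a \<gamma>)\<^sup>2)"
    unfolding sum_distrib_right by (rule sum.swap)
  also have "\<dots> \<le> (\<Sum>j\<in>UNIV. 2 * H j)"
    by (intro sum_mono step)
  also have "\<dots> = 2 * (H10_norm (\<lambda>x. \<Sum>\<alpha>\<in>?Q. a \<alpha> * tensor_faber_schauder \<alpha> x))\<^sup>2"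
    unfolding H10_norm_square H_def st_def sum_distrib_left[symmetric] ..
  finally show ?thesis .
qed

lemma orthonormal_coeff_inverse:
  fixes a :: "('d::finite \<Rightarrow> nat) \<Rightarrow> real"
  assumes "\<alpha> \<in> coarse_indices K"
  shows "a \<alpha> = (\<Sum>\<gamma>\<in>coarse_indices K. orthonormal_coeff a \<gamma> * (\<Prod>i\<in>UNIV. U (\<gamma> i) (\<alpha> i)))"
proof -
  let ?Q = "coarse_indices K :: ('d \<Rightarrow> nat) set"
  have "(\<Sum>\<gamma>\<in>?Q. orthonormal_coeff a \<gamma> * (\<Prod>i\<in>UNIV. U (\<gamma> i) (\<alpha> i)))
    = (\<Sum>\<alpha>'\<in>?Q. a \<alpha>' * (\<Sum>\<gamma>\<in>?Q. (\<Prod>i\<in>UNIV. T (\<alpha>' i) (\<gamma> i) * U (\<gamma> i) (\<alpha> i))))"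
    unfolding orthonormal_coeff_def sum_distrib_left sum_distrib_right prod.distrib
    by (subst sum.swap) (simp add: mult_ac)
  also have "\<dots> = (\<Sum>\<alpha>'\<in>?Q. if \<alpha>' = \<alpha> then a \<alpha>' else 0)"
  proof (intro sum.cong refl)
    fix \<alpha>' :: "'d \<Rightarrow> nat" assume \<alpha>': "\<alpha>' \<in> ?Q"
    have "(\<Sum>\<gamma>\<in>?Q. (\<Prod>i\<in>UNIV. T (\<alpha>' i) (\<gamma> i) * U (\<gamma> i) (\<alpha> i)))
      = (\<Prod>i\<in>UNIV. \<Sum>l\<in>{1..<2^K}. T (\<alpha>' i) l * U l (\<alpha> i))"
      unfolding coarse_indices_def by (rule prod_sum_PiE[symmetric]) auto
    also have "\<dots> = (\<Prod>i\<in>UNIV. if \<alpha>' i = \<alpha> i then 1 else 0)"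
      using assms \<alpha>' unfolding coarse_indices_def by (intro prod.cong refl T_U) auto
    also have "\<dots> = (if \<alpha>' = \<alpha> then 1 else 0)"
    proof (cases "\<alpha>' = \<alpha>")
      case False
      then obtain i where "\<alpha>' i \<noteq> \<alpha> i" by (metis ext)
      then have "(\<Prod>i\<in>UNIV. if \<alpha>' i = \<alpha> i then 1 else 0 :: real) = 0" by (intro prod_zero) auto
      then show ?thesis using False by (simp only: if_False)
    qed simp
    finally show "a \<alpha>' * (\<Sum>\<gamma>\<in>?Q. (\<Prod>i\<in>UNIV. T (\<alpha>' i) (\<gamma> i) * U (\<gamma> i) (\<alpha> i))) = (if \<alpha>' = \<alpha> then a \<alpha>' else 0)"
      by simp
  qed
  finally show ?thesis using assms by (simp add: finite_coarse_indices)
qed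

text \<open>A nonzero product of entries of \<open>T\<close> forces the levels of
  \<open>\<gamma>\<close> to lie below those of \<open>\<alpha>\<close>. Since
  \<open>\<Lambda>\<close> is monotone, orthonormalisation does not leave it.\<close>

lemma orthonormal_coeff_support:
  fixes a :: "('d::finite \<Rightarrow> nat) \<Rightarrow> real"
  assumes "monotone_index_set \<Lambda>"
    and "\<And>\<alpha>. \<alpha> \<in> coarse_indices K \<Longrightarrow> (\<lambda>i. lev (\<alpha> i)) \<notin> \<Lambda> \<Longrightarrow> a \<alpha> = 0"
    and \<gamma>: "\<gamma> \<in> coarse_indices K" "(\<lambda>i. lev (\<gamma> i)) \<notin> \<Lambda>"
  shows "orthonormal_coeff a \<gamma> = 0"
  unfolding orthonormal_coeff_def
proof (intro sum.neutral ballI)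
  fix \<alpha> :: "'d \<Rightarrow> nat" assume \<alpha>: "\<alpha> \<in> coarse_indices K"
  have mi: "(\<lambda>i. lev (\<gamma> i)) \<in> multi_indices"
    using \<gamma>(1) lev_bounds(1) unfolding multi_indices_def coarse_indices_iff by blast
  show "a \<alpha> * (\<Prod>i\<in>UNIV. T (\<alpha> i) (\<gamma> i)) = 0"
  proof (cases "(\<lambda>i. lev (\<alpha> i)) \<in> \<Lambda>")
    case True
    then have "\<not> (\<lambda>i. lev (\<gamma> i)) \<le> (\<lambda>i. lev (\<alpha> i))"
      using assms(1) mi \<gamma>(2) unfolding monotone_index_set_def by blast
    then obtain i where "lev (\<alpha> i) < lev (\<gamma> i)" by (auto simp: le_fun_def not_le)
    then have "T (\<alpha> i) (\<gamma> i) = 0" by (rule coarse_T_eq_0)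
    then have "(\<Prod>i\<in>UNIV. T (\<alpha> i) (\<gamma> i)) = 0" by (intro prod_zero) auto
    then show ?thesis by simp
  qed (simp add: assms(2)[OF \<alpha>])
qed

text \<open>The tensor power of \<open>block_coefficients_bound\<close>. Its right side is
  represented by a multiple \<open>M'\<close> of the identity in each direction, and the factors
  \<open>54 * 2 ^ \<beta>' i\<close> multiply up.\<close>

lemma block_tensor_bound:
  fixes b :: "('d::finite \<Rightarrow> nat) \<Rightarrow> real"
  assumes "\<beta> \<le> \<beta>'" "\<beta>' \<in> multi_indices" "\<And>i. \<beta>' i \<le> K"
  shows "(\<Sum>\<alpha>\<in>block_indices \<beta>. (\<Sum>\<gamma>\<in>block_indices \<beta>'. b \<gamma> * (\<Prod>i\<in>UNIV. U (\<gamma> i) (\<alpha> i)))\<^sup>2)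
    \<le> 54 ^ CARD('d) * 2 ^ norm_one \<beta>' * (\<Sum>\<gamma>\<in>block_indices \<beta>'. (b \<gamma>)\<^sup>2)"
proof -
  define M' :: "'d \<Rightarrow> nat \<Rightarrow> nat \<Rightarrow> real" where "M' i m n = (if m = n then sqrt (54 * 2 ^ \<beta>' i) else 0)" for i m n
  have "(\<Sum>\<alpha>\<in>block_indices \<beta>. (\<Sum>\<gamma>\<in>block_indices \<beta>'. b \<gamma> * (\<Prod>i\<in>UNIV. U (\<gamma> i) (\<alpha> i)))\<^sup>2)
    \<le> (\<Sum>\<alpha>\<in>block_indices \<beta>'. (\<Sum>\<gamma>\<in>block_indices \<beta>'. b \<gamma> * (\<Prod>i\<in>UNIV. M' i (\<gamma> i) (\<alpha> i)))\<^sup>2)"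
    unfolding block_indices_PiE
  proof (rule tensor_sum_squares_le)
    fix i :: 'd and c :: "nat \<Rightarrow> real"
    have "(\<Sum>n\<in>level_indices (\<beta>' i). (\<Sum>m\<in>level_indices (\<beta>' i). c m * M' i m n)\<^sup>2)
      = (\<Sum>n\<in>level_indices (\<beta>' i). (c n * sqrt (54 * 2 ^ \<beta>' i))\<^sup>2)"
      by (intro sum.cong refl) (simp add: M'_def finite_level_indices if_distrib[of "(*) _"] cong: if_cong)
    also have "\<dots> = 54 * 2 ^ \<beta>' i * (\<Sum>n\<in>level_indices (\<beta>' i). (c n)\<^sup>2)"
      unfolding sum_distrib_left by (intro sum.cong refl) (simp add: power_mult_distrib)
    finally show "(\<Sum>n\<in>level_indices (\<beta> i). (\<Sum>m\<in>level_indices (\<beta>' i). c m * U m n)\<^sup>2)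
      \<le> (\<Sum>n\<in>level_indices (\<beta>' i). (\<Sum>m\<in>level_indices (\<beta>' i). c m * M' i m n)\<^sup>2)"
      using block_coefficients_bound[of "\<beta> i" "\<beta>' i" c] assms by (auto simp: le_fun_def multi_indices_def)
  qed simp
  also have "\<dots> = (\<Sum>\<alpha>\<in>block_indices \<beta>'. (b \<alpha> * (\<Prod>i\<in>UNIV. sqrt (54 * 2 ^ \<beta>' i)))\<^sup>2)"
  proof (intro sum.cong refl)
    fix \<alpha> :: "'d \<Rightarrow> nat" assume "\<alpha> \<in> block_indices \<beta>'"
    have "(\<Prod>i\<in>UNIV. M' i (\<gamma> i) (\<alpha> i)) = (if \<gamma> = \<alpha> then \<Prod>i\<in>UNIV. sqrt (54 * 2 ^ \<beta>' i) else 0)" for \<gamma>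
    proof (cases "\<gamma> = \<alpha>")
      case False
      then obtain i where "\<gamma> i \<noteq> \<alpha> i" by (metis ext)
      then have "M' i (\<gamma> i) (\<alpha> i) = 0" by (simp add: M'_def)
      then have "(\<Prod>i\<in>UNIV. M' i (\<gamma> i) (\<alpha> i)) = 0" by (intro prod_zero) auto
      then show ?thesis using False by (simp only: if_False)
    qed (simp add: M'_def)
    then have "(\<Sum>\<gamma>\<in>block_indices \<beta>'. b \<gamma> * (\<Prod>i\<in>UNIV. M' i (\<gamma> i) (\<alpha> i)))
      = (\<Sum>\<gamma>\<in>block_indices \<beta>'. if \<gamma> = \<alpha> then b \<alpha> * (\<Prod>i\<in>UNIV. sqrt (54 * 2 ^ \<beta>' i)) else 0)"
      by (intro sum.cong refl) simp
    then show "(\<Sum>\<gamma>\<in>block_indices \<beta>'. b \<gamma> * (\<Prod>i\<in>UNIV. M' i (\<gamma> i) (\<alpha> i)))\<^sup>2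
       = (b \<alpha> * (\<Prod>i\<in>UNIV. sqrt (54 * 2 ^ \<beta>' i)))\<^sup>2"
      using \<open>\<alpha> \<in> block_indices \<beta>'\<close> by (simp add: finite_block_indices)
  qed
  also have "\<dots> = 54 ^ CARD('d) * 2 ^ norm_one \<beta>' * (\<Sum>\<gamma>\<in>block_indices \<beta>'. (b \<gamma>)\<^sup>2)"
  proof -
    have "(\<Prod>i\<in>UNIV. sqrt (54 * 2 ^ \<beta>' i))\<^sup>2 = (54 ^ CARD('d) * 2 ^ norm_one \<beta>' :: real)"
      by (simp add: prod_power_distrib prod.distrib power_norm_one)
    then show ?thesis by (simp only: power_mult_distrib flip: sum_distrib_right) (simp only: mult_ac)
  qed
  finally show ?thesis .
qed

text \<open>The contribution of component \<open>\<beta>'\<close> costs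
  \<open>2 ^ norm_one \<beta>'\<close>, while the energy controls that component with weight
  \<open>4 ^ norm_max \<beta>'\<close>. The Cauchy-Schwarz weight \<open>w\<close> is the quotient,
  so division by it leaves exactly the controlled quantity. Components not above
  \<open>\<beta>\<close> drop out because \<open>U\<close> is triangular.\<close>

lemma coefficients_le_H10:
  fixes a :: "('d::finite \<Rightarrow> nat) \<Rightarrow> real" and \<Lambda> :: "('d \<Rightarrow> nat) set"
  assumes \<Lambda>: "finite \<Lambda>" "monotone_index_set \<Lambda>" "\<And>\<beta> i. \<beta> \<in> \<Lambda> \<Longrightarrow> \<beta> i \<le> K"
    and supp: "\<And>\<alpha>. \<alpha> \<in> coarse_indices K \<Longrightarrow> (\<lambda>i. lev (\<alpha> i)) \<notin> \<Lambda> \<Longrightarrow> a \<alpha> = 0"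
    and \<beta>: "\<beta> \<in> \<Lambda>"
  shows "(\<Sum>\<alpha>\<in>block_indices \<beta>. (a \<alpha>)\<^sup>2) \<le>
    (\<Sum>\<beta>'\<in>{\<beta>'\<in>\<Lambda>. \<beta> \<le> \<beta>'}. 2 ^ norm_one \<beta>' / 4 ^ norm_max \<beta>') * (2 * 54 ^ CARD('d)) *
    (H10_norm (\<lambda>x. \<Sum>\<alpha>\<in>coarse_indices K. a \<alpha> * tensor_faber_schauder \<alpha> x))\<^sup>2"
proof -
  let ?Q = "coarse_indices K :: ('d \<Rightarrow> nat) set"
  let ?H = "(H10_norm (\<lambda>x. \<Sum>\<alpha>\<in>?Q. a \<alpha> * tensor_faber_schauder \<alpha> x))\<^sup>2"
  define b where "b = orthonormal_coeff a"
  define \<Lambda>' where "\<Lambda>' = {\<beta>'\<in>\<Lambda>. \<beta> \<le> \<beta>'}"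
  define w :: "('d \<Rightarrow> nat) \<Rightarrow> real" where "w \<beta>' = 2 ^ norm_one \<beta>' / 4 ^ norm_max \<beta>'" for \<beta>'
  define B where "B \<beta>' = (\<Sum>\<gamma>\<in>block_indices \<beta>'. (b \<gamma>)\<^sup>2)" for \<beta>'
  define y where "y \<beta>' \<alpha> = (\<Sum>\<gamma>\<in>block_indices \<beta>'. b \<gamma> * (\<Prod>i\<in>UNIV. U (\<gamma> i) (\<alpha> i)))" for \<beta>' \<alpha>
  have b0: "b \<gamma> = 0" if "\<gamma> \<in> ?Q" "(\<lambda>i. lev (\<gamma> i)) \<notin> \<Lambda>" for \<gamma>
    unfolding b_def by (rule orthonormal_coeff_support[OF \<Lambda>(2) supp that])
  have w: "w \<beta>' > 0" for \<beta>' by (simp add: w_def)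
  have B: "B \<beta>' \<ge> 0" for \<beta>' by (simp add: B_def sum_nonneg)
  have multi: "\<beta>' \<in> multi_indices" if "\<beta>' \<in> \<Lambda>" for \<beta>' using \<Lambda>(2) that by (auto simp: monotone_index_set_def)
  have a_eq: "a \<alpha> = (\<Sum>\<beta>'\<in>\<Lambda>'. y \<beta>' \<alpha>)" if \<alpha>: "\<alpha> \<in> block_indices \<beta>" for \<alpha>
  proof -
    have "\<alpha> \<in> ?Q" using block_subset_coarse[of \<beta> K] \<Lambda>(3)[OF \<beta>] \<alpha> by blast
    then have "a \<alpha> = (\<Sum>\<gamma>\<in>?Q. b \<gamma> * (\<Prod>i\<in>UNIV. U (\<gamma> i) (\<alpha> i)))"
      unfolding b_def by (rule orthonormal_coeff_inverse)
    also have "\<dots> = (\<Sum>\<beta>'\<in>\<Lambda>. y \<beta>' \<alpha>)"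
      unfolding y_def by (rule sum_coarse_blocks) (use \<Lambda> b0 in auto)
    also have "\<dots> = (\<Sum>\<beta>'\<in>\<Lambda>'. y \<beta>' \<alpha>)"
    proof (rule sum.mono_neutral_right)
      show "\<forall>\<beta>'\<in>\<Lambda> - \<Lambda>'. y \<beta>' \<alpha> = 0"
      proof
        fix \<beta>' assume "\<beta>' \<in> \<Lambda> - \<Lambda>'"
        then have "\<not> \<beta> \<le> \<beta>'" by (simp add: \<Lambda>'_def)
        then obtain i where i: "\<beta>' i < \<beta> i" by (auto simp: le_fun_def not_le)
        show "y \<beta>' \<alpha> = 0"
          unfolding y_def
        proof (intro sum.neutral ballI)
          fix \<gamma> assume "\<gamma> \<in> block_indices \<beta>'"
          then have "U (\<gamma> i) (\<alpha> i) = 0"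
            using i block_indicesD(2)[OF \<alpha>, of i] block_indicesD(2)[of \<gamma> \<beta>' i] by (intro coarse_U_eq_0) auto
          then have "(\<Prod>i\<in>UNIV. U (\<gamma> i) (\<alpha> i)) = 0" by (intro prod_zero) auto
          then show "b \<gamma> * (\<Prod>i\<in>UNIV. U (\<gamma> i) (\<alpha> i)) = 0" by simp
        qed
      qed
    qed (use \<Lambda>(1) in \<open>auto simp: \<Lambda>'_def\<close>)
    finally show ?thesis .
  qed
  have "(\<Sum>\<alpha>\<in>block_indices \<beta>. (a \<alpha>)\<^sup>2) \<le> (\<Sum>\<alpha>\<in>block_indices \<beta>. (\<Sum>\<beta>'\<in>\<Lambda>'. w \<beta>') * (\<Sum>\<beta>'\<in>\<Lambda>'. (y \<beta>' \<alpha>)\<^sup>2 / w \<beta>'))"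
    using a_eq w by (intro sum_mono) (auto intro!: weighted_Cauchy_Schwarz_sum)
  also have "\<dots> = (\<Sum>\<beta>'\<in>\<Lambda>'. w \<beta>') * (\<Sum>\<beta>'\<in>\<Lambda>'. (\<Sum>\<alpha>\<in>block_indices \<beta>. (y \<beta>' \<alpha>)\<^sup>2) / w \<beta>')"
    unfolding sum_distrib_left[symmetric] sum_divide_distrib by (subst sum.swap) simp
  also have "\<dots> \<le> (\<Sum>\<beta>'\<in>\<Lambda>'. w \<beta>') * (\<Sum>\<beta>'\<in>\<Lambda>'. 54 ^ CARD('d) * (4 ^ norm_max \<beta>' * B \<beta>'))"
  proof (intro mult_left_mono sum_mono sum_nonneg)
    fix \<beta>' assume "\<beta>' \<in> \<Lambda>'"
    then have "(\<Sum>\<alpha>\<in>block_indices \<beta>. (y \<beta>' \<alpha>)\<^sup>2) \<le> 54 ^ CARD('d) * 2 ^ norm_one \<beta>' * B \<beta>'"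
      unfolding y_def B_def using \<Lambda>(3) multi by (intro block_tensor_bound) (auto simp: \<Lambda>'_def)
    then show "(\<Sum>\<alpha>\<in>block_indices \<beta>. (y \<beta>' \<alpha>)\<^sup>2) / w \<beta>' \<le> 54 ^ CARD('d) * (4 ^ norm_max \<beta>' * B \<beta>')"
      by (simp add: w_def field_simps)
  qed (use w in \<open>auto simp: less_imp_le\<close>)
  also have "\<dots> \<le> (\<Sum>\<beta>'\<in>\<Lambda>'. w \<beta>') * (54 ^ CARD('d) * (\<Sum>\<beta>'\<in>\<Lambda>. 4 ^ norm_max \<beta>' * B \<beta>'))"
    unfolding sum_distrib_left[symmetric]
    using w B \<Lambda>(1) by (intro mult_left_mono sum_mono2 sum_nonneg) (auto simp: \<Lambda>'_def less_imp_le)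
  also have "\<dots> \<le> (\<Sum>\<beta>'\<in>\<Lambda>'. w \<beta>') * (54 ^ CARD('d) * (2 * ?H))"
  proof (intro mult_left_mono sum_nonneg)
    have "(\<Sum>\<beta>'\<in>\<Lambda>. 4 ^ norm_max \<beta>' * B \<beta>') \<le> (\<Sum>\<beta>'\<in>\<Lambda>. \<Sum>\<gamma>\<in>block_indices \<beta>'. (\<Sum>j\<in>UNIV. 4 ^ lev (\<gamma> j)) * (b \<gamma>)\<^sup>2)"
      unfolding B_def sum_distrib_left
    proof (intro sum_mono mult_right_mono)
      fix \<beta>' \<gamma> assume "\<gamma> \<in> block_indices \<beta>'"
      from power_norm_max_le[of "\<lambda>i. lev (\<gamma> i)"] show "(4::real) ^ norm_max \<beta>' \<le> (\<Sum>j\<in>UNIV. 4 ^ lev (\<gamma> j))"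
        unfolding block_indices_lev[OF \<open>\<gamma> \<in> block_indices \<beta>'\<close>] .
    qed auto
    also have "\<dots> = (\<Sum>\<gamma>\<in>?Q. (\<Sum>j\<in>UNIV. 4 ^ lev (\<gamma> j)) * (b \<gamma>)\<^sup>2)"
      by (rule sum_coarse_blocks[symmetric]) (use \<Lambda> b0 in auto)
    also have "\<dots> \<le> 2 * ?H"
      unfolding b_def by (rule orthonormal_coeff_H10_bound)
    finally show "(\<Sum>\<beta>'\<in>\<Lambda>. 4 ^ norm_max \<beta>' * B \<beta>') \<le> 2 * ?H" .
  qed (use w in \<open>auto simp: less_imp_le\<close>)
  finally show ?thesis by (simp add: \<Lambda>'_def w_def mult_ac)
qed

end

section \<open>Geometric sums over multi-indices\<close>

lemma sum_powers_le: "(\<Sum>t\<in>{1..k}. 2 ^ t :: real) \<le> 2 * 2 ^ k"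
proof -
  have "(\<Sum>t\<in>{1..k}. 2 ^ t :: real) = 2 * 2 ^ k - 2" by (induction k) auto
  then show ?thesis by simp
qed

text \<open>Bounding \<open>4 ^ norm_max \<beta>\<close> by the sum of the
  \<open>4 ^ \<beta> j\<close> makes every summand a product over directions. Direction
  \<open>j\<close> then sums \<open>2 ^ t\<close> to at most \<open>2 * 2 ^ k\<close>, each other
  one sums \<open>1 / 2 ^ t\<close> to at most 1.\<close>

lemma sum_norm_max_weights_le:
  "(\<Sum>\<beta>\<in>PiE UNIV (\<lambda>_::'d::finite. {1..k}). 4 ^ norm_max \<beta> / 2 ^ norm_one \<beta> :: real) \<le> 2 * real CARD('d) * 2 ^ k"
proof -
  let ?P = "PiE UNIV (\<lambda>_::'d. {1..k})"
  have "(\<Sum>\<beta>\<in>?P. 4 ^ norm_max \<beta> / 2 ^ norm_one \<beta> :: real)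
    \<le> (\<Sum>\<beta>\<in>?P. \<Sum>j\<in>UNIV. \<Prod>i\<in>UNIV. if i = j then 2 ^ \<beta> i else 1 / 2 ^ \<beta> i)"
  proof (rule sum_mono)
    fix \<beta> :: "'d \<Rightarrow> nat"
    have "4 ^ norm_max \<beta> / 2 ^ norm_one \<beta> \<le> (\<Sum>j\<in>UNIV. 4 ^ \<beta> j) / (2 ^ norm_one \<beta> :: real)"
      by (intro divide_right_mono power_norm_max_le) simp
    also have "\<dots> = (\<Sum>j\<in>UNIV. 4 ^ \<beta> j / 2 ^ norm_one \<beta>)"
      by (rule sum_divide_distrib)
    also have "\<dots> = (\<Sum>j\<in>UNIV. \<Prod>i\<in>UNIV. if i = j then 2 ^ \<beta> i else 1 / 2 ^ \<beta> i)"
    proof (intro sum.cong refl)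
      fix j
      have "(\<Prod>i\<in>UNIV. if i = j then 2 ^ \<beta> i else 1 / 2 ^ \<beta> i :: real)
        = (\<Prod>i\<in>UNIV. (if i = j then 4 ^ \<beta> i else 1) / 2 ^ \<beta> i)"
      proof (intro prod.cong refl)
        fix i
        have "(4::real) ^ \<beta> i = 2 ^ \<beta> i * 2 ^ \<beta> i" by (simp flip: power_mult_distrib)
        then show "(if i = j then 2 ^ \<beta> i else 1 / 2 ^ \<beta> i :: real) = (if i = j then 4 ^ \<beta> i else 1) / 2 ^ \<beta> i"
          by (cases "i = j") simp_all
      qed
      also have "\<dots> = 4 ^ \<beta> j / 2 ^ norm_one \<beta>"
        by (simp add: prod_dividef power_norm_one)
      finally show "(4 ^ \<beta> j / 2 ^ norm_one \<beta> :: real) = (\<Prod>i\<in>UNIV. if i = j then 2 ^ \<beta> i else 1 / 2 ^ \<beta> i)" ..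
    qed
    finally show "4 ^ norm_max \<beta> / 2 ^ norm_one \<beta> \<le> (\<Sum>j\<in>UNIV. \<Prod>i\<in>UNIV. if i = j then 2 ^ \<beta> i else 1 / 2 ^ \<beta> i :: real)" .
  qed
  also have "\<dots> = (\<Sum>j\<in>UNIV. \<Sum>\<beta>\<in>?P. \<Prod>i\<in>UNIV. if i = j then 2 ^ \<beta> i else 1 / 2 ^ \<beta> i)"
    by (rule sum.swap)
  also have "\<dots> = (\<Sum>j\<in>(UNIV::'d set). \<Prod>i\<in>UNIV. \<Sum>t\<in>{1..k}. if i = j then 2 ^ t else 1 / 2 ^ t)"
    by (rule sum.cong[OF refl]) (subst prod_sum_PiE; simp)
  also have "\<dots> \<le> (\<Sum>j\<in>(UNIV::'d set). \<Prod>i\<in>UNIV. if i = j then 2 * 2 ^ k else 1)"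
  proof (intro sum_mono prod_mono conjI)
    fix i j :: 'd
    show "(\<Sum>t\<in>{1..k}. if i = j then 2 ^ t else 1 / 2 ^ t :: real) \<le> (if i = j then 2 * 2 ^ k else 1)"
      using sum_powers_le[of k] sum_inverse_powers_le[of 1 k] by (cases "i = j") simp_all
  qed (auto intro!: sum_nonneg)
  also have "\<dots> = 2 * real CARD('d) * 2 ^ k" by simp
  finally show ?thesis .
qed

lemma sum_below_le:
  fixes \<beta> :: "'d::finite \<Rightarrow> nat"
  shows "(\<Sum>\<beta>'\<in>{\<beta>'\<in>multi_indices. \<beta>' \<le> \<beta>}. 2 ^ norm_one \<beta>' :: real) \<le> 2 ^ CARD('d) * 2 ^ norm_one \<beta>"
    and "finite {\<beta>'\<in>multi_indices. \<beta>' \<le> \<beta>}"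
proof -
  have eq: "{\<beta>'\<in>multi_indices. \<beta>' \<le> \<beta>} = PiE UNIV (\<lambda>i. {1..\<beta> i})"
    by (auto simp: multi_indices_def PiE_UNIV_domain le_fun_def)
  show "finite {\<beta>'\<in>multi_indices. \<beta>' \<le> \<beta>}" unfolding eq by (intro finite_PiE) auto
  have "(\<Sum>\<beta>'\<in>{\<beta>'\<in>multi_indices. \<beta>' \<le> \<beta>}. 2 ^ norm_one \<beta>' :: real) = (\<Prod>i\<in>UNIV. \<Sum>t\<in>{1..\<beta> i}. 2 ^ t)"
    unfolding eq power_norm_one[symmetric] by (rule prod_sum_PiE[symmetric]) auto
  also have "\<dots> \<le> (\<Prod>i\<in>UNIV. 2 * 2 ^ \<beta> i)"
    by (intro prod_mono conjI sum_powers_le sum_nonneg) auto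
  also have "\<dots> = 2 ^ CARD('d) * 2 ^ norm_one \<beta>" by (simp add: prod.distrib power_norm_one)
  finally show "(\<Sum>\<beta>'\<in>{\<beta>'\<in>multi_indices. \<beta>' \<le> \<beta>}. 2 ^ norm_one \<beta>' :: real) \<le> 2 ^ CARD('d) * 2 ^ norm_one \<beta>" .
qed

lemma power_norm_diff:
  fixes \<beta> :: "'d::finite \<Rightarrow> nat"
  shows "real (2 ^ (norm_one \<beta> - norm_max \<beta>)) = 2 ^ norm_one \<beta> / 2 ^ norm_max \<beta>"
  by (simp only: of_nat_power of_nat_numeral) (simp add: power_diff norm_max_le_norm_one)

lemma norm_max_ge_1: "\<beta> \<in> multi_indices \<Longrightarrow> 1 \<le> norm_max \<beta>" for \<beta> :: "'d::finite \<Rightarrow> nat"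
  using norm_max_attained[of \<beta>] by (auto simp: multi_indices_def)

lemma norm_max_le_max_level: "finite \<Lambda> \<Longrightarrow> \<beta> \<in> \<Lambda> \<Longrightarrow> norm_max \<beta> \<le> max_level \<Lambda>"
  by (simp add: max_level_def)

lemma sum_UN_le:
  fixes f :: "'a \<Rightarrow> real"
  assumes "finite I" "\<And>i. i \<in> I \<Longrightarrow> finite (D i)" "\<And>x. 0 \<le> f x"
  shows "sum f (\<Union>i\<in>I. D i) \<le> (\<Sum>i\<in>I. sum f (D i))"
  using assms(1,2)
proof (induction I rule: finite_induct)
  case (insert i I)
  have "sum f (D i \<union> (\<Union>i\<in>I. D i)) \<le> sum f (D i) + sum f (\<Union>i\<in>I. D i)"
    using insert.prems insert.hyps assms(3) by (subst sum_Un) (auto intro: sum_nonneg)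
  also have "\<dots> \<le> sum f (D i) + (\<Sum>i\<in>I. sum f (D i))"
    using insert by simp
  finally show ?case using insert.hyps by simp
qed simp

text \<open>On level \<open>k\<close> the denominator is the constant \<open>2 ^ k\<close>, and
  every index lies below a maximal one, so each box below a maximal index gives a geometric sum.
  Such a box may contain indices of smaller maximum. This only enlarges the sum, since the
  denominator has been pulled out before.\<close>

lemma sum_le_n_tilde:
  fixes \<Lambda> :: "('d::finite \<Rightarrow> nat) set"
  assumes "finite \<Lambda>" "monotone_index_set \<Lambda>"
  shows "(\<Sum>\<beta>\<in>\<Lambda>. 2 ^ norm_one \<beta> / 2 ^ norm_max \<beta>) \<le> 2 ^ CARD('d) * real (n_tilde \<Lambda>)"
proof -
  have multi: "\<Lambda> \<subseteq> multi_indices" using assms(2) by (simp add: monotone_index_set_def)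
  have level: "(\<Sum>\<beta>\<in>level_set \<Lambda> k. 2 ^ norm_one \<beta> / 2 ^ norm_max \<beta>)
    \<le> (\<Sum>\<beta>\<in>maximal_level_set \<Lambda> k. 2 ^ CARD('d) * (2 ^ norm_one \<beta> / 2 ^ norm_max \<beta>) :: real)" for k
  proof -
    have fin: "finite (level_set \<Lambda> k)" "finite (maximal_level_set \<Lambda> k)"
      using assms(1) by (auto simp: level_set_def maximal_level_set_def)
    let ?D = "\<lambda>\<beta>. {\<beta>'\<in>multi_indices. \<beta>' \<le> \<beta>}"
    have cover: "level_set \<Lambda> k \<subseteq> (\<Union>\<beta>\<in>maximal_level_set \<Lambda> k. ?D \<beta>)"
    proof
      fix \<beta> assume \<beta>: "\<beta> \<in> level_set \<Lambda> k"
      obtain \<mu> where "\<mu> \<in> level_set \<Lambda> k" "\<beta> \<le> \<mu>" "\<forall>\<nu>\<in>level_set \<Lambda> k. \<mu> \<le> \<nu> \<longrightarrow> \<mu> = \<nu>"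
        using finite_has_maximal2[OF fin(1) \<beta>] by blast
      then show "\<beta> \<in> (\<Union>\<beta>\<in>maximal_level_set \<Lambda> k. ?D \<beta>)"
        using \<beta> multi by (auto simp: maximal_level_set_def level_set_def)
    qed
    have "(\<Sum>\<beta>\<in>level_set \<Lambda> k. 2 ^ norm_one \<beta> / 2 ^ norm_max \<beta>) = (\<Sum>\<beta>\<in>level_set \<Lambda> k. 2 ^ norm_one \<beta>) / (2 ^ k :: real)"
      unfolding sum_divide_distrib by (intro sum.cong refl) (simp add: level_set_def)
    also have "\<dots> \<le> (\<Sum>\<beta>\<in>(\<Union>\<beta>\<in>maximal_level_set \<Lambda> k. ?D \<beta>). 2 ^ norm_one \<beta>) / (2 ^ k :: real)"
      using fin(2) sum_below_le(2) by (intro divide_right_mono sum_mono2 cover) auto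
    also have "\<dots> \<le> (\<Sum>\<beta>\<in>maximal_level_set \<Lambda> k. \<Sum>\<beta>'\<in>?D \<beta>. 2 ^ norm_one \<beta>') / (2 ^ k :: real)"
      using fin(2) sum_below_le(2) by (intro divide_right_mono sum_UN_le) auto
    also have "\<dots> \<le> (\<Sum>\<beta>\<in>maximal_level_set \<Lambda> k. 2 ^ CARD('d) * 2 ^ norm_one \<beta>) / (2 ^ k :: real)"
      by (intro divide_right_mono sum_mono sum_below_le(1)) auto
    also have "\<dots> = (\<Sum>\<beta>\<in>maximal_level_set \<Lambda> k. 2 ^ CARD('d) * (2 ^ norm_one \<beta> / 2 ^ norm_max \<beta>))"
      unfolding sum_divide_distrib by (intro sum.cong refl) (simp add: maximal_level_set_def level_set_def)
    finally show ?thesis .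
  qed
  have "(\<Sum>\<beta>\<in>\<Lambda>. 2 ^ norm_one \<beta> / 2 ^ norm_max \<beta>) = (\<Sum>k\<in>{1..max_level \<Lambda>}. \<Sum>\<beta>\<in>level_set \<Lambda> k. 2 ^ norm_one \<beta> / (2 ^ norm_max \<beta> :: real))"
    unfolding level_set_def
  proof (rule sum.group[symmetric])
    show "norm_max ` \<Lambda> \<subseteq> {1..max_level \<Lambda>}"
    proof
      fix k assume "k \<in> norm_max ` \<Lambda>"
      then obtain \<beta> where "\<beta> \<in> \<Lambda>" "k = norm_max \<beta>" by blast
      then show "k \<in> {1..max_level \<Lambda>}"
        using norm_max_ge_1[of \<beta>] norm_max_le_max_level[OF assms(1), of \<beta>] multi by auto
    qed
  qed (use assms(1) in auto)
  also have "\<dots> \<le> (\<Sum>k\<in>{1..max_level \<Lambda>}. \<Sum>\<beta>\<in>maximal_level_set \<Lambda> k. 2 ^ CARD('d) * (2 ^ norm_one \<beta> / 2 ^ norm_max \<beta>))"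
    by (intro sum_mono level)
  also have "\<dots> = 2 ^ CARD('d) * real (n_tilde \<Lambda>)"
    unfolding n_tilde_def of_nat_sum power_norm_diff sum_distrib_left ..
  finally show ?thesis .
qed

text \<open>An index \<open>\<alpha>\<close> determines its block through its levels, so the
  coefficients of all blocks fit into one family, extended by 0.\<close>

lemma block_space_coefficients:
  assumes "\<And>\<beta>. \<beta> \<in> \<Lambda> \<Longrightarrow> s \<beta> \<in> block_space \<beta>"
  obtains a where "\<And>\<beta>. \<beta> \<in> \<Lambda> \<Longrightarrow> s \<beta> = (\<lambda>x. \<Sum>\<alpha>\<in>block_indices \<beta>. a \<alpha> * tensor_faber_schauder \<alpha> x)"
    and "\<And>\<alpha>. (\<lambda>i. lev (\<alpha> i)) \<notin> \<Lambda> \<Longrightarrow> a \<alpha> = 0"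
proof -
  have "\<exists>c. \<forall>\<beta>\<in>\<Lambda>. s \<beta> = (\<lambda>x. \<Sum>\<alpha>\<in>block_indices \<beta>. c \<beta> \<alpha> * tensor_faber_schauder \<alpha> x)"
    using assms unfolding block_space_def by (intro bchoice) blast
  then obtain c where c: "\<And>\<beta>. \<beta> \<in> \<Lambda> \<Longrightarrow> s \<beta> = (\<lambda>x. \<Sum>\<alpha>\<in>block_indices \<beta>. c \<beta> \<alpha> * tensor_faber_schauder \<alpha> x)"
    by blast
  define a where "a \<alpha> = (if (\<lambda>i. lev (\<alpha> i)) \<in> \<Lambda> then c (\<lambda>i. lev (\<alpha> i)) \<alpha> else 0)" for \<alpha>
  show ?thesis
  proof (rule that)
    fix \<beta> assume \<beta>: "\<beta> \<in> \<Lambda>"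
    have "a \<alpha> = c \<beta> \<alpha>" if "\<alpha> \<in> block_indices \<beta>" for \<alpha>
      using \<beta> unfolding a_def block_indices_lev[OF that] by simp
    then show "s \<beta> = (\<lambda>x. \<Sum>\<alpha>\<in>block_indices \<beta>. a \<alpha> * tensor_faber_schauder \<alpha> x)"
      unfolding c[OF \<beta>] by (intro ext sum.cong refl) simp
  next
    fix \<alpha> assume "(\<lambda>i. lev (\<alpha> i)) \<notin> \<Lambda>"
    then show "a \<alpha> = 0" unfolding a_def by (simp only: if_False)
  qed
qed

text \<open>With d = \<open>CARD('d)\<close>, the constant collects \<open>2 ^ d\<close> from the
  norm of a block, \<open>2 * 54 ^ d\<close> from the coefficient bound, \<open>2 * d\<close> from
  the sum over coarse indices and \<open>2 ^ d\<close> from the boxes below maximal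
  elements.\<close>

lemma stability_estimate:
  fixes \<Lambda> :: "('d::finite \<Rightarrow> nat) set"
  assumes fin: "finite \<Lambda>" and mono: "monotone_index_set \<Lambda>" and s: "\<And>\<beta>. \<beta> \<in> \<Lambda> \<Longrightarrow> s \<beta> \<in> block_space \<beta>"
  shows "(\<Sum>\<beta>\<in>\<Lambda>. 2 ^ (2 * norm_max \<beta>) * (L2_norm (s \<beta>))\<^sup>2)
    \<le> 4 * real CARD('d) * 216 ^ CARD('d) * real (n_tilde \<Lambda>) * (H10_norm (\<lambda>x. \<Sum>\<beta>\<in>\<Lambda>. s \<beta> x))\<^sup>2"
proof -
  define K where "K = max_level \<Lambda>"
  obtain T U where "faber_schauder_orthonormalisation K T U"
    using faber_schauder_orthonormalisation_exists by blast
  then interpret faber_schauder_orthonormalisation K T U .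
  obtain a where a: "\<And>\<beta>. \<beta> \<in> \<Lambda> \<Longrightarrow> s \<beta> = (\<lambda>x. \<Sum>\<alpha>\<in>block_indices \<beta>. a \<alpha> * tensor_faber_schauder \<alpha> x)"
    and a0: "\<And>\<alpha>. (\<lambda>i. lev (\<alpha> i)) \<notin> \<Lambda> \<Longrightarrow> a \<alpha> = 0"
    using block_space_coefficients[OF s] by blast
  have le_K: "\<beta> i \<le> K" if "\<beta> \<in> \<Lambda>" for \<beta> i
    unfolding K_def by (rule order_trans[OF le_norm_max norm_max_le_max_level[OF fin that]])
  define H where "H = (H10_norm (\<lambda>x. \<Sum>\<beta>\<in>\<Lambda>. s \<beta> x))\<^sup>2"
  have "(\<Sum>\<beta>\<in>\<Lambda>. s \<beta> x) = (\<Sum>\<alpha>\<in>coarse_indices K. a \<alpha> * tensor_faber_schauder \<alpha> x)" for x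
  proof -
    have "(\<Sum>\<beta>\<in>\<Lambda>. s \<beta> x) = (\<Sum>\<beta>\<in>\<Lambda>. \<Sum>\<alpha>\<in>block_indices \<beta>. a \<alpha> * tensor_faber_schauder \<alpha> x)"
      by (intro sum.cong refl) (simp only: a)
    also have "\<dots> = (\<Sum>\<alpha>\<in>coarse_indices K. a \<alpha> * tensor_faber_schauder \<alpha> x)"
      by (rule sum_coarse_blocks[symmetric, OF fin]) (use le_K a0 in auto)
    finally show ?thesis .
  qed
  then have H: "H = (H10_norm (\<lambda>x. \<Sum>\<alpha>\<in>coarse_indices K. a \<alpha> * tensor_faber_schauder \<alpha> x))\<^sup>2"
    by (simp only: H_def)
  define X where "X \<beta> = (\<Sum>\<beta>'\<in>{\<beta>'\<in>\<Lambda>. \<beta> \<le> \<beta>'}. 2 ^ norm_one \<beta>' / 4 ^ norm_max \<beta>' :: real)" for \<beta> :: "'d \<Rightarrow> nat"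
  define v where "v \<beta> = (4 ^ norm_max \<beta> / 2 ^ norm_one \<beta> :: real)" for \<beta> :: "'d \<Rightarrow> nat"
  have v0: "v \<beta> \<ge> 0" for \<beta> by (simp add: v_def)
  define C where "C = (2 ^ CARD('d) * (2 * 54 ^ CARD('d)) :: real)"
  have "(\<Sum>\<beta>\<in>\<Lambda>. 2 ^ (2 * norm_max \<beta>) * (L2_norm (s \<beta>))\<^sup>2) \<le> (\<Sum>\<beta>\<in>\<Lambda>. C * H * (v \<beta> * X \<beta>))"
  proof (rule sum_mono)
    fix \<beta> assume \<beta>: "\<beta> \<in> \<Lambda>"
    have "2 ^ (2 * norm_max \<beta>) * (L2_norm (s \<beta>))\<^sup>2
      \<le> 4 ^ norm_max \<beta> * (2 ^ CARD('d) / 2 ^ norm_one \<beta> * (\<Sum>\<alpha>\<in>block_indices \<beta>. (a \<alpha>)\<^sup>2))"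
      unfolding a[OF \<beta>] power_mult by (intro mult_mono L2_norm_block_le) auto
    also have "\<dots> = v \<beta> * 2 ^ CARD('d) * (\<Sum>\<alpha>\<in>block_indices \<beta>. (a \<alpha>)\<^sup>2)"
      by (simp add: v_def)
    also have "\<dots> \<le> v \<beta> * 2 ^ CARD('d) * (X \<beta> * (2 * 54 ^ CARD('d)) * H)"
      unfolding H X_def using v0 a0 le_K by (intro mult_left_mono coefficients_le_H10[OF fin mono _ _ \<beta>]) auto
    finally show "2 ^ (2 * norm_max \<beta>) * (L2_norm (s \<beta>))\<^sup>2 \<le> C * H * (v \<beta> * X \<beta>)"
      by (simp add: C_def mult_ac)
  qed
  also have "\<dots> = C * H * (\<Sum>\<beta>\<in>\<Lambda>. v \<beta> * X \<beta>)"
    by (rule sum_distrib_left[symmetric])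
  also have "\<dots> \<le> C * H * (2 * real CARD('d) * (2 ^ CARD('d) * real (n_tilde \<Lambda>)))"
  proof (rule mult_left_mono)
    \<comment> \<open>After exchanging the sums the inner one runs over
      \<open>\<beta> \<le> \<beta>'\<close> and is of order \<open>2 ^ norm_max \<beta>'\<close>.
      This reduces the denominator \<open>4 ^ norm_max \<beta>'\<close> to the
      \<open>2 ^ norm_max \<beta>'\<close> of \<open>n_tilde\<close>.\<close>
    have "(\<Sum>\<beta>\<in>\<Lambda>. v \<beta> * X \<beta>) = (\<Sum>\<beta>\<in>\<Lambda>. \<Sum>\<beta>'\<in>\<Lambda>. if \<beta> \<le> \<beta>' then v \<beta> * (2 ^ norm_one \<beta>' / 4 ^ norm_max \<beta>') else 0)"
      unfolding X_def sum.inter_filter[OF fin] sum_distrib_left by (intro sum.cong refl) simp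
    also have "\<dots> = (\<Sum>\<beta>'\<in>\<Lambda>. \<Sum>\<beta>\<in>\<Lambda>. if \<beta> \<le> \<beta>' then v \<beta> * (2 ^ norm_one \<beta>' / 4 ^ norm_max \<beta>') else 0)"
      by (rule sum.swap)
    also have "\<dots> = (\<Sum>\<beta>'\<in>\<Lambda>. (\<Sum>\<beta>\<in>{\<beta>\<in>\<Lambda>. \<beta> \<le> \<beta>'}. v \<beta>) * (2 ^ norm_one \<beta>' / 4 ^ norm_max \<beta>'))"
      unfolding sum.inter_filter[OF fin, symmetric] sum_distrib_right ..
    also have "\<dots> \<le> (\<Sum>\<beta>'\<in>\<Lambda>. (2 * real CARD('d) * 2 ^ norm_max \<beta>') * (2 ^ norm_one \<beta>' / 4 ^ norm_max \<beta>'))"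
    proof (intro sum_mono mult_right_mono)
      fix \<beta>' assume "\<beta>' \<in> \<Lambda>"
      let ?P = "PiE UNIV (\<lambda>_::'d. {1..norm_max \<beta>'})"
      have "{\<beta>\<in>\<Lambda>. \<beta> \<le> \<beta>'} \<subseteq> ?P"
      proof
        fix \<beta> assume "\<beta> \<in> {\<beta>\<in>\<Lambda>. \<beta> \<le> \<beta>'}"
        then have "1 \<le> \<beta> i" "\<beta> i \<le> norm_max \<beta>'" for i
          using mono le_norm_max[of \<beta>' i]
          by (auto simp: monotone_index_set_def multi_indices_def le_fun_def intro: order_trans)
        then show "\<beta> \<in> ?P" by (simp add: PiE_UNIV_domain)
      qed
      then have "(\<Sum>\<beta>\<in>{\<beta>\<in>\<Lambda>. \<beta> \<le> \<beta>'}. v \<beta>) \<le> (\<Sum>\<beta>\<in>?P. v \<beta>)"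
        using v0 by (intro sum_mono2 finite_PiE) auto
      also have "\<dots> \<le> 2 * real CARD('d) * 2 ^ norm_max \<beta>'"
        unfolding v_def by (rule sum_norm_max_weights_le)
      finally show "(\<Sum>\<beta>\<in>{\<beta>\<in>\<Lambda>. \<beta> \<le> \<beta>'}. v \<beta>) \<le> 2 * real CARD('d) * 2 ^ norm_max \<beta>'" .
    qed auto
    also have "\<dots> = 2 * real CARD('d) * (\<Sum>\<beta>'\<in>\<Lambda>. 2 ^ norm_one \<beta>' / 2 ^ norm_max \<beta>')"
      unfolding sum_distrib_left
    proof (intro sum.cong refl)
      fix \<beta>' :: "'d \<Rightarrow> nat"
      have "(4::real) ^ norm_max \<beta>' = 2 ^ norm_max \<beta>' * 2 ^ norm_max \<beta>'" by (simp flip: power_mult_distrib)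
      then show "(2 * real CARD('d) * 2 ^ norm_max \<beta>') * (2 ^ norm_one \<beta>' / 4 ^ norm_max \<beta>')
        = 2 * real CARD('d) * (2 ^ norm_one \<beta>' / (2 ^ norm_max \<beta>' :: real))" by simp
    qed
    also have "\<dots> \<le> 2 * real CARD('d) * (2 ^ CARD('d) * real (n_tilde \<Lambda>))"
      by (intro mult_left_mono sum_le_n_tilde fin mono) auto
    finally show "(\<Sum>\<beta>\<in>\<Lambda>. v \<beta> * X \<beta>) \<le> 2 * real CARD('d) * (2 ^ CARD('d) * real (n_tilde \<Lambda>))" .
    show "0 \<le> C * H" by (simp add: C_def H_def)
  qed
  also have "\<dots> = 4 * real CARD('d) * 216 ^ CARD('d) * real (n_tilde \<Lambda>) * H"
  proof -
    have "(216::real) ^ CARD('d) = 2 ^ CARD('d) * 54 ^ CARD('d) * 2 ^ CARD('d)" by (simp flip: power_mult_distrib)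
    then show ?thesis by (simp add: C_def mult_ac)
  qed
  finally show ?thesis by (simp only: H_def)
qed

section \<open>The lower estimate\<close>

text \<open>
  The Faber-Schauder coefficients of the nodal hat function at \<open>1/2\<close>; they do not depend on its level.
  The indices \<open>3 * 2 ^ (l - 2) - 1\<close> and \<open>3 * 2 ^ (l - 2)\<close> are those of the two functions of level \<open>l\<close>
  adjacent to \<open>1/2\<close>.
\<close>

definition nodal_coeff :: "nat \<Rightarrow> real" where
  "nodal_coeff m = (if m = 1 then 1 else
     if m = 3 * 2 ^ (lev m - 2) \<or> m + 1 = 3 * 2 ^ (lev m - 2) then - 1 / 2 else 0)"

lemma lev_eqI: "2 ^ k \<le> m \<Longrightarrow> m < 2 ^ Suc k \<Longrightarrow> lev m = Suc k"
  using floorlog_leI[of m 2 "Suc k"] floorlog_ge_SucI[of 2 k m] by simp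

lemma nodal_index_bounds:
  "(2::nat) ^ Suc k \<le> 3 * 2 ^ k" "3 * (2::nat) ^ k < 2 ^ Suc (Suc k)"
  "(2::nat) ^ Suc k \<le> 3 * 2 ^ k - 1" "3 * (2::nat) ^ k - 1 < 2 ^ Suc (Suc k)"
  using one_le_power[of "2::nat" k] unfolding power_Suc by linarith+

text \<open>Every level from 2 on carries exactly two nonzero nodal coefficients, so refining by one
  level adds two terms.\<close>

lemma sum_nodal_level:
  fixes f :: "nat \<Rightarrow> real"
  assumes "\<And>m. nodal_coeff m = 0 \<Longrightarrow> f m = 0"
  shows "(\<Sum>m\<in>{1..<2 ^ Suc (Suc k)}. f m) = (\<Sum>m\<in>{1..<2 ^ Suc k}. f m) + (f (3 * 2 ^ k) + f (3 * 2 ^ k - 1))"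
proof -
  have split: "{1..<2 ^ Suc (Suc k)} = {1..<2 ^ Suc k} \<union> {2 ^ Suc k..<2 ^ Suc (Suc k) :: nat}"
    using ivl_disj_un_two(3)[of 1 "2 ^ Suc k" "2 ^ Suc (Suc k) :: nat"] by simp
  have "(\<Sum>m\<in>{1..<2 ^ Suc (Suc k)}. f m) = (\<Sum>m\<in>{1..<2 ^ Suc k}. f m) + (\<Sum>m\<in>{2 ^ Suc k..<2 ^ Suc (Suc k)}. f m)"
    unfolding split by (rule sum.union_disjoint) auto
  also have "(\<Sum>m\<in>{2 ^ Suc k..<2 ^ Suc (Suc k)}. f m) = (\<Sum>m\<in>{3 * 2 ^ k, 3 * 2 ^ k - 1}. f m)"
  proof (rule sum.mono_neutral_right)
    have "(1::nat) \<le> 2 ^ k" by simp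
    show "{3 * 2 ^ k, 3 * 2 ^ k - 1} \<subseteq> {2 ^ Suc k..<2 ^ Suc (Suc k) :: nat}"
      using nodal_index_bounds[of k] by (simp only: insert_subset atLeastLessThan_iff empty_subsetI simp_thms)
    show "\<forall>m\<in>{2 ^ Suc k..<2 ^ Suc (Suc k)} - {3 * 2 ^ k, 3 * 2 ^ k - 1}. f m = 0"
    proof
      fix m :: nat assume m: "m \<in> {2 ^ Suc k..<2 ^ Suc (Suc k)} - {3 * 2 ^ k, 3 * 2 ^ k - 1}"
      then have "lev m = Suc (Suc k)" by (intro lev_eqI) auto
      moreover have "m \<noteq> 1" using m \<open>1 \<le> 2 ^ k\<close> by auto
      ultimately have "nodal_coeff m = 0" using m by (auto simp: nodal_coeff_def)
      then show "f m = 0" by (rule assms)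
    qed
  qed auto
  also have "\<dots> = f (3 * 2 ^ k) + f (3 * 2 ^ k - 1)"
  proof -
    have "(3 * 2 ^ k :: nat) \<noteq> 3 * 2 ^ k - 1" using one_le_power[of "2::nat" k] by linarith
    then show ?thesis by simp
  qed
  finally show ?thesis .
qed

lemma lev_nodal: "lev (3 * 2 ^ k) = Suc (Suc k)" "lev (3 * 2 ^ k - 1) = Suc (Suc k)"
  by (rule lev_eqI[OF nodal_index_bounds(1,2)], rule lev_eqI[OF nodal_index_bounds(3,4)])

lemma nodal_coeff_values:
  "nodal_coeff 1 = 1" "nodal_coeff (3 * 2 ^ k) = - 1 / 2" "nodal_coeff (3 * 2 ^ k - 1) = - 1 / 2"
proof -
  have "3 * 2 ^ k \<noteq> (1::nat)" "3 * 2 ^ k - 1 \<noteq> (1::nat)" "3 * 2 ^ k - 1 + 1 = (3 * 2 ^ k :: nat)"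
    using one_le_power[of "2::nat" k] by linarith+
  moreover have "Suc (Suc k) - 2 = k" by simp
  ultimately show "nodal_coeff 1 = 1" "nodal_coeff (3 * 2 ^ k) = - 1 / 2" "nodal_coeff (3 * 2 ^ k - 1) = - 1 / 2"
    by (simp_all only: nodal_coeff_def lev_nodal if_False if_True simp_thms)
qed

lemma hat_refinement: "hat s = hat (2 * s) + hat (2 * s - 1) / 2 + hat (2 * s + 1) / 2"
  by (auto simp: hat_def max_def abs_if)

text \<open>The right side is the nodal hat at 1/2 of mesh width \<open>1 / 2 ^ Suc k\<close>. By
  the two-scale relation \<open>hat_refinement\<close> the next finer nodal hat arises on
  subtracting half of each of its two neighbours, which are Faber-Schauder functions of the new
  level. Earlier coefficients never change.\<close>

lemma nodal_expansion:
  "(\<Sum>m\<in>{1..<2 ^ Suc k}. nodal_coeff m * faber_schauder m t) = hat (2 ^ Suc k * t - 2 ^ k)"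
proof (induction k)
  case 0
  have "lev 1 = 1" using lev_eqI[of 0 1] by simp
  then have "faber_schauder 1 t = hat (2 * t - 1)" by (simp only: fs_eq_hat node_def) simp
  moreover have "{1..<2 ^ Suc 0} = {1::nat}" by auto
  ultimately show ?case by (simp add: nodal_coeff_def)
next
  case (Suc k)
  define s where "s = 2 ^ Suc k * t - 2 ^ k"
  have p: "(2::real) ^ Suc (Suc k) * t - 2 ^ Suc k = 2 * s" by (simp add: s_def algebra_simps)
  have "(1::nat) \<le> 2 ^ k" by simp
  then have nodes: "real (node (3 * 2 ^ k)) = 2 ^ Suc k + 1" "real (node (3 * 2 ^ k - 1)) = 2 ^ Suc k - 1"
    by (simp_all only: node_def lev_nodal) (simp_all add: of_nat_diff)
  have fs: "faber_schauder (3 * 2 ^ k) t = hat (2 * s - 1)" "faber_schauder (3 * 2 ^ k - 1) t = hat (2 * s + 1)"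
    by (simp_all only: fs_eq_hat lev_nodal nodes p[symmetric]) (simp_all add: algebra_simps)
  have "(\<Sum>m\<in>{1..<2 ^ Suc (Suc k)}. nodal_coeff m * faber_schauder m t)
    = hat s - hat (2 * s - 1) / 2 - hat (2 * s + 1) / 2"
    by (subst sum_nodal_level) (simp_all only: Suc.IH nodal_coeff_values fs mult_zero_left, simp add: s_def)
  also have "\<dots> = hat (2 * s)" using hat_refinement[of s] by simp
  finally show ?case unfolding p .
qed

lemma nodal_mass_le:
  assumes "1 \<le> k"
  shows "(\<Sum>m\<in>{1..<2^k}. \<Sum>n\<in>{1..<2^k}. nodal_coeff m * nodal_coeff n * mass m n) \<le> 2 / 2 ^ k"
proof -
  obtain k' where k: "k = Suc k'" using assms by (cases k) auto
  show ?thesis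
    unfolding k mass_form[OF finite_atLeastLessThan] nodal_expansion power2_eq_square
    by (rule hat_square_integral_le)
qed

lemma nodal_stiffness_eq:
  assumes "1 \<le> k"
  shows "(\<Sum>m\<in>{1..<2^k}. \<Sum>n\<in>{1..<2^k}. nodal_coeff m * nodal_coeff n *
    (LINT t:{0..1}|lborel. fs_deriv m t * fs_deriv n t)) = 2 * 2 ^ k"
proof -
  obtain k' where k: "k = Suc k'" using assms by (cases k) auto
  let ?R = "{1..<2^k} :: nat set"
  have "(\<Sum>m\<in>?R. \<Sum>n\<in>?R. nodal_coeff m * nodal_coeff n * (LINT t:{0..1}|lborel. fs_deriv m t * fs_deriv n t))
    = (\<Sum>m\<in>?R. \<Sum>n\<in>?R. if n = m then (nodal_coeff m)\<^sup>2 * (2 * 2 ^ lev m) else 0)"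
    by (intro sum.cong refl) (simp add: stiffness power2_eq_square)
  also have "\<dots> = (\<Sum>m\<in>?R. (nodal_coeff m)\<^sup>2 * (2 * 2 ^ lev m))"
    by (intro sum.cong refl) (simp only: sum.delta finite_atLeastLessThan if_True)
  also have "\<dots> = 2 * 2 ^ k"
    unfolding k
  proof (induction k')
    case 0
    have "lev 1 = 1" using lev_eqI[of 0 1] by simp
    moreover have "{1..<2 ^ Suc 0} = {1::nat}" by auto
    ultimately show ?case by (simp add: nodal_coeff_def)
  next
    case (Suc k)
    then show ?case
      by (subst sum_nodal_level) (simp_all only: Suc.IH nodal_coeff_values lev_nodal, simp_all add: power2_eq_square)
  qed
  finally show ?thesis .
qed

text \<open>For the product of nodal hats the energy is at most of order
  \<open>4 ^ norm_max \<beta> / 2 ^ norm_one \<beta>\<close>, since each factor has mass of order at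
  most \<open>1 / 2 ^ \<beta> i\<close>. The block \<open>\<mu>\<close>, fine in one maximal
  direction only, already has weighted norm of order at least
  \<open>4 ^ norm_max \<beta> / 2 ^ norm_max \<beta>\<close>. The quotient bounds
  \<open>c\<close>.\<close>

lemma stable_with_upper_bound:
  fixes \<Lambda> :: "('d::finite \<Rightarrow> nat) set"
  assumes fin: "finite \<Lambda>" and mono: "monotone_index_set \<Lambda>" and \<beta>: "\<beta> \<in> \<Lambda>" and stable: "stable_with \<Lambda> c"
  shows "c * (2 ^ norm_one \<beta> / 2 ^ norm_max \<beta>) \<le> 4 * real CARD('d) * 216 ^ CARD('d)"
proof (cases "c \<le> 0")
  case True
  then have "c * (2 ^ norm_one \<beta> / 2 ^ norm_max \<beta>) \<le> 0" by (intro mult_nonpos_nonneg) auto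
  also have "0 \<le> (4 * real CARD('d) * 216 ^ CARD('d) :: real)" by simp
  finally show ?thesis .
next
  case False
  define K where "K = max_level \<Lambda>"
  have le_K: "\<beta>' i \<le> K" if "\<beta>' \<in> \<Lambda>" for \<beta>' i
    unfolding K_def by (rule order_trans[OF le_norm_max norm_max_le_max_level[OF fin that]])
  have \<beta>1: "1 \<le> \<beta> i" for i using mono \<beta> by (auto simp: monotone_index_set_def multi_indices_def)
  define A where "A = PiE (UNIV::'d set) (\<lambda>i. {1..<2 ^ \<beta> i :: nat})"
  have A_iff: "\<alpha> \<in> A \<longleftrightarrow> \<alpha> \<in> coarse_indices K \<and> (\<lambda>i. lev (\<alpha> i)) \<le> \<beta>" for \<alpha>
  proof -
    have "1 \<le> m \<and> m < 2 ^ k \<longleftrightarrow> 1 \<le> m \<and> lev m \<le> k" for m k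
      using floorlog_leI[of m 2 k] floorlog_leD[of 2 m k] by auto
    then have "\<alpha> \<in> A \<longleftrightarrow> (\<forall>i. 1 \<le> \<alpha> i \<and> lev (\<alpha> i) \<le> \<beta> i)"
      unfolding A_def by (simp only: PiE_UNIV_domain Pi_iff atLeastLessThan_iff) auto
    then show ?thesis
      unfolding coarse_indices_iff le_fun_def using le_K[OF \<beta>] order_trans by blast
  qed
  define a where "a \<alpha> = (\<Prod>i\<in>UNIV. nodal_coeff (\<alpha> i))" for \<alpha> :: "'d \<Rightarrow> nat"
  \<comment> \<open>The nodal coefficients do not know the level of the hat; \<open>\<beta>\<close>
    enters only through this truncation.\<close>
  define a' where "a' \<alpha> = (if (\<lambda>i. lev (\<alpha> i)) \<le> \<beta> then a \<alpha> else 0)" for \<alpha>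
  define s where "s \<beta>' = (\<lambda>x. \<Sum>\<alpha>\<in>block_indices \<beta>'. a' \<alpha> * tensor_faber_schauder \<alpha> x)" for \<beta>'
  define P :: real where "P = 2 ^ CARD('d) * (real CARD('d) * 4 ^ norm_max \<beta>) / 2 ^ norm_one \<beta>"
  have u: "(\<Sum>\<beta>'\<in>\<Lambda>. s \<beta>' x) = (\<Sum>\<alpha>\<in>A. a \<alpha> * tensor_faber_schauder \<alpha> x)" for x
  proof -
    have "(\<Sum>\<beta>'\<in>\<Lambda>. s \<beta>' x) = (\<Sum>\<alpha>\<in>coarse_indices K. a' \<alpha> * tensor_faber_schauder \<alpha> x)"
      unfolding s_def
    proof (rule sum_coarse_blocks[symmetric])
      fix \<alpha> :: "'d \<Rightarrow> nat" assume \<alpha>: "\<alpha> \<in> coarse_indices K" "(\<lambda>i. lev (\<alpha> i)) \<notin> \<Lambda>"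
      have "(\<lambda>i. lev (\<alpha> i)) \<in> multi_indices"
        using \<alpha>(1) lev_bounds(1) unfolding multi_indices_def coarse_indices_iff by blast
      then have "\<not> (\<lambda>i. lev (\<alpha> i)) \<le> \<beta>"
        using mono \<beta> \<alpha>(2) unfolding monotone_index_set_def by blast
      then show "a' \<alpha> * tensor_faber_schauder \<alpha> x = 0" unfolding a'_def by simp
    qed (use fin le_K in auto)
    also have "\<dots> = (\<Sum>\<alpha>\<in>A. a' \<alpha> * tensor_faber_schauder \<alpha> x)"
    proof (rule sum.mono_neutral_right[OF finite_coarse_indices])
      show "A \<subseteq> coarse_indices K" using A_iff by blast
      show "\<forall>\<alpha>\<in>coarse_indices K - A. a' \<alpha> * tensor_faber_schauder \<alpha> x = 0"
        using A_iff unfolding a'_def by auto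
    qed
    also have "\<dots> = (\<Sum>\<alpha>\<in>A. a \<alpha> * tensor_faber_schauder \<alpha> x)"
      using A_iff by (intro sum.cong refl) (simp add: a'_def)
    finally show ?thesis .
  qed
  have H: "(H10_norm (\<lambda>x. \<Sum>\<beta>'\<in>\<Lambda>. s \<beta>' x))\<^sup>2 \<le> P"
  proof -
    define F where "F j i m n = (if i = j then (LINT t:{0..1}|lborel. fs_deriv m t * fs_deriv n t) else mass m n)"
      for i j :: 'd and m n
    \<comment> \<open>Since the coefficients are products and the index set is a box, the quadratic
      form splits into one-dimensional forms.\<close>
    have prod_form: "(\<Sum>\<alpha>\<in>A. \<Sum>\<alpha>'\<in>A. a \<alpha> * a \<alpha>' * (\<Prod>i\<in>UNIV. F j i (\<alpha> i) (\<alpha>' i)))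
      = (\<Prod>i\<in>UNIV. \<Sum>m\<in>{1..<2 ^ \<beta> i}. \<Sum>n\<in>{1..<2 ^ \<beta> i}. nodal_coeff m * nodal_coeff n * F j i m n)" for j
    proof -
      have "(\<Prod>i\<in>UNIV. \<Sum>m\<in>{1..<2 ^ \<beta> i}. \<Sum>n\<in>{1..<2 ^ \<beta> i}. nodal_coeff m * nodal_coeff n * F j i m n)
        = (\<Sum>\<alpha>\<in>A. \<Prod>i\<in>UNIV. \<Sum>n\<in>{1..<2 ^ \<beta> i}. nodal_coeff (\<alpha> i) * nodal_coeff n * F j i (\<alpha> i) n)"
        unfolding A_def by (rule prod_sum_PiE) auto
      also have "\<dots> = (\<Sum>\<alpha>\<in>A. \<Sum>\<alpha>'\<in>A. \<Prod>i\<in>UNIV. nodal_coeff (\<alpha> i) * nodal_coeff (\<alpha>' i) * F j i (\<alpha> i) (\<alpha>' i))"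
        unfolding A_def by (rule sum.cong[OF refl], rule prod_sum_PiE) auto
      finally show ?thesis by (simp add: a_def prod.distrib)
    qed
    have factor: "(\<Sum>m\<in>{1..<2 ^ \<beta> i}. \<Sum>n\<in>{1..<2 ^ \<beta> i}. nodal_coeff m * nodal_coeff n * F j i m n) \<le> (if i = j then 4 ^ \<beta> i else 1) * 2 / 2 ^ \<beta> i"
      and factor0: "0 \<le> (\<Sum>m\<in>{1..<2 ^ \<beta> i}. \<Sum>n\<in>{1..<2 ^ \<beta> i}. nodal_coeff m * nodal_coeff n * F j i m n)" for i j
    proof -
      have "(4::real) ^ \<beta> i = 2 ^ \<beta> i * 2 ^ \<beta> i" by (simp flip: power_mult_distrib)
      then show "(\<Sum>m\<in>{1..<2 ^ \<beta> i}. \<Sum>n\<in>{1..<2 ^ \<beta> i}. nodal_coeff m * nodal_coeff n * F j i m n) \<le> (if i = j then 4 ^ \<beta> i else 1) * 2 / 2 ^ \<beta> i"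
        using nodal_mass_le[OF \<beta>1[of i]] nodal_stiffness_eq[OF \<beta>1[of i]]
        by (cases "i = j") (simp_all only: F_def if_True if_False simp_thms, simp_all)
      show "0 \<le> (\<Sum>m\<in>{1..<2 ^ \<beta> i}. \<Sum>n\<in>{1..<2 ^ \<beta> i}. nodal_coeff m * nodal_coeff n * F j i m n)"
      proof (cases "i = j")
        case True
        then show ?thesis using nodal_stiffness_eq[OF \<beta>1[of i]] by (simp only: F_def if_True simp_thms) simp
      next
        case False
        then show ?thesis
          by (simp only: F_def if_False mass_form[OF finite_atLeastLessThan])
            (auto intro!: Henstock_Kurzweil_Integration.integral_nonneg integrable_continuous_real continuous_intros)
      qed
    qed
    have "(H10_norm (\<lambda>x. \<Sum>\<beta>'\<in>\<Lambda>. s \<beta>' x))\<^sup>2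
      = (\<Sum>j\<in>UNIV. \<Prod>i\<in>UNIV. \<Sum>m\<in>{1..<2 ^ \<beta> i}. \<Sum>n\<in>{1..<2 ^ \<beta> i}. nodal_coeff m * nodal_coeff n * F j i m n)"
      unfolding u H10_norm_square prod_form[symmetric] unfolding F_def ..
    also have "\<dots> \<le> (\<Sum>j\<in>UNIV. \<Prod>i\<in>UNIV. (if i = j then 4 ^ \<beta> i else 1) * 2 / 2 ^ \<beta> i)"
      by (intro sum_mono prod_mono conjI factor factor0)
    also have "\<dots> = (\<Sum>j\<in>UNIV. 4 ^ \<beta> j * (2 ^ CARD('d) / 2 ^ norm_one \<beta>))"
      by (simp add: prod_dividef prod.distrib power_norm_one)
    also have "\<dots> \<le> (\<Sum>j\<in>(UNIV::'d set). 4 ^ norm_max \<beta> * (2 ^ CARD('d) / 2 ^ norm_one \<beta>))"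
      using le_norm_max[of \<beta>] by (intro sum_mono mult_right_mono power_increasing) auto
    also have "\<dots> = P" by (simp add: P_def)
    finally show ?thesis .
  qed
  obtain j where j: "norm_max \<beta> = \<beta> j" using norm_max_attained by blast
  define \<mu> where "\<mu> i = (if i = j then \<beta> j else 1)" for i
  \<comment> \<open>An index of level \<open>\<beta> j\<close> with nodal coefficient 1 or -1/2; the
    general formula starts at level 2.\<close>
  define m where "m = (if \<beta> j = 1 then 1 else 3 * 2 ^ (\<beta> j - 2) :: nat)"
  have m: "1 \<le> m" "lev m = \<beta> j" "(1/2)\<^sup>2 \<le> (nodal_coeff m)\<^sup>2"
  proof -
    have "1 \<le> m \<and> lev m = \<beta> j \<and> (1/2)\<^sup>2 \<le> (nodal_coeff m)\<^sup>2"
    proof (cases "\<beta> j = 1")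
      case True
      have "lev 1 = 1" using lev_eqI[of 0 1] by simp
      then show ?thesis using True by (simp add: m_def nodal_coeff_def power2_eq_square)
    next
      case False
      then have "2 \<le> \<beta> j" using \<beta>1[of j] by linarith
      then obtain k where k: "\<beta> j = Suc (Suc k)" using le_Suc_ex[of 2 "\<beta> j"] by auto
      then have "m = 3 * 2 ^ k" by (simp add: m_def)
      then show ?thesis by (simp only: k lev_nodal nodal_coeff_values) (simp add: power2_eq_square Suc_le_eq)
    qed
    then show "1 \<le> m" "lev m = \<beta> j" "(1/2)\<^sup>2 \<le> (nodal_coeff m)\<^sup>2" by blast+
  qed
  define \<alpha> where "\<alpha> i = (if i = j then m else 1)" for i
  have \<mu>: "\<mu> \<le> \<beta>" "\<mu> \<in> multi_indices" using \<beta>1 by (auto simp: \<mu>_def le_fun_def multi_indices_def)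
  then have \<mu>\<Lambda>: "\<mu> \<in> \<Lambda>" using mono \<beta> unfolding monotone_index_set_def by blast
  have norm_\<mu>: "norm_max \<mu> = norm_max \<beta>"
  proof (rule antisym)
    obtain i where "norm_max \<mu> = \<mu> i" using norm_max_attained by blast
    then show "norm_max \<mu> \<le> norm_max \<beta>"
      using le_funD[OF \<mu>(1), of i] le_norm_max[of \<beta> i] by simp
    show "norm_max \<beta> \<le> norm_max \<mu>" using le_norm_max[of \<mu> j] by (simp add: \<mu>_def j)
  qed
  have lev1: "lev 1 = 1" using lev_eqI[of 0 1] by simp
  have \<alpha>_block: "\<alpha> \<in> block_indices \<mu>"
    using m lev1 by (intro block_indicesI) (auto simp: \<alpha>_def \<mu>_def)
  have mass_lower: "1 / (108 ^ CARD('d) * 2 ^ norm_max \<beta>) \<le> (\<Prod>i\<in>UNIV. mass (\<alpha> i) (\<alpha> i))"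
  proof -
    \<comment> \<open>Here 108 = 54 * 2 is the exact bound in the directions of level 1; in
      direction \<open>j\<close> the extra factor 2 is given away.\<close>
    have "1 / (108 ^ CARD('d) * 2 ^ norm_max \<beta>) = (\<Prod>i\<in>UNIV. 1 / (108 * (if i = j then 2 ^ \<beta> j else 1)) :: real)"
      by (simp add: prod_dividef prod.distrib j)
    also have "\<dots> \<le> (\<Prod>i\<in>UNIV. mass (\<alpha> i) (\<alpha> i))"
    proof (intro prod_mono conjI)
      fix i
      have "1 / (108 * (if i = j then 2 ^ \<beta> j else 1)) \<le> 1 / (54 * 2 ^ \<mu> i :: real)"
        by (simp add: \<mu>_def frac_le)
      also have "\<dots> \<le> mass (\<alpha> i) (\<alpha> i)"
        using mass_diag_ge[OF block_indicesD(1)[OF \<alpha>_block, of i]] by (simp only: block_indicesD(2)[OF \<alpha>_block])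
      finally show "1 / (108 * (if i = j then 2 ^ \<beta> j else 1)) \<le> mass (\<alpha> i) (\<alpha> i)" .
    qed simp
    finally show ?thesis .
  qed
  have L2: "(1/2)\<^sup>2 * (1 / (108 ^ CARD('d) * 2 ^ norm_max \<beta>)) \<le> (L2_norm (s \<mu>))\<^sup>2"
  proof -
    have "a \<alpha> = (\<Prod>i\<in>UNIV. if i = j then nodal_coeff m else 1)"
      unfolding a_def by (intro prod.cong refl) (auto simp: \<alpha>_def nodal_coeff_def)
    then have "a \<alpha> = nodal_coeff m" by simp
    moreover have "a' \<alpha> = a \<alpha>" using \<mu>(1) unfolding a'_def block_indices_lev[OF \<alpha>_block] by simp
    ultimately have "(1/2)\<^sup>2 \<le> (a' \<alpha>)\<^sup>2" using m(3) by simp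
    then have "(1/2)\<^sup>2 * (1 / (108 ^ CARD('d) * 2 ^ norm_max \<beta>)) \<le> (a' \<alpha>)\<^sup>2 * (\<Prod>i\<in>UNIV. mass (\<alpha> i) (\<alpha> i))"
      using mass_lower by (intro mult_mono) auto
    also have "\<dots> \<le> (\<Sum>\<alpha>\<in>block_indices \<mu>. (a' \<alpha>)\<^sup>2 * (\<Prod>i\<in>UNIV. mass (\<alpha> i) (\<alpha> i)))"
    proof (rule member_le_sum[OF \<alpha>_block _ finite_block_indices])
      fix \<alpha>' assume "\<alpha>' \<in> block_indices \<mu> - {\<alpha>}"
      then have "\<alpha>' \<in> block_indices \<mu>" by simp
      then have "0 \<le> mass (\<alpha>' i) (\<alpha>' i)" for i
        by (intro order_trans[OF _ mass_diag_ge[OF block_indicesD(1)]]) auto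
      then show "0 \<le> (a' \<alpha>')\<^sup>2 * (\<Prod>i\<in>UNIV. mass (\<alpha>' i) (\<alpha>' i))" by (intro mult_nonneg_nonneg prod_nonneg) auto
    qed
    also have "\<dots> = (L2_norm (s \<mu>))\<^sup>2" unfolding s_def L2_norm_block_square ..
    finally show ?thesis .
  qed
  have "c * (4 ^ norm_max \<beta> * ((1/2)\<^sup>2 * (1 / (108 ^ CARD('d) * 2 ^ norm_max \<beta>)))) \<le> c * (2 ^ (2 * norm_max \<mu>) * (L2_norm (s \<mu>))\<^sup>2)"
    using False by (simp only: norm_\<mu> power_mult) (intro mult_left_mono mult_mono L2, auto)
  also have "\<dots> \<le> c * (\<Sum>\<beta>'\<in>\<Lambda>. 2 ^ (2 * norm_max \<beta>') * (L2_norm (s \<beta>'))\<^sup>2)"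
    using False by (intro mult_left_mono member_le_sum \<mu>\<Lambda> fin) auto
  also have "\<dots> \<le> (H10_norm (\<lambda>x. \<Sum>\<beta>'\<in>\<Lambda>. s \<beta>' x))\<^sup>2"
  proof -
    have "s \<beta>' \<in> block_space \<beta>'" for \<beta>' unfolding s_def block_space_def by blast
    then show ?thesis using stable unfolding stable_with_def by blast
  qed
  also have "\<dots> \<le> P" by (rule H)
  finally have "c * (4 ^ norm_max \<beta> * ((1/2)\<^sup>2 * (1 / (108 ^ CARD('d) * 2 ^ norm_max \<beta>)))) \<le> P" .
  \<comment> \<open>The common factor \<open>4 ^ norm_max \<beta>\<close> of weight and energy
    cancels. The 4 comes from the squared coefficient 1/2, and 2 * 108 = 216 yields the same
    constant as in \<open>stability_estimate\<close>.\<close>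
  then have "c / (4 * 108 ^ CARD('d) * 2 ^ norm_max \<beta>) * 4 ^ norm_max \<beta> \<le> (2 ^ CARD('d) * real CARD('d) / 2 ^ norm_one \<beta>) * 4 ^ norm_max \<beta>"
    by (simp add: P_def power2_eq_square mult_ac)
  then have "c / (4 * 108 ^ CARD('d) * 2 ^ norm_max \<beta>) \<le> 2 ^ CARD('d) * real CARD('d) / 2 ^ norm_one \<beta>"
    by (rule mult_right_le_imp_le) simp
  then have "c * (2 ^ norm_one \<beta> / 2 ^ norm_max \<beta>) \<le> 4 * real CARD('d) * (2 ^ CARD('d) * 108 ^ CARD('d))"
    by (simp add: field_simps)
  also have "2 ^ CARD('d) * 108 ^ CARD('d) = (216 ^ CARD('d) :: real)"
    by (simp flip: power_mult_distrib)
  finally show ?thesis .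
qed

section \<open>The best constant\<close>

text \<open>For each choice of blocks the condition is a linear inequality in \<open>c\<close> with
  nonnegative coefficient \<open>X\<close>, hence closed under suprema. This makes the best constant
  attained.\<close>

lemma stable_with_Sup:
  assumes "\<And>c. c \<in> S \<Longrightarrow> stable_with \<Lambda> c" "S \<noteq> {}" "bdd_above S"
  shows "stable_with \<Lambda> (Sup S)"
  unfolding stable_with_def
proof (intro allI impI)
  fix s assume s: "\<forall>\<beta>\<in>\<Lambda>. s \<beta> \<in> block_space \<beta>"
  define X where "X = (\<Sum>\<beta>\<in>\<Lambda>. 2 ^ (2 * norm_max \<beta>) * (L2_norm (s \<beta>))\<^sup>2)"
  define Y where "Y = (H10_norm (\<lambda>x. \<Sum>\<beta>\<in>\<Lambda>. s \<beta> x))\<^sup>2"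
  have le: "c * X \<le> Y" if "c \<in> S" for c
    using assms(1)[OF that] s unfolding stable_with_def X_def Y_def by blast
  have "0 \<le> X" unfolding X_def by (intro sum_nonneg) auto
  have "Sup S * X \<le> Y"
  proof (cases "X = 0")
    case False
    then have "0 < X" using \<open>0 \<le> X\<close> by simp
    then have "Sup S \<le> Y / X" using le assms(2) by (intro cSup_least) (auto simp: pos_le_divide_eq)
    then show ?thesis using \<open>0 < X\<close> by (simp add: pos_le_divide_eq)
  qed (simp add: Y_def)
  then show "Sup S * (\<Sum>\<beta>\<in>\<Lambda>. 2 ^ (2 * norm_max \<beta>) * (L2_norm (s \<beta>))\<^sup>2) \<le> (H10_norm (\<lambda>x. \<Sum>\<beta>\<in>\<Lambda>. s \<beta> x))\<^sup>2"
    by (simp only: X_def Y_def)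
qed

theorem mainTheorem3:
  assumes "1 < CARD('d::finite)"
  shows "\<exists>c C :: real. 0 < c \<and> 0 < C \<and>
    (\<forall>\<Lambda> :: ('d \<Rightarrow> nat) set. finite \<Lambda> \<and> \<Lambda> \<noteq> {} \<and> monotone_index_set \<Lambda> \<longrightarrow>
      (\<exists>c\<^sub>\<Lambda>. is_best_constant \<Lambda> c\<^sub>\<Lambda> \<and> 0 < c\<^sub>\<Lambda> \<and>
        c * real (n_tilde' \<Lambda>) \<le> inverse c\<^sub>\<Lambda> \<and> inverse c\<^sub>\<Lambda> \<le> C * real (n_tilde \<Lambda>)))"
proof -
  define C :: real where "C = 4 * real CARD('d) * 216 ^ CARD('d)"
  have C: "0 < C" by (simp add: C_def)
  show ?thesis
  \<comment> \<open>Both estimates carry the same constant, so \<open>C\<close> and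
    \<open>1 / C\<close> serve as the two bounds.\<close>
  proof (rule exI[of _ "1 / C"], rule exI[of _ C], intro conjI allI impI)
    fix \<Lambda> :: "('d \<Rightarrow> nat) set"
    assume "finite \<Lambda> \<and> \<Lambda> \<noteq> {} \<and> monotone_index_set \<Lambda>"
    then have \<Lambda>: "finite \<Lambda>" "\<Lambda> \<noteq> {}" "monotone_index_set \<Lambda>" by auto
    define S where "S = {c. stable_with \<Lambda> c}"
    define N N' where "N = real (n_tilde \<Lambda>)" and "N' = real (n_tilde' \<Lambda>)"
    have "0 < (\<Sum>\<beta>\<in>\<Lambda>. 2 ^ norm_one \<beta> / 2 ^ norm_max \<beta> :: real)"
      using \<Lambda> by (intro sum_pos) auto
    also have "\<dots> \<le> 2 ^ CARD('d) * N"
      unfolding N_def by (rule sum_le_n_tilde[OF \<Lambda>(1,3)])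
    finally have N: "0 < N" by (simp add: zero_less_mult_iff)
    have lower: "1 / (C * N) \<in> S"
      unfolding S_def mem_Collect_eq stable_with_def
    proof (intro allI impI)
      fix s assume "\<forall>\<beta>\<in>\<Lambda>. s \<beta> \<in> block_space \<beta>"
      then have "(\<Sum>\<beta>\<in>\<Lambda>. 2 ^ (2 * norm_max \<beta>) * (L2_norm (s \<beta>))\<^sup>2) \<le> C * N * (H10_norm (\<lambda>x. \<Sum>\<beta>\<in>\<Lambda>. s \<beta> x))\<^sup>2"
        unfolding C_def N_def by (intro stability_estimate \<Lambda>) auto
      then show "1 / (C * N) * (\<Sum>\<beta>\<in>\<Lambda>. 2 ^ (2 * norm_max \<beta>) * (L2_norm (s \<beta>))\<^sup>2) \<le> (H10_norm (\<lambda>x. \<Sum>\<beta>\<in>\<Lambda>. s \<beta> x))\<^sup>2"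
        using C N by (simp add: pos_divide_le_eq mult_ac)
    qed
    \<comment> \<open>The maximum is attained at some \<open>\<beta>\<close>; testing at this single
      index both bounds \<open>S\<close> from above, so that \<open>Sup S\<close> exists as a real
      number, and gives the lower estimate of the inverse.\<close>
    have "N' \<in> (\<lambda>\<beta>. 2 ^ norm_one \<beta> / 2 ^ norm_max \<beta>) ` \<Lambda>"
    proof -
      have "n_tilde' \<Lambda> \<in> (\<lambda>\<beta>. 2 ^ (norm_one \<beta> - norm_max \<beta>)) ` \<Lambda>"
        unfolding n_tilde'_def using \<Lambda> by (intro Max_in) auto
      then obtain \<beta> where "\<beta> \<in> \<Lambda>" "n_tilde' \<Lambda> = 2 ^ (norm_one \<beta> - norm_max \<beta>)" by blast
      then show ?thesis unfolding N'_def by (simp only: power_norm_diff) blast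
    qed
    then obtain \<beta> where \<beta>: "\<beta> \<in> \<Lambda>" "N' = 2 ^ norm_one \<beta> / 2 ^ norm_max \<beta>" by blast
    have N': "0 < N'" unfolding \<beta>(2) by simp
    have upper: "c \<le> C / N'" if "c \<in> S" for c
    proof -
      have "c * N' \<le> C"
        using stable_with_upper_bound[OF \<Lambda>(1,3) \<beta>(1)] that unfolding S_def C_def \<beta>(2) by simp
      then show ?thesis using N' by (simp add: pos_le_divide_eq)
    qed
    have bdd: "bdd_above S" using upper by (rule bdd_aboveI)
    have "is_best_constant \<Lambda> (Sup S)"
      unfolding is_best_constant_def
    proof (intro conjI allI impI)
      show "stable_with \<Lambda> (Sup S)"
        using lower by (intro stable_with_Sup bdd) (auto simp: S_def)
      show "c \<le> Sup S" if "stable_with \<Lambda> c" for c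
        using that by (intro cSup_upper bdd) (simp add: S_def)
    qed
    moreover have Sup_ge: "1 / (C * N) \<le> Sup S" by (rule cSup_upper[OF lower bdd])
    have "0 < 1 / (C * N)" using C N by simp
    then have pos: "0 < Sup S" using Sup_ge by linarith
    moreover have "Sup S \<le> C / N'" using lower upper by (intro cSup_least) auto
    then have "1 / C * N' \<le> inverse (Sup S)" using pos C N' by (simp add: field_simps)
    moreover have "inverse (Sup S) \<le> C * N" using Sup_ge pos C N by (simp add: field_simps)
    ultimately show "\<exists>c\<^sub>\<Lambda>. is_best_constant \<Lambda> c\<^sub>\<Lambda> \<and> 0 < c\<^sub>\<Lambda> \<and>
        1 / C * real (n_tilde' \<Lambda>) \<le> inverse c\<^sub>\<Lambda> \<and> inverse c\<^sub>\<Lambda> \<le> C * real (n_tilde \<Lambda>)"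
      unfolding N_def N'_def by blast
  qed (use C in auto)
qed

end
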